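(* Let $\mathbb K$ be a field of characteristic $0$, let $(\mathbf C,\otimes,I,\gamma)$ be a symmetric strict monoidal $\mathrm{Ch}^{[-1,0]}_{\mathbb K}$-category and let $t:\otimes\Rightarrow\otimes$ be a strict infinitesimal 2-braiding on it. Then $$\Big(\mathbf C_{\mathbb K[h]/(h^3)},\ \otimes,\ I,\ \alpha:=1+\tfrac{h^2}{24}[t_{12},t_{23}]\Big)$$ is a pentagonal strictly-unital monoidal $\mathrm{Ch}^{[-1,0]}_{\mathbb K[h]/(h^3)}$-category.
   Context: **Enriched setting.** Let $R$ be a commutative $\mathbb K$-algebra (used for $R=\mathbb K$ and $R=\mathbb K[h]/(h^3)$). $\mathrm{Ch}^{[-1,0]}_R$ denotes cochain complexes of $R$-modules concentrated in degrees $-1,0$, with the truncated tensor product (products of two degree $-1$ elements vanish and $(\partial\phi)\otimes\phi'=\phi\otimes\partial\phi'$ for degree $-1$ elements). Thus a $\mathrm{Ch}^{[-1,0]}_R$-category $\mathbf C$ has $R$-modules $\mathbf C[U,V]^0$ (1-cells) and $\mathbf C[U,V]^{-1}$ (2-cells, or homotopies), $R$-linear maps $\partial:\mathbf C[U,V]^{-1}\to\mathbf C[U,V]^0$, and an $R$-bilinear associative unital degree-preserving composition (juxtaposition) in which composites of two 2-cells vanish, $\partial(f\phi)=f\,\partial\phi$, $\partial(\phi f)=(\partial\phi)f$ and $(\partial\phi)\phi'=\phi\,\partial\phi'$ for 1-cells $f$ and 2-cells $\phi,\phi'$. $\mathbf C\boxtimes\mathbf D$ has pairs $UV$ as objects,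 truncated tensor products as hom complexes, and $(f'\boxtimes g')(f\boxtimes g)=f'f\boxtimes g'g$. $\mathbf C_{\mathbb K[h]/(h^3)}$ has the same objects as $\mathbf C$, with homs tensored with $\mathbb K[h]/(h^3)$ and all structure extended linearly. **Pseudonatural transformations.** For $\mathrm{Ch}^{[-1,0]}_R$-functors $F,G:\mathbf C\to\mathbf D$, a pseudonatural transformation $\xi:F\Rightarrow G$ consists of 1-cells $\xi_U\in\mathbf D[F(U),G(U)]^0$ and $R$-linear maps $f\mapsto\xi_f$, $\mathbf C[U,U']^0\to\mathbf D[F(U),G(U')]^{-1}$, with $G(f)\xi_U-\xi_{U'}F(f)=\partial\xi_f$ for 1-cells $f$, $G(q)\xi_U-\xi_{U'}F(q)=\xi_{\partial q}$ for 2-cells $q$, $\xi_{1_U}=0$, and $\xi_{f'f}=\xi_{f'}F(f)+G(f')\xi_f$. It is $\mathrm{Ch}^{[-1,0]}_R$-natural if all $\xi_f=0$. Vertical composition: $(\theta\xi)_U=\theta_U\xi_U$, $(\theta\xi)_f=\theta_f\xi_U+\theta_{U'}\xi_f$; the identity $1$ has $1_f=0$; sums and scalar multiples are componentwise; $[\xi,\theta]=\xi\theta-\theta\xi$. A pseudonatural isomorphism is one invertible for vertical composition. **Symmetric strict monoidal categories.** $(\mathbf C,\otimes,I,\gamma)$ consists of a $\mathrm{Ch}^{[-1,0]}_R$-category, a strictly associative and strictly unital $\mathrm{Ch}^{[-1,0]}_R$-functor $\otimes:\mathbf C\boxtimes\mathbf C\to\mathbf C$ (on objects $(UV)$; brackets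 in subscripts only record the grouping of arguments), and a $\mathrm{Ch}^{[-1,0]}_R$-natural isomorphism $\gamma_{UV}:(UV)\to(VU)$ with $\gamma_{VU}\gamma_{UV}=1_{(UV)}$ and $\gamma_{U(VW)}=(1_V\otimes\gamma_{UW})(\gamma_{UV}\otimes1_W)$. **Infinitesimal 2-braidings.** An infinitesimal 2-braiding is a pseudonatural transformation $t:\otimes\Rightarrow\otimes$, with components $t_{UV}$ and $t_{f\boxtimes g}\in\mathbf C[(UV),(U'V')]^{-1}$ for $f:U\to U'$, $g:V\to V'$. It is strict if for all objects $U,V,W$ and 1-cells $f:U\to U'$, $g:V\to V'$, $k:W\to W'$: $t_{U(VW)}=t_{UV}\otimes1_W+(\gamma_{VU}\otimes1_W)(1_V\otimes t_{UW})(\gamma_{UV}\otimes1_W)$, $t_{f\boxtimes(g\otimes k)}=t_{f\boxtimes g}\otimes k+(\gamma_{V'U'}\otimes1_{W'})(g\otimes t_{f\boxtimes k})(\gamma_{UV}\otimes1_W)$, $t_{(UV)W}=1_U\otimes t_{VW}+(1_U\otimes\gamma_{WV})(t_{UW}\otimes1_V)(1_U\otimes\gamma_{VW})$, $t_{(f\otimes g)\boxtimes k}=f\otimes t_{g\boxtimes k}+(1_{U'}\otimes\gamma_{W'V'})(t_{f\boxtimes k}\otimes g)(1_U\otimes\gamma_{VW})$. The pseudonatural endomorphisms $t_{12},t_{23}$ of $\otimes^2:\mathbf C^{\boxtimes3}\to\mathbf C$ have components $(t_{12})_{UVW}=t_{UV}\otimes1_W$, $(t_{12})_{f\boxtimes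 g\boxtimes k}=t_{f\boxtimes g}\otimes k$, $(t_{23})_{UVW}=1_U\otimes t_{VW}$, $(t_{23})_{f\boxtimes g\boxtimes k}=f\otimes t_{g\boxtimes k}$. **Pentagonal strictly-unital monoidal category.** $(\mathbf C,\otimes,I,\alpha)$, where $\mathbf C$ is a $\mathrm{Ch}^{[-1,0]}_R$-category, $\otimes:\mathbf C\boxtimes\mathbf C\to\mathbf C$ a $\mathrm{Ch}^{[-1,0]}_R$-functor, $I$ an object, and $\alpha:\otimes(\otimes\boxtimes\mathrm{id})\Rightarrow\otimes(\mathrm{id}\boxtimes\otimes)$ a pseudonatural isomorphism, such that for all objects $U,V,W,X,Y$ and 1-cells $f:U\to U'$, $g:V\to V'$, $k:W\to W'$, $x:X\to X'$: 1. (Unitality) $(IU)=U=(UI)$ and $1_I\otimes f=f=f\otimes1_I$ for all morphisms $f$. 2. (Pentagon, i.e. the pentagonator is trivial) $(1_U\otimes\alpha_{VWX})\alpha_{U(VW)X}(\alpha_{UVW}\otimes1_X)=\alpha_{UV(WX)}\alpha_{(UV)WX}$, and $(f\otimes\alpha_{g\boxtimes k\boxtimes x})\alpha_{U(VW)X}(\alpha_{UVW}\otimes1_X)+(1_{U'}\otimes\alpha_{V'W'X'})\alpha_{f\boxtimes(g\otimes k)\boxtimes x}(\alpha_{UVW}\otimes1_X)+(1_{U'}\otimes\alpha_{V'W'X'})\alpha_{U'(V'W')X'}(\alpha_{f\boxtimes g\boxtimes k}\otimes x)=\alpha_{f\boxtimes g\boxtimes(k\otimes x)}\alpha_{(UV)WX}+\alpha_{U'V'(W'X')}\alpha_{(f\otimes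 g)\boxtimes k\boxtimes x}$. 3. (Associahedron, with trivial pentagonator) $\alpha_{1_U\boxtimes1_V\boxtimes\alpha_{WXY}}\,\alpha_{(UV)(WX)Y}(\alpha_{(UV)WX}\otimes1_Y)+(1_U\otimes\alpha_{VW(XY)})\alpha_{U(VW)(XY)}\,\alpha_{\alpha_{UVW}\boxtimes1_X\boxtimes1_Y}+\big(1_U\otimes[1_V\otimes\alpha_{WXY}]\alpha_{V(WX)Y}\big)\alpha_{1_U\boxtimes\alpha_{VWX}\boxtimes1_Y}\big(\alpha_{U(VW)X}[\alpha_{UVW}\otimes1_X]\otimes1_Y\big)=0$. 4. (Triangle) $\alpha_{UIV}=1_{(UV)}$ and $\alpha_{f\boxtimes1_I\boxtimes g}=0$. (The remaining "prism" axiom says the pentagonator vanishes when a middle argument is $I$, automatic for trivial pentagonator.) *)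

theory Defs
  imports Complex_Main "HOL-Computational_Algebra.Polynomial"
begin

section \<open>Multilinear maps between submodules\<close>

text \<open>
  Modules over a commutative ring are given by a scalar multiplication \<open>s\<close> on an abelian group
  (locale \<^locale>\<open>module\<close>) together with submodules of it.
\<close>

definition linear_on ::
  "('r \<Rightarrow> 'x \<Rightarrow> 'x::ab_group_add) \<Rightarrow> ('r \<Rightarrow> 'y \<Rightarrow> 'y::ab_group_add) \<Rightarrow> 'x set \<Rightarrow> ('x \<Rightarrow> 'y) \<Rightarrow> bool"
  where
  "linear_on s s' M f \<longleftrightarrow>
     (\<forall>x\<in>M. \<forall>y\<in>M. f (x + y) = f x + f y) \<and> (\<forall>r. \<forall>x\<in>M. f (s r x) = s' r (f x))"

definition bilinear_on where
  "bilinear_on s1 s2 s' M1 M2 f \<longleftrightarrow>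
     (\<forall>x\<in>M1. linear_on s2 s' M2 (\<lambda>y. f x y)) \<and>
     (\<forall>y\<in>M2. linear_on s1 s' M1 (\<lambda>x. f x y))"

definition trilinear_on where
  "trilinear_on s1 s2 s3 s' M1 M2 M3 f \<longleftrightarrow>
     (\<forall>x\<in>M1. \<forall>y\<in>M2. linear_on s3 s' M3 (\<lambda>z. f x y z)) \<and>
     (\<forall>x\<in>M1. \<forall>z\<in>M3. linear_on s2 s' M2 (\<lambda>y. f x y z)) \<and>
     (\<forall>y\<in>M2. \<forall>z\<in>M3. linear_on s1 s' M1 (\<lambda>x. f x y z))"


section \<open>Categories enriched in two-term complexes\<close>

text \<open>
  \<open>Hom0 C U V\<close> and \<open>Hom1 C U V\<close> are the hom modules in degrees 0 and -1. They are submodules of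
  ambient modules \<open>'a\<close> and \<open>'b\<close>, shared by all pairs of objects: any family of modules can be
  presented like this inside its direct sum, where two different hom modules share only 0. For the
  same reason compositions, \<open>\<partial>\<close> and tensor products of cells carry no object arguments. They are
  only constrained on the hom modules. Objects are the elements of the type \<open>'o\<close>.

  \<open>g \<cdot> f\<close> is the composite of two 1-cells, \<open>f \<rhd> \<phi>\<close> and \<open>\<phi> \<lhd> f\<close> are the composites of a 1-cell with
  a 2-cell. Composites of two 2-cells would have degree -2 and vanish, so there is no operation
  for them.
\<close>

record ('r, 'o, 'a, 'b) ch_cat =
  Hom0 :: "'o \<Rightarrow> 'o \<Rightarrow> 'a set"
  Hom1 :: "'o \<Rightarrow> 'o \<Rightarrow> 'b set"
  smul0 :: "'r \<Rightarrow> 'a \<Rightarrow> 'a"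
  smul1 :: "'r \<Rightarrow> 'b \<Rightarrow> 'b"
  bdry :: "'b \<Rightarrow> 'a"  ("\<partial>\<index> _" [81] 80)
  ident :: "'o \<Rightarrow> 'a"  ("\<one>\<index> _" [91] 90)
  comp00 :: "'a \<Rightarrow> 'a \<Rightarrow> 'a"  (infixr "\<cdot>\<index>" 70)
  comp01 :: "'a \<Rightarrow> 'b \<Rightarrow> 'b"  (infixr "\<rhd>\<index>" 70)
  comp10 :: "'b \<Rightarrow> 'a \<Rightarrow> 'b"  (infixr "\<lhd>\<index>" 70)

locale ch_category =
  fixes C :: "('r::comm_ring_1, 'o, 'a::ab_group_add, 'b::ab_group_add, 'z) ch_cat_scheme" (structure)
  assumes module0: "module (smul0 C)"
    and module1: "module (smul1 C)"
    and submodule0: "module.subspace (smul0 C) (Hom0 C U V)"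
    and submodule1: "module.subspace (smul1 C) (Hom1 C U V)"
    and bdry_closed: "\<phi> \<in> Hom1 C U V \<Longrightarrow> \<partial> \<phi> \<in> Hom0 C U V"
    and bdry_linear: "linear_on (smul1 C) (smul0 C) (Hom1 C U V) (bdry C)"
    and ident_closed: "\<one> U \<in> Hom0 C U U"
    and comp00_closed: "\<lbrakk>g \<in> Hom0 C V W; f \<in> Hom0 C U V\<rbrakk> \<Longrightarrow> g \<cdot> f \<in> Hom0 C U W"
    and comp01_closed: "\<lbrakk>g \<in> Hom0 C V W; \<phi> \<in> Hom1 C U V\<rbrakk> \<Longrightarrow> g \<rhd> \<phi> \<in> Hom1 C U W"
    and comp10_closed: "\<lbrakk>\<phi> \<in> Hom1 C V W; f \<in> Hom0 C U V\<rbrakk> \<Longrightarrow> \<phi> \<lhd> f \<in> Hom1 C U W"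
    and comp00_bilinear:
      "bilinear_on (smul0 C) (smul0 C) (smul0 C) (Hom0 C V W) (Hom0 C U V) (comp00 C)"
    and comp01_bilinear:
      "bilinear_on (smul0 C) (smul1 C) (smul1 C) (Hom0 C V W) (Hom1 C U V) (comp01 C)"
    and comp10_bilinear:
      "bilinear_on (smul1 C) (smul0 C) (smul1 C) (Hom1 C V W) (Hom0 C U V) (comp10 C)"
    and ident_left0: "f \<in> Hom0 C U V \<Longrightarrow> \<one> V \<cdot> f = f"
    and ident_right0: "f \<in> Hom0 C U V \<Longrightarrow> f \<cdot> \<one> U = f"
    and ident_left1: "\<phi> \<in> Hom1 C U V \<Longrightarrow> \<one> V \<rhd> \<phi> = \<phi>"
    and ident_right1: "\<phi> \<in> Hom1 C U V \<Longrightarrow> \<phi> \<lhd> \<one> U = \<phi>"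
    and assoc000: "\<lbrakk>h \<in> Hom0 C W X; g \<in> Hom0 C V W; f \<in> Hom0 C U V\<rbrakk>
      \<Longrightarrow> (h \<cdot> g) \<cdot> f = h \<cdot> (g \<cdot> f)"
    and assoc100: "\<lbrakk>\<phi> \<in> Hom1 C W X; g \<in> Hom0 C V W; f \<in> Hom0 C U V\<rbrakk>
      \<Longrightarrow> (\<phi> \<lhd> g) \<lhd> f = \<phi> \<lhd> (g \<cdot> f)"
    and assoc010: "\<lbrakk>h \<in> Hom0 C W X; \<phi> \<in> Hom1 C V W; f \<in> Hom0 C U V\<rbrakk>
      \<Longrightarrow> (h \<rhd> \<phi>) \<lhd> f = h \<rhd> (\<phi> \<lhd> f)"
    and assoc001: "\<lbrakk>h \<in> Hom0 C W X; g \<in> Hom0 C V W; \<phi> \<in> Hom1 C U V\<rbrakk>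
      \<Longrightarrow> (h \<cdot> g) \<rhd> \<phi> = h \<rhd> (g \<rhd> \<phi>)"
    and bdry_comp01: "\<lbrakk>g \<in> Hom0 C V W; \<phi> \<in> Hom1 C U V\<rbrakk> \<Longrightarrow> \<partial> (g \<rhd> \<phi>) = g \<cdot> \<partial> \<phi>"
    and bdry_comp10: "\<lbrakk>\<phi> \<in> Hom1 C V W; f \<in> Hom0 C U V\<rbrakk> \<Longrightarrow> \<partial> (\<phi> \<lhd> f) = (\<partial> \<phi>) \<cdot> f"
    and truncation: "\<lbrakk>\<phi> \<in> Hom1 C V W; \<phi>' \<in> Hom1 C U V\<rbrakk> \<Longrightarrow> (\<partial> \<phi>) \<rhd> \<phi>' = \<phi> \<lhd> (\<partial> \<phi>')"


section \<open>Functors and transformations in several variables\<close>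

text \<open>
  An \<open>R\<close>-linear map out of a hom module of \<open>C \<boxtimes> C\<close> is the same thing as a bilinear map, and two
  such maps agree iff they agree on pure tensors. So functors and transformations on \<open>C \<boxtimes> C\<close>
  (\<open>C \<boxtimes> C \<boxtimes> C\<close>) are given by their values on pure tensors, which must be multilinear. The pure
  2-cells of \<open>C \<boxtimes> C\<close> are \<open>\<phi> \<boxtimes> g\<close> and \<open>f \<boxtimes> \<psi>\<close>, with the relation \<open>(\<partial> \<phi>) \<boxtimes> \<psi> = \<phi> \<boxtimes> (\<partial> \<psi>)\<close>
  of the truncated tensor product. In \<open>fun2_10\<close>, \<open>fun3_010\<close> etc., 1 marks the argument that is a
  2-cell.
\<close>

record ('o, 'a, 'b) fun2 =
  fun2_ob :: "'o \<Rightarrow> 'o \<Rightarrow> 'o"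
  fun2_00 :: "'a \<Rightarrow> 'a \<Rightarrow> 'a"
  fun2_10 :: "'b \<Rightarrow> 'a \<Rightarrow> 'b"
  fun2_01 :: "'a \<Rightarrow> 'b \<Rightarrow> 'b"

record ('o, 'a, 'b) fun3 =
  fun3_ob :: "'o \<Rightarrow> 'o \<Rightarrow> 'o \<Rightarrow> 'o"
  fun3_000 :: "'a \<Rightarrow> 'a \<Rightarrow> 'a \<Rightarrow> 'a"
  fun3_100 :: "'b \<Rightarrow> 'a \<Rightarrow> 'a \<Rightarrow> 'b"
  fun3_010 :: "'a \<Rightarrow> 'b \<Rightarrow> 'a \<Rightarrow> 'b"
  fun3_001 :: "'a \<Rightarrow> 'a \<Rightarrow> 'b \<Rightarrow> 'b"

text \<open>
  The data of a transformation \<open>\<xi>\<close>: \<open>at_ob \<xi> s\<close> is its 1-cell at the object \<open>s\<close> (a pair or triple of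
  objects), \<open>along \<xi> s s' p\<close> its 2-cell at the pure tensor \<open>p\<close> (a pair or triple of 1-cells) from
  \<open>s\<close> to \<open>s'\<close>. The objects are arguments because the vertical composite refers to them.
\<close>

record ('s, 'p, 'a, 'b) transf =
  at_ob :: "'s \<Rightarrow> 'a"
  along :: "'s \<Rightarrow> 's \<Rightarrow> 'p \<Rightarrow> 'b"

type_synonym ('o, 'a, 'b) transf2 = "('o \<times> 'o, 'a \<times> 'a, 'a, 'b) transf"
type_synonym ('o, 'a, 'b) transf3 = "('o \<times> 'o \<times> 'o, 'a \<times> 'a \<times> 'a, 'a, 'b) transf"

definition tr_ident :: "('r, 'o, 'a, 'b::zero, 'z) ch_cat_scheme \<Rightarrow> ('s \<Rightarrow> 'o) \<Rightarrow> ('s, 'p, 'a, 'b) transf"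
  where "tr_ident C F = \<lparr>at_ob = (\<lambda>s. ident C (F s)), along = (\<lambda>s s' p. 0)\<rparr>"

definition tr_vcomp :: "('r, 'o, 'a, 'b::plus, 'z) ch_cat_scheme \<Rightarrow>
    ('s, 'p, 'a, 'b) transf \<Rightarrow> ('s, 'p, 'a, 'b) transf \<Rightarrow> ('s, 'p, 'a, 'b) transf"
  where
  "tr_vcomp C \<theta> \<xi> =
     \<lparr>at_ob = (\<lambda>s. at_ob \<theta> s \<cdot>\<^bsub>C\<^esub> at_ob \<xi> s),
      along = (\<lambda>s s' p. (along \<theta> s s' p \<lhd>\<^bsub>C\<^esub> at_ob \<xi> s) + (at_ob \<theta> s' \<rhd>\<^bsub>C\<^esub> along \<xi> s s' p))\<rparr>"

definition tr_add ::
  "('s, 'p, 'a::plus, 'b::plus) transf \<Rightarrow> ('s, 'p, 'a, 'b) transf \<Rightarrow> ('s, 'p, 'a, 'b) transf"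
  where
  "tr_add \<xi> \<theta> =
     \<lparr>at_ob = (\<lambda>s. at_ob \<xi> s + at_ob \<theta> s), along = (\<lambda>s s' p. along \<xi> s s' p + along \<theta> s s' p)\<rparr>"

definition tr_diff ::
  "('s, 'p, 'a::minus, 'b::minus) transf \<Rightarrow> ('s, 'p, 'a, 'b) transf \<Rightarrow> ('s, 'p, 'a, 'b) transf"
  where
  "tr_diff \<xi> \<theta> =
     \<lparr>at_ob = (\<lambda>s. at_ob \<xi> s - at_ob \<theta> s), along = (\<lambda>s s' p. along \<xi> s s' p - along \<theta> s s' p)\<rparr>"

definition tr_smul ::
  "('r, 'o, 'a, 'b, 'z) ch_cat_scheme \<Rightarrow> 'r \<Rightarrow> ('s, 'p, 'a, 'b) transf \<Rightarrow> ('s, 'p, 'a, 'b) transf"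
  where
  "tr_smul C r \<xi> =
     \<lparr>at_ob = (\<lambda>s. smul0 C r (at_ob \<xi> s)), along = (\<lambda>s s' p. smul1 C r (along \<xi> s s' p))\<rparr>"

definition tr_commutator where
  "tr_commutator C \<xi> \<theta> = tr_diff (tr_vcomp C \<xi> \<theta>) (tr_vcomp C \<theta> \<xi>)"

locale pseudonatural2 =
  fixes C :: "('r::comm_ring_1, 'o, 'a::ab_group_add, 'b::ab_group_add, 'z) ch_cat_scheme" (structure)
    and F G :: "('o, 'a, 'b) fun2"
    and \<xi> :: "('o, 'a, 'b) transf2"
  assumes at_closed: "at_ob \<xi> (U,V) \<in> Hom0 C (fun2_ob F U V) (fun2_ob G U V)"
    and along_closed: "\<lbrakk>f \<in> Hom0 C U U'; g \<in> Hom0 C V V'\<rbrakk>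
      \<Longrightarrow> along \<xi> (U,V) (U',V') (f,g) \<in> Hom1 C (fun2_ob F U V) (fun2_ob G U' V')"
    and along_bilinear: "bilinear_on (smul0 C) (smul0 C) (smul1 C) (Hom0 C U U') (Hom0 C V V')
      (\<lambda>f g. along \<xi> (U,V) (U',V') (f,g))"
    and natural_00: "\<lbrakk>f \<in> Hom0 C U U'; g \<in> Hom0 C V V'\<rbrakk>
      \<Longrightarrow> (fun2_00 G f g \<cdot> at_ob \<xi> (U,V)) - (at_ob \<xi> (U',V') \<cdot> fun2_00 F f g)
          = \<partial> (along \<xi> (U,V) (U',V') (f,g))"
    and natural_10: "\<lbrakk>\<phi> \<in> Hom1 C U U'; g \<in> Hom0 C V V'\<rbrakk>
      \<Longrightarrow> (fun2_10 G \<phi> g \<lhd> at_ob \<xi> (U,V)) - (at_ob \<xi> (U',V') \<rhd> fun2_10 F \<phi> g)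
          = along \<xi> (U,V) (U',V') (\<partial> \<phi>, g)"
    and natural_01: "\<lbrakk>f \<in> Hom0 C U U'; \<phi> \<in> Hom1 C V V'\<rbrakk>
      \<Longrightarrow> (fun2_01 G f \<phi> \<lhd> at_ob \<xi> (U,V)) - (at_ob \<xi> (U',V') \<rhd> fun2_01 F f \<phi>)
          = along \<xi> (U,V) (U',V') (f, \<partial> \<phi>)"
    and along_ident: "along \<xi> (U,V) (U,V) (\<one> U, \<one> V) = 0"
    and along_comp: "\<lbrakk>f \<in> Hom0 C U U'; f' \<in> Hom0 C U' U''; g \<in> Hom0 C V V'; g' \<in> Hom0 C V' V''\<rbrakk>
      \<Longrightarrow> along \<xi> (U,V) (U'',V'') (f' \<cdot> f, g' \<cdot> g)
          = (along \<xi> (U',V') (U'',V'') (f',g') \<lhd> fun2_00 F f g)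
            + (fun2_00 G f' g' \<rhd> along \<xi> (U,V) (U',V') (f,g))"

locale pseudonatural3 =
  fixes C :: "('r::comm_ring_1, 'o, 'a::ab_group_add, 'b::ab_group_add, 'z) ch_cat_scheme" (structure)
    and F G :: "('o, 'a, 'b) fun3"
    and \<xi> :: "('o, 'a, 'b) transf3"
  assumes at_closed: "at_ob \<xi> (U,V,W) \<in> Hom0 C (fun3_ob F U V W) (fun3_ob G U V W)"
    and along_closed: "\<lbrakk>f \<in> Hom0 C U U'; g \<in> Hom0 C V V'; k \<in> Hom0 C W W'\<rbrakk>
      \<Longrightarrow> along \<xi> (U,V,W) (U',V',W') (f,g,k) \<in> Hom1 C (fun3_ob F U V W) (fun3_ob G U' V' W')"
    and along_trilinear: "trilinear_on (smul0 C) (smul0 C) (smul0 C) (smul1 C)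
      (Hom0 C U U') (Hom0 C V V') (Hom0 C W W')
      (\<lambda>f g k. along \<xi> (U,V,W) (U',V',W') (f,g,k))"
    and natural_000: "\<lbrakk>f \<in> Hom0 C U U'; g \<in> Hom0 C V V'; k \<in> Hom0 C W W'\<rbrakk>
      \<Longrightarrow> (fun3_000 G f g k \<cdot> at_ob \<xi> (U,V,W)) - (at_ob \<xi> (U',V',W') \<cdot> fun3_000 F f g k)
          = \<partial> (along \<xi> (U,V,W) (U',V',W') (f,g,k))"
    and natural_100: "\<lbrakk>\<phi> \<in> Hom1 C U U'; g \<in> Hom0 C V V'; k \<in> Hom0 C W W'\<rbrakk>
      \<Longrightarrow> (fun3_100 G \<phi> g k \<lhd> at_ob \<xi> (U,V,W)) - (at_ob \<xi> (U',V',W') \<rhd> fun3_100 F \<phi> g k)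
          = along \<xi> (U,V,W) (U',V',W') (\<partial> \<phi>, g, k)"
    and natural_010: "\<lbrakk>f \<in> Hom0 C U U'; \<phi> \<in> Hom1 C V V'; k \<in> Hom0 C W W'\<rbrakk>
      \<Longrightarrow> (fun3_010 G f \<phi> k \<lhd> at_ob \<xi> (U,V,W)) - (at_ob \<xi> (U',V',W') \<rhd> fun3_010 F f \<phi> k)
          = along \<xi> (U,V,W) (U',V',W') (f, \<partial> \<phi>, k)"
    and natural_001: "\<lbrakk>f \<in> Hom0 C U U'; g \<in> Hom0 C V V'; \<phi> \<in> Hom1 C W W'\<rbrakk>
      \<Longrightarrow> (fun3_001 G f g \<phi> \<lhd> at_ob \<xi> (U,V,W)) - (at_ob \<xi> (U',V',W') \<rhd> fun3_001 F f g \<phi>)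
          = along \<xi> (U,V,W) (U',V',W') (f, g, \<partial> \<phi>)"
    and along_ident: "along \<xi> (U,V,W) (U,V,W) (\<one> U, \<one> V, \<one> W) = 0"
    and along_comp: "\<lbrakk>f \<in> Hom0 C U U'; f' \<in> Hom0 C U' U''; g \<in> Hom0 C V V'; g' \<in> Hom0 C V' V'';
        k \<in> Hom0 C W W'; k' \<in> Hom0 C W' W''\<rbrakk>
      \<Longrightarrow> along \<xi> (U,V,W) (U'',V'',W'') (f' \<cdot> f, g' \<cdot> g, k' \<cdot> k)
          = (along \<xi> (U',V',W') (U'',V'',W'') (f',g',k') \<lhd> fun3_000 F f g k)
            + (fun3_000 G f' g' k' \<rhd> along \<xi> (U,V,W) (U',V',W') (f,g,k))"

text \<open>Equality of transformations, ignoring values outside the hom modules.\<close>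

definition tr_eq3 :: "('r, 'o, 'a, 'b, 'z) ch_cat_scheme \<Rightarrow>
    ('o, 'a, 'b) transf3 \<Rightarrow> ('o, 'a, 'b) transf3 \<Rightarrow> bool"
  where
  "tr_eq3 C \<xi> \<theta> \<longleftrightarrow> (\<forall>s. at_ob \<xi> s = at_ob \<theta> s) \<and>
     (\<forall>U V W U' V' W'. \<forall>f \<in> Hom0 C U U'. \<forall>g \<in> Hom0 C V V'. \<forall>k \<in> Hom0 C W W'.
        along \<xi> (U,V,W) (U',V',W') (f,g,k) = along \<theta> (U,V,W) (U',V',W') (f,g,k))"

definition tr_ident3 where
  "tr_ident3 C F = tr_ident C (\<lambda>(U,V,W). fun3_ob F U V W)"

definition pseudonatural_iso3 where
  "pseudonatural_iso3 C F G \<xi> \<longleftrightarrow> pseudonatural3 C F G \<xi> \<and>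
     (\<exists>\<eta>. pseudonatural3 C G F \<eta> \<and>
        tr_eq3 C (tr_vcomp C \<eta> \<xi>) (tr_ident3 C F) \<and> tr_eq3 C (tr_vcomp C \<xi> \<eta>) (tr_ident3 C G))"


section \<open>Monoidal structures\<close>

text \<open>
  \<open>f \<otimes> g\<close> is the tensor product of 1-cells; \<open>\<phi> \<ltimes> g\<close> and \<open>f \<rtimes> \<psi>\<close> are the tensor products of a
  2-cell with a 1-cell and of a 1-cell with a 2-cell.
\<close>

record ('r, 'o, 'a, 'b) mon_cat = "('r, 'o, 'a, 'b) ch_cat" +
  tens_ob :: "'o \<Rightarrow> 'o \<Rightarrow> 'o"  (infixr "\<odot>\<index>" 75)
  tens00 :: "'a \<Rightarrow> 'a \<Rightarrow> 'a"  (infixr "\<otimes>\<index>" 75)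
  tens10 :: "'b \<Rightarrow> 'a \<Rightarrow> 'b"  (infixr "\<ltimes>\<index>" 75)
  tens01 :: "'a \<Rightarrow> 'b \<Rightarrow> 'b"  (infixr "\<rtimes>\<index>" 75)
  unit_ob :: "'o"  ("\<I>\<index>")

text \<open>
  \<open>\<otimes>\<close> is a functor \<open>C \<boxtimes> C \<Rightarrow> C\<close>.
\<close>

locale ch_tensor = ch_category C
  for C :: "('r::comm_ring_1, 'o, 'a::ab_group_add, 'b::ab_group_add, 'z) mon_cat_scheme" (structure) +
  assumes tens00_closed: "\<lbrakk>f \<in> Hom0 C U U'; g \<in> Hom0 C V V'\<rbrakk> \<Longrightarrow> f \<otimes> g \<in> Hom0 C (U \<odot> V) (U' \<odot> V')"
    and tens10_closed: "\<lbrakk>\<phi> \<in> Hom1 C U U'; g \<in> Hom0 C V V'\<rbrakk> \<Longrightarrow> \<phi> \<ltimes> g \<in> Hom1 C (U \<odot> V) (U' \<odot> V')"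
    and tens01_closed: "\<lbrakk>f \<in> Hom0 C U U'; \<psi> \<in> Hom1 C V V'\<rbrakk> \<Longrightarrow> f \<rtimes> \<psi> \<in> Hom1 C (U \<odot> V) (U' \<odot> V')"
    and tens00_bilinear:
      "bilinear_on (smul0 C) (smul0 C) (smul0 C) (Hom0 C U U') (Hom0 C V V') (tens00 C)"
    and tens10_bilinear:
      "bilinear_on (smul1 C) (smul0 C) (smul1 C) (Hom1 C U U') (Hom0 C V V') (tens10 C)"
    and tens01_bilinear:
      "bilinear_on (smul0 C) (smul1 C) (smul1 C) (Hom0 C U U') (Hom1 C V V') (tens01 C)"
    and tens_truncation: "\<lbrakk>\<phi> \<in> Hom1 C U U'; \<psi> \<in> Hom1 C V V'\<rbrakk> \<Longrightarrow> (\<partial> \<phi>) \<rtimes> \<psi> = \<phi> \<ltimes> (\<partial> \<psi>)"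
    and bdry_tens10: "\<lbrakk>\<phi> \<in> Hom1 C U U'; g \<in> Hom0 C V V'\<rbrakk> \<Longrightarrow> \<partial> (\<phi> \<ltimes> g) = (\<partial> \<phi>) \<otimes> g"
    and bdry_tens01: "\<lbrakk>f \<in> Hom0 C U U'; \<psi> \<in> Hom1 C V V'\<rbrakk> \<Longrightarrow> \<partial> (f \<rtimes> \<psi>) = f \<otimes> (\<partial> \<psi>)"
    and tens_ident: "\<one> U \<otimes> \<one> V = \<one> (U \<odot> V)"
    and interchange_00_00:
      "\<lbrakk>f \<in> Hom0 C U U'; f' \<in> Hom0 C U' U''; g \<in> Hom0 C V V'; g' \<in> Hom0 C V' V''\<rbrakk>
        \<Longrightarrow> (f' \<otimes> g') \<cdot> (f \<otimes> g) = (f' \<cdot> f) \<otimes> (g' \<cdot> g)"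
    and interchange_00_10:
      "\<lbrakk>\<phi> \<in> Hom1 C U U'; f' \<in> Hom0 C U' U''; g \<in> Hom0 C V V'; g' \<in> Hom0 C V' V''\<rbrakk>
        \<Longrightarrow> (f' \<otimes> g') \<rhd> (\<phi> \<ltimes> g) = (f' \<rhd> \<phi>) \<ltimes> (g' \<cdot> g)"
    and interchange_00_01:
      "\<lbrakk>f \<in> Hom0 C U U'; f' \<in> Hom0 C U' U''; \<psi> \<in> Hom1 C V V'; g' \<in> Hom0 C V' V''\<rbrakk>
        \<Longrightarrow> (f' \<otimes> g') \<rhd> (f \<rtimes> \<psi>) = (f' \<cdot> f) \<rtimes> (g' \<rhd> \<psi>)"
    and interchange_10_00:
      "\<lbrakk>f \<in> Hom0 C U U'; \<phi>' \<in> Hom1 C U' U''; g \<in> Hom0 C V V'; g' \<in> Hom0 C V' V''\<rbrakk>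
        \<Longrightarrow> (\<phi>' \<ltimes> g') \<lhd> (f \<otimes> g) = (\<phi>' \<lhd> f) \<ltimes> (g' \<cdot> g)"
    and interchange_01_00:
      "\<lbrakk>f \<in> Hom0 C U U'; f' \<in> Hom0 C U' U''; g \<in> Hom0 C V V'; \<psi>' \<in> Hom1 C V' V''\<rbrakk>
        \<Longrightarrow> (f' \<rtimes> \<psi>') \<lhd> (f \<otimes> g) = (f' \<cdot> f) \<rtimes> (\<psi>' \<lhd> g)"

definition tensor :: "('r, 'o, 'a, 'b, 'z) mon_cat_scheme \<Rightarrow> ('o, 'a, 'b) fun2" where
  "tensor C = \<lparr>fun2_ob = tens_ob C, fun2_00 = tens00 C, fun2_10 = tens10 C, fun2_01 = tens01 C\<rparr>"

definition tensor_flip :: "('r, 'o, 'a, 'b, 'z) mon_cat_scheme \<Rightarrow> ('o, 'a, 'b) fun2" where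
  "tensor_flip C =
     \<lparr>fun2_ob = (\<lambda>U V. V \<odot>\<^bsub>C\<^esub> U),
      fun2_00 = (\<lambda>f g. g \<otimes>\<^bsub>C\<^esub> f),
      fun2_10 = (\<lambda>\<phi> g. g \<rtimes>\<^bsub>C\<^esub> \<phi>),
      fun2_01 = (\<lambda>f \<psi>. \<psi> \<ltimes>\<^bsub>C\<^esub> f)\<rparr>"

text \<open>The functors \<open>\<otimes>(\<otimes> \<boxtimes> id)\<close> and \<open>\<otimes>(id \<boxtimes> \<otimes>)\<close>.\<close>

definition tensor_left :: "('r, 'o, 'a, 'b, 'z) mon_cat_scheme \<Rightarrow> ('o, 'a, 'b) fun3" where
  "tensor_left C =
     \<lparr>fun3_ob = (\<lambda>U V W. (U \<odot>\<^bsub>C\<^esub> V) \<odot>\<^bsub>C\<^esub> W),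
      fun3_000 = (\<lambda>f g k. (f \<otimes>\<^bsub>C\<^esub> g) \<otimes>\<^bsub>C\<^esub> k),
      fun3_100 = (\<lambda>\<phi> g k. (\<phi> \<ltimes>\<^bsub>C\<^esub> g) \<ltimes>\<^bsub>C\<^esub> k),
      fun3_010 = (\<lambda>f \<phi> k. (f \<rtimes>\<^bsub>C\<^esub> \<phi>) \<ltimes>\<^bsub>C\<^esub> k),
      fun3_001 = (\<lambda>f g \<phi>. (f \<otimes>\<^bsub>C\<^esub> g) \<rtimes>\<^bsub>C\<^esub> \<phi>)\<rparr>"

definition tensor_right :: "('r, 'o, 'a, 'b, 'z) mon_cat_scheme \<Rightarrow> ('o, 'a, 'b) fun3" where
  "tensor_right C =
     \<lparr>fun3_ob = (\<lambda>U V W. U \<odot>\<^bsub>C\<^esub> (V \<odot>\<^bsub>C\<^esub> W)),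
      fun3_000 = (\<lambda>f g k. f \<otimes>\<^bsub>C\<^esub> (g \<otimes>\<^bsub>C\<^esub> k)),
      fun3_100 = (\<lambda>\<phi> g k. \<phi> \<ltimes>\<^bsub>C\<^esub> (g \<otimes>\<^bsub>C\<^esub> k)),
      fun3_010 = (\<lambda>f \<phi> k. f \<rtimes>\<^bsub>C\<^esub> (\<phi> \<ltimes>\<^bsub>C\<^esub> k)),
      fun3_001 = (\<lambda>f g \<phi>. f \<rtimes>\<^bsub>C\<^esub> (g \<rtimes>\<^bsub>C\<^esub> \<phi>))\<rparr>"

locale strictly_unital_tensor = ch_tensor C
  for C :: "('r::comm_ring_1, 'o, 'a::ab_group_add, 'b::ab_group_add, 'z) mon_cat_scheme" (structure) +
  assumes unit_ob_left: "\<I> \<odot> U = U"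
    and unit_ob_right: "U \<odot> \<I> = U"
    and unit_left0: "f \<in> Hom0 C U V \<Longrightarrow> \<one> \<I> \<otimes> f = f"
    and unit_right0: "f \<in> Hom0 C U V \<Longrightarrow> f \<otimes> \<one> \<I> = f"
    and unit_left1: "\<phi> \<in> Hom1 C U V \<Longrightarrow> \<one> \<I> \<rtimes> \<phi> = \<phi>"
    and unit_right1: "\<phi> \<in> Hom1 C U V \<Longrightarrow> \<phi> \<ltimes> \<one> \<I> = \<phi>"

text \<open>
  The symmetry \<open>\<gamma>\<close> is enriched-natural, i.e. pseudonatural with zero 2-cells. Its inverse is \<open>\<gamma>\<close>
  itself by \<open>symmetry_involutive\<close>.
\<close>

locale symmetric_strict_monoidal = strictly_unital_tensor C
  for C :: "('r::comm_ring_1, 'o, 'a::ab_group_add, 'b::ab_group_add, 'z) mon_cat_scheme" (structure) +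
  fixes \<gamma> :: "'o \<times> 'o \<Rightarrow> 'a"
  assumes assoc_ob: "(U \<odot> V) \<odot> W = U \<odot> (V \<odot> W)"
    and tens_assoc000: "\<lbrakk>f \<in> Hom0 C U U'; g \<in> Hom0 C V V'; k \<in> Hom0 C W W'\<rbrakk>
      \<Longrightarrow> (f \<otimes> g) \<otimes> k = f \<otimes> (g \<otimes> k)"
    and tens_assoc100: "\<lbrakk>\<phi> \<in> Hom1 C U U'; g \<in> Hom0 C V V'; k \<in> Hom0 C W W'\<rbrakk>
      \<Longrightarrow> (\<phi> \<ltimes> g) \<ltimes> k = \<phi> \<ltimes> (g \<otimes> k)"
    and tens_assoc010: "\<lbrakk>f \<in> Hom0 C U U'; \<phi> \<in> Hom1 C V V'; k \<in> Hom0 C W W'\<rbrakk>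
      \<Longrightarrow> (f \<rtimes> \<phi>) \<ltimes> k = f \<rtimes> (\<phi> \<ltimes> k)"
    and tens_assoc001: "\<lbrakk>f \<in> Hom0 C U U'; g \<in> Hom0 C V V'; \<phi> \<in> Hom1 C W W'\<rbrakk>
      \<Longrightarrow> (f \<otimes> g) \<rtimes> \<phi> = f \<rtimes> (g \<rtimes> \<phi>)"
    and symmetry_natural:
      "pseudonatural2 C (tensor C) (tensor_flip C) \<lparr>at_ob = \<gamma>, along = (\<lambda>s s' p. 0)\<rparr>"
    and symmetry_involutive: "\<gamma> (V,U) \<cdot> \<gamma> (U,V) = \<one> (U \<odot> V)"
    and symmetry_hexagon: "\<gamma> (U, V \<odot> W) = (\<one> V \<otimes> \<gamma> (U,W)) \<cdot> (\<gamma> (U,V) \<otimes> \<one> W)"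

locale strict_infinitesimal_2braiding =
  fixes C :: "('r::comm_ring_1, 'o, 'a::ab_group_add, 'b::ab_group_add, 'z) mon_cat_scheme" (structure)
    and \<gamma> :: "'o \<times> 'o \<Rightarrow> 'a"
    and t :: "('o, 'a, 'b) transf2"
  assumes pseudonatural: "pseudonatural2 C (tensor C) (tensor C) t"
    and strict_right_at: "at_ob t (U, V \<odot> W)
      = at_ob t (U,V) \<otimes> \<one> W
        + ((\<gamma> (V,U) \<otimes> \<one> W) \<cdot> (\<one> V \<otimes> at_ob t (U,W)) \<cdot> (\<gamma> (U,V) \<otimes> \<one> W))"
    and strict_right_along: "\<lbrakk>f \<in> Hom0 C U U'; g \<in> Hom0 C V V'; k \<in> Hom0 C W W'\<rbrakk>
      \<Longrightarrow> along t (U, V \<odot> W) (U', V' \<odot> W') (f, g \<otimes> k)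
      = along t (U,V) (U',V') (f,g) \<ltimes> k
        + ((\<gamma> (V',U') \<otimes> \<one> W') \<rhd> (g \<rtimes> along t (U,W) (U',W') (f,k)) \<lhd> (\<gamma> (U,V) \<otimes> \<one> W))"
    and strict_left_at: "at_ob t (U \<odot> V, W)
      = \<one> U \<otimes> at_ob t (V,W)
        + ((\<one> U \<otimes> \<gamma> (W,V)) \<cdot> (at_ob t (U,W) \<otimes> \<one> V) \<cdot> (\<one> U \<otimes> \<gamma> (V,W)))"
    and strict_left_along: "\<lbrakk>f \<in> Hom0 C U U'; g \<in> Hom0 C V V'; k \<in> Hom0 C W W'\<rbrakk>
      \<Longrightarrow> along t (U \<odot> V, W) (U' \<odot> V', W') (f \<otimes> g, k)
      = f \<rtimes> along t (V,W) (V',W') (g,k)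
        + ((\<one> U' \<otimes> \<gamma> (W',V')) \<rhd> (along t (U,W) (U',W') (f,k) \<ltimes> g) \<lhd> (\<one> U \<otimes> \<gamma> (V,W)))"

definition t12 :: "('r, 'o, 'a, 'b, 'z) mon_cat_scheme \<Rightarrow> ('o, 'a, 'b) transf2 \<Rightarrow> ('o, 'a, 'b) transf3"
  where
  "t12 C t =
     \<lparr>at_ob = (\<lambda>(U,V,W). at_ob t (U,V) \<otimes>\<^bsub>C\<^esub> \<one>\<^bsub>C\<^esub> W),
      along = (\<lambda>(U,V,W) (U',V',W') (f,g,k). along t (U,V) (U',V') (f,g) \<ltimes>\<^bsub>C\<^esub> k)\<rparr>"

definition t23 :: "('r, 'o, 'a, 'b, 'z) mon_cat_scheme \<Rightarrow> ('o, 'a, 'b) transf2 \<Rightarrow> ('o, 'a, 'b) transf3"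
  where
  "t23 C t =
     \<lparr>at_ob = (\<lambda>(U,V,W). \<one>\<^bsub>C\<^esub> U \<otimes>\<^bsub>C\<^esub> at_ob t (V,W)),
      along = (\<lambda>(U,V,W) (U',V',W') (f,g,k). f \<rtimes>\<^bsub>C\<^esub> along t (V,W) (V',W') (g,k))\<rparr>"

locale pentagonal_monoidal = strictly_unital_tensor C
  for C :: "('r::comm_ring_1, 'o, 'a::ab_group_add, 'b::ab_group_add, 'z) mon_cat_scheme" (structure) +
  fixes \<alpha> :: "('o, 'a, 'b) transf3"
  assumes associator_iso: "pseudonatural_iso3 C (tensor_left C) (tensor_right C) \<alpha>"
    and pentagon_at:
      "(\<one> U \<otimes> at_ob \<alpha> (V,W,X)) \<cdot> at_ob \<alpha> (U, V \<odot> W, X) \<cdot> (at_ob \<alpha> (U,V,W) \<otimes> \<one> X)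
       = at_ob \<alpha> (U, V, W \<odot> X) \<cdot> at_ob \<alpha> (U \<odot> V, W, X)"
    and pentagon_along:
      "\<lbrakk>f \<in> Hom0 C U U'; g \<in> Hom0 C V V'; k \<in> Hom0 C W W'; x \<in> Hom0 C X X'\<rbrakk> \<Longrightarrow>
         ((f \<rtimes> along \<alpha> (V,W,X) (V',W',X') (g,k,x))
            \<lhd> (at_ob \<alpha> (U, V \<odot> W, X) \<cdot> (at_ob \<alpha> (U,V,W) \<otimes> \<one> X)))
       + ((\<one> U' \<otimes> at_ob \<alpha> (V',W',X'))
            \<rhd> along \<alpha> (U, V \<odot> W, X) (U', V' \<odot> W', X') (f, g \<otimes> k, x)
            \<lhd> (at_ob \<alpha> (U,V,W) \<otimes> \<one> X))
       + (((\<one> U' \<otimes> at_ob \<alpha> (V',W',X')) \<cdot> at_ob \<alpha> (U', V' \<odot> W', X'))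
            \<rhd> (along \<alpha> (U,V,W) (U',V',W') (f,g,k) \<ltimes> x))
       = (along \<alpha> (U, V, W \<odot> X) (U', V', W' \<odot> X') (f, g, k \<otimes> x) \<lhd> at_ob \<alpha> (U \<odot> V, W, X))
       + (at_ob \<alpha> (U', V', W' \<odot> X') \<rhd> along \<alpha> (U \<odot> V, W, X) (U' \<odot> V', W', X') (f \<otimes> g, k, x))"
    and associahedron:
      "  (along \<alpha> (U, V, (W \<odot> X) \<odot> Y) (U, V, W \<odot> (X \<odot> Y)) (\<one> U, \<one> V, at_ob \<alpha> (W,X,Y))
            \<lhd> (at_ob \<alpha> (U \<odot> V, W \<odot> X, Y) \<cdot> (at_ob \<alpha> (U \<odot> V, W, X) \<otimes> \<one> Y)))
       + (((\<one> U \<otimes> at_ob \<alpha> (V, W, X \<odot> Y)) \<cdot> at_ob \<alpha> (U, V \<odot> W, X \<odot> Y))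
            \<rhd> along \<alpha> ((U \<odot> V) \<odot> W, X, Y) (U \<odot> (V \<odot> W), X, Y) (at_ob \<alpha> (U,V,W), \<one> X, \<one> Y))
       + ((\<one> U \<otimes> ((\<one> V \<otimes> at_ob \<alpha> (W,X,Y)) \<cdot> at_ob \<alpha> (V, W \<odot> X, Y)))
            \<rhd> along \<alpha> (U, (V \<odot> W) \<odot> X, Y) (U, V \<odot> (W \<odot> X), Y) (\<one> U, at_ob \<alpha> (V,W,X), \<one> Y)
            \<lhd> ((at_ob \<alpha> (U, V \<odot> W, X) \<cdot> (at_ob \<alpha> (U,V,W) \<otimes> \<one> X)) \<otimes> \<one> Y))
       = 0"
    and triangle_at: "at_ob \<alpha> (U, \<I>, V) = \<one> (U \<odot> V)"
    and triangle_along: "\<lbrakk>f \<in> Hom0 C U U'; g \<in> Hom0 C V V'\<rbrakk>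
      \<Longrightarrow> along \<alpha> (U, \<I>, V) (U', \<I>, V') (f, \<one> \<I>, g) = 0"


section \<open>Extension of scalars to $K[h]/(h^3)$\<close>

text \<open>
  Since \<open>K[h]/(h^3)\<close> is free over \<open>K\<close> with basis \<open>1, h, h^2\<close>, we have
  \<open>M \<otimes> K[h]/(h^3) = M \<oplus> M h \<oplus> M h^2\<close>. Its elements \<open>m0 + m1 h + m2 h^2\<close> are written
  \<open>Trunc m0 m1 m2\<close>; the case \<open>M = K\<close> is the ring itself.
\<close>

datatype 'x trunc = Trunc (cf0: 'x) (cf1: 'x) (cf2: 'x)

definition trunc_mult :: "('x \<Rightarrow> 'y \<Rightarrow> 'z::plus) \<Rightarrow> 'x trunc \<Rightarrow> 'y trunc \<Rightarrow> 'z trunc" where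
  "trunc_mult m p q =
     Trunc (m (cf0 p) (cf0 q))
           (m (cf0 p) (cf1 q) + m (cf1 p) (cf0 q))
           (m (cf0 p) (cf2 q) + m (cf1 p) (cf1 q) + m (cf2 p) (cf0 q))"

definition trunc_const :: "'x::zero \<Rightarrow> 'x trunc" where
  "trunc_const x = Trunc x 0 0"

instantiation trunc :: (ab_group_add) ab_group_add
begin
definition "0 = Trunc 0 0 0"
definition "p + q = Trunc (cf0 p + cf0 q) (cf1 p + cf1 q) (cf2 p + cf2 q)"
definition "p - q = Trunc (cf0 p - cf0 q) (cf1 p - cf1 q) (cf2 p - cf2 q)"
definition "- p = Trunc (- cf0 p) (- cf1 p) (- cf2 p)"
instance
  by standard (simp_all add: zero_trunc_def plus_trunc_def minus_trunc_def uminus_trunc_def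
      algebra_simps)
end

instantiation trunc :: (comm_ring_1) comm_ring_1
begin
definition "1 = trunc_const (1 :: 'a)"
definition "p * q = trunc_mult (*) p (q :: 'a trunc)"
instance
  by standard (simp_all add: zero_trunc_def plus_trunc_def one_trunc_def times_trunc_def
      trunc_const_def trunc_mult_def algebra_simps)
end

definition hbar :: "'x::comm_ring_1 trunc" where
  "hbar = Trunc 0 1 0"

text \<open>
  The ring \<open>'k trunc\<close> is \<open>K[h]/(h^3)\<close>: truncation of polynomials is a surjective ring
  homomorphism sending the variable to \<^const>\<open>hbar\<close>, with kernel generated by \<open>h^3\<close>.
\<close>

definition trunc_of_poly :: "'k::comm_ring_1 poly \<Rightarrow> 'k trunc" where
  "trunc_of_poly p = Trunc (coeff p 0) (coeff p 1) (coeff p 2)"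

lemma trunc_of_poly_hom:
  "trunc_of_poly (p + q) = trunc_of_poly p + trunc_of_poly q"
  "trunc_of_poly (p * q) = trunc_of_poly p * trunc_of_poly q"
  "trunc_of_poly [:c:] = trunc_const c"
  "trunc_of_poly [:0, 1:] = hbar"
  by (simp_all add: trunc_of_poly_def plus_trunc_def times_trunc_def trunc_mult_def trunc_const_def
      hbar_def coeff_mult numeral_2_eq_2 algebra_simps)

lemma surj_trunc_of_poly: "surj (trunc_of_poly :: 'k::comm_ring_1 poly \<Rightarrow> 'k trunc)"
proof (rule surjI)
  show "trunc_of_poly [:cf0 x, cf1 x, cf2 x:] = x" for x :: "'k trunc"
    by (simp add: trunc_of_poly_def numeral_2_eq_2)
qed

lemma trunc_of_poly_eq_0_iff:
  fixes p :: "'k::comm_ring_1 poly"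
  shows "trunc_of_poly p = 0 \<longleftrightarrow> [:0, 1:] ^ 3 dvd p"
proof -
  have "[:0, 1:] ^ 3 = (monom 1 3 :: 'k poly)"
    by (simp add: monom_altdef)
  then show ?thesis
    by (auto simp: trunc_of_poly_def zero_trunc_def monom_1_dvd_iff' less_Suc_eq numeral_3_eq_3
        numeral_2_eq_2)
qed

definition trunc_submodule :: "'x set \<Rightarrow> 'x trunc set" where
  "trunc_submodule M = {x. cf0 x \<in> M \<and> cf1 x \<in> M \<and> cf2 x \<in> M}"

definition scalar_ext :: "('k, 'o, 'a::ab_group_add, 'b::ab_group_add) mon_cat \<Rightarrow>
    ('k trunc, 'o, 'a trunc, 'b trunc) mon_cat"
  where
  "scalar_ext C =
     \<lparr>Hom0 = (\<lambda>U V. trunc_submodule (Hom0 C U V)),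
      Hom1 = (\<lambda>U V. trunc_submodule (Hom1 C U V)),
      smul0 = trunc_mult (smul0 C),
      smul1 = trunc_mult (smul1 C),
      bdry = map_trunc (bdry C),
      ident = (\<lambda>U. trunc_const (ident C U)),
      comp00 = trunc_mult (comp00 C),
      comp01 = trunc_mult (comp01 C),
      comp10 = trunc_mult (comp10 C),
      tens_ob = tens_ob C,
      tens00 = trunc_mult (tens00 C),
      tens10 = trunc_mult (tens10 C),
      tens01 = trunc_mult (tens01 C),
      unit_ob = unit_ob C\<rparr>"

definition transf2_ext ::
  "('o, 'a::ab_group_add, 'b::ab_group_add) transf2 \<Rightarrow> ('o, 'a trunc, 'b trunc) transf2"
  where
  "transf2_ext t =
     \<lparr>at_ob = (\<lambda>s. trunc_const (at_ob t s)),
      along = (\<lambda>s s' (f,g). trunc_mult (\<lambda>f g. along t s s' (f,g)) f g)\<rparr>"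

text \<open>\<open>1 + (h^2/24) [t12, t23]\<close>\<close>

definition associator :: "('k::field_char_0, 'o, 'a::ab_group_add, 'b::ab_group_add) mon_cat \<Rightarrow>
    ('o, 'a, 'b) transf2 \<Rightarrow> ('o, 'a trunc, 'b trunc) transf3"
  where
  "associator C t =
     (let D = scalar_ext C; t' = transf2_ext t in
        tr_add (tr_ident3 D (tensor_left D))
          (tr_smul D (trunc_const (1/24) * hbar ^ 2)
            (tr_commutator D (t12 D t') (t23 D t'))))"

end

theory Submission
  imports Defs
begin

text \<open>
  Put \<open>c = [t12, t23] / 24\<close>, so that \<open>\<alpha> = 1 + h^2 c\<close>. As \<open>h^3 = 0\<close>, products of two correction terms
  vanish and each condition on \<open>\<alpha>\<close> becomes a condition on \<open>c\<close> that is linear and involves only the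
  constant terms of cells (\<open>pentagonal_perturbation\<close>). Pseudonaturality of \<open>\<alpha>\<close> is pseudonaturality
  of \<open>c\<close>; the inverse of \<open>\<alpha>\<close> is \<open>1 - h^2 c\<close>; the triangle says that \<open>c\<close> vanishes when the middle
  argument is the unit. The associahedron is automatic: each of its summands contains the 2-cell of
  \<open>\<alpha>\<close> along components of \<open>\<alpha>\<close>, which is \<open>h^2\<close> times the 2-cell of \<open>c\<close> along the constant terms of
  those components. The constant terms are identities, and the 2-cell along identities is zero.

  The pentagon becomes \<open>1 \<otimes> c + c_U(VW)X + c \<otimes> 1 = c_UV(WX) + c_(UV)WX\<close>, together with the same
  equation for 2-cells. Write \<open>t_ij\<close> for \<open>t\<close> acting on the factors \<open>i\<close> and \<open>j\<close> of a product of four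
  objects. Strictness of \<open>t\<close> turns the equation into
  \<open>[t23, t34] + [t12 + t13, t34 + t24] + [t12, t23] = [t12, t23 + t24] + [t23 + t13, t34]\<close>, that is,
  \<open>[t12, t34] + [t13, t24] = 0\<close>. The first commutator vanishes by the interchange law, and the
  second is conjugate to the first under the symmetry of the two middle factors.

  The equations for 1-cells and for 2-cells are proved together. The values of a
  transformation at the two ends of a 1-cell and along it form a square that commutes up to a
  homotopy. Such squares are the morphisms of an ordinary additive monoidal category whose
  objects are the 1-cells of \<open>C\<close>: the truncation relations \<open>(\<partial> \<phi>) \<phi>' = \<phi> (\<partial> \<phi>')\<close> and
  \<open>(\<partial> \<phi>) \<otimes> \<phi>' = \<phi> \<otimes> (\<partial> \<phi>')\<close> are what makes horizontal and vertical pasting, and the two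
  tensor factors, commute. In that category \<open>t\<close> is a family of endomorphisms, and the argument
  above is an argument about commutators of endomorphisms (\<open>commutator_pentagon\<close>).

  Finally, strictness for \<open>V = W = I\<close> reads \<open>t_UI = t_UI + t_UI\<close>, whence \<open>t_UI = 0\<close> and the triangle.
\<close>

section \<open>Extension of scalars for bilinear maps\<close>

text \<open>
  Closure of the three additive submonoids is part of the predicate, so that one fact about a
  composition or a tensor product carries all the side conditions for expanding it.
\<close>

definition bihom ::
  "'x::ab_group_add set \<Rightarrow> 'y::ab_group_add set \<Rightarrow> 'z::ab_group_add set \<Rightarrow> ('x \<Rightarrow> 'y \<Rightarrow> 'z) \<Rightarrow> bool"
  where
  "bihom M N P m \<longleftrightarrow>
     (\<forall>x\<in>M. \<forall>y\<in>M. x + y \<in> M) \<and> (\<forall>x\<in>N. \<forall>y\<in>N. x + y \<in> N) \<and> (\<forall>x\<in>P. \<forall>y\<in>P. x + y \<in> P) \<and>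
     0 \<in> M \<and> 0 \<in> N \<and> 0 \<in> P \<and>
     (\<forall>x\<in>M. \<forall>y\<in>N. m x y \<in> P) \<and>
     (\<forall>x\<in>M. \<forall>x'\<in>M. \<forall>y\<in>N. m (x + x') y = m x y + m x' y) \<and>
     (\<forall>x\<in>M. \<forall>y\<in>N. \<forall>y'\<in>N. m x (y + y') = m x y + m x y')"

lemma
  assumes "bihom M N P m"
  shows bihom_closed: "\<lbrakk>x \<in> M; y \<in> N\<rbrakk> \<Longrightarrow> m x y \<in> P"
    and bihom_add_left: "\<lbrakk>x \<in> M; x' \<in> M; y \<in> N\<rbrakk> \<Longrightarrow> m (x + x') y = m x y + m x' y"
    and bihom_add_right: "\<lbrakk>x \<in> M; y \<in> N; y' \<in> N\<rbrakk> \<Longrightarrow> m x (y + y') = m x y + m x y'"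
    and bihom_sum_closed: "\<lbrakk>z \<in> P; z' \<in> P\<rbrakk> \<Longrightarrow> z + z' \<in> P"
  using assms by (auto simp: bihom_def)

lemma
  assumes "bihom M N P m"
  shows bihom_zero_left: "y \<in> N \<Longrightarrow> m 0 y = 0"
    and bihom_zero_right: "x \<in> M \<Longrightarrow> m x 0 = 0"
proof -
  have "0 \<in> M" "0 \<in> N"
    using assms by (auto simp: bihom_def)
  then show "y \<in> N \<Longrightarrow> m 0 y = 0" "x \<in> M \<Longrightarrow> m x 0 = 0"
    using bihom_add_left[OF assms, of 0 0 y] bihom_add_right[OF assms, of x 0 0] by auto
qed

lemma trunc_submodule_iff [simp]:
  "Trunc x y z \<in> trunc_submodule M \<longleftrightarrow> x \<in> M \<and> y \<in> M \<and> z \<in> M"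
  by (simp add: trunc_submodule_def)

lemma trunc_submoduleD:
  assumes "x \<in> trunc_submodule M"
  shows "cf0 x \<in> M" "cf1 x \<in> M" "cf2 x \<in> M"
  using assms by (auto simp: trunc_submodule_def)

lemma cf_add [simp]:
  "cf0 (x + y) = cf0 x + cf0 y" "cf1 (x + y) = cf1 x + cf1 y" "cf2 (x + y) = cf2 x + cf2 y"
  by (simp_all add: plus_trunc_def)

lemma cf_diff [simp]:
  "cf0 (x - y) = cf0 x - cf0 y" "cf1 (x - y) = cf1 x - cf1 y" "cf2 (x - y) = cf2 x - cf2 y"
  by (simp_all add: minus_trunc_def)

lemma cf_mult:
  "cf0 (trunc_mult m x y) = m (cf0 x) (cf0 y)"
  "cf1 (trunc_mult m x y) = m (cf0 x) (cf1 y) + m (cf1 x) (cf0 y)"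
  "cf2 (trunc_mult m x y) = m (cf0 x) (cf2 y) + m (cf1 x) (cf1 y) + m (cf2 x) (cf0 y)"
  by (simp_all add: trunc_mult_def)

lemma trunc_mult_closed:
  assumes m: "bihom M N P m" and "x \<in> trunc_submodule M" "y \<in> trunc_submodule N"
  shows "trunc_mult m x y \<in> trunc_submodule P"
  using assms(2-)
  by (simp add: trunc_mult_def trunc_submodule_def bihom_closed[OF m] bihom_sum_closed[OF m])

text \<open>
  The coefficient of \<open>h^n\<close> in either bracketing is the sum of the bracketed products
  \<open>x_i y_j z_k\<close> over \<open>i + j + k = n\<close>. All associativity laws of the extended structure are instances.
\<close>

lemma trunc_mult_assoc:
  assumes "bihom M1 M2 M12 m" "bihom M12 M3 M123 p" "bihom M2 M3 M23 n" "bihom M1 M23 M123 q"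
    and "\<And>x y z. \<lbrakk>x \<in> M1; y \<in> M2; z \<in> M3\<rbrakk> \<Longrightarrow> p (m x y) z = q x (n y z)"
    and "x \<in> trunc_submodule M1" "y \<in> trunc_submodule M2" "z \<in> trunc_submodule M3"
  shows "trunc_mult p (trunc_mult m x y) z = trunc_mult q x (trunc_mult n y z)"
  using assms(5-)
  by (simp add: trunc_mult_def trunc_submodule_def bihom_closed[OF assms(1)]
      bihom_closed[OF assms(3)] bihom_add_left[OF assms(2)] bihom_add_right[OF assms(4)]
      bihom_sum_closed[OF assms(1)] bihom_sum_closed[OF assms(3)])

text \<open>
  The analogue of associativity for laws in four arguments that swap the two middle ones.
\<close>

lemma trunc_mult_interchange:
  assumes "bihom A B AB m" "bihom C D CD n" "bihom AB CD E p"
    and "bihom A C AC r" "bihom B D BD s" "bihom AC BD E q"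
    and "\<And>a b c d. \<lbrakk>a \<in> A; b \<in> B; c \<in> C; d \<in> D\<rbrakk> \<Longrightarrow> p (m a b) (n c d) = q (r a c) (s b d)"
    and "a \<in> trunc_submodule A" "b \<in> trunc_submodule B"
      "c \<in> trunc_submodule C" "d \<in> trunc_submodule D"
  shows "trunc_mult p (trunc_mult m a b) (trunc_mult n c d)
    = trunc_mult q (trunc_mult r a c) (trunc_mult s b d)"
  using assms(7-)
  by (simp add: trunc_mult_def trunc_submodule_def bihom_closed[OF assms(1)]
      bihom_closed[OF assms(2)] bihom_closed[OF assms(4)] bihom_closed[OF assms(5)]
      bihom_add_left[OF assms(3)] bihom_add_right[OF assms(3)]
      bihom_add_left[OF assms(6)] bihom_add_right[OF assms(6)]
      bihom_sum_closed[OF assms(1)] bihom_sum_closed[OF assms(2)]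
      bihom_sum_closed[OF assms(4)] bihom_sum_closed[OF assms(5)])

lemma module_trunc:
  assumes "module s"
  shows "module (trunc_mult s)"
proof -
  interpret module s by fact
  show ?thesis
    by unfold_locales (simp_all add: trunc_mult_def plus_trunc_def times_trunc_def one_trunc_def
        trunc_const_def scale_left_distrib scale_right_distrib algebra_simps)
qed

lemma subspace_trunc:
  assumes "module s" "module.subspace s M"
  shows "module.subspace (trunc_mult s) (trunc_submodule M)"
proof -
  interpret module s by fact
  interpret T: module "trunc_mult s" by (rule module_trunc) fact
  show ?thesis
    using assms(2)
    by (auto simp: T.subspace_def subspace_def trunc_submodule_def trunc_mult_def zero_trunc_def)
qed

lemma linear_on_map_trunc:
  assumes "linear_on s s' M f" "module s" "module.subspace s M"
  shows "linear_on (trunc_mult s) (trunc_mult s') (trunc_submodule M) (map_trunc f)"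
proof -
  interpret module s by fact
  show ?thesis
    using assms(1,3)
    by (auto simp: linear_on_def subspace_def trunc_submodule_def trunc_mult_def plus_trunc_def
        trunc.map_sel trunc.expand)
qed

lemma bilinear_on_trunc_mult:
  assumes m: "bilinear_on s1 s2 s' M N m"
    and "module s1" "module.subspace s1 M" "module s2" "module.subspace s2 N" "module s'"
  shows "bilinear_on (trunc_mult s1) (trunc_mult s2) (trunc_mult s')
    (trunc_submodule M) (trunc_submodule N) (trunc_mult m)"
proof -
  interpret s1: module s1 by fact
  interpret s2: module s2 by fact
  interpret s': module s' by fact
  note closed = s1.subspace_add[OF assms(3)] s1.subspace_scale[OF assms(3)]
    s2.subspace_add[OF assms(5)] s2.subspace_scale[OF assms(5)]
  show ?thesis
    using m unfolding bilinear_on_def linear_on_def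
    by (simp add: trunc_submodule_def trunc_mult_def plus_trunc_def closed
        s'.scale_right_distrib ac_simps)
qed

lemma bihomI:
  assumes "bilinear_on s1 s2 s' M N m"
    and "module s1" "module.subspace s1 M" "module s2" "module.subspace s2 N"
    and "module s'" "module.subspace s' P"
    and "\<And>x y. \<lbrakk>x \<in> M; y \<in> N\<rbrakk> \<Longrightarrow> m x y \<in> P"
  shows "bihom M N P m"
proof -
  interpret s1: module s1 by fact
  interpret s2: module s2 by fact
  interpret s': module s' by fact
  show ?thesis
    using assms(1,3,5,7,8)
    by (auto simp: bihom_def bilinear_on_def linear_on_def s1.subspace_def s2.subspace_def
        s'.subspace_def)
qed

context ch_category
begin

lemma bihom_comp:
  "bihom (Hom0 C V W) (Hom0 C U V) (Hom0 C U W) (comp00 C)"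
  "bihom (Hom0 C V W) (Hom1 C U V) (Hom1 C U W) (comp01 C)"
  "bihom (Hom1 C V W) (Hom0 C U V) (Hom1 C U W) (comp10 C)"
proof -
  show "bihom (Hom0 C V W) (Hom0 C U V) (Hom0 C U W) (comp00 C)"
    by (rule bihomI[OF comp00_bilinear module0 submodule0 module0 submodule0 module0 submodule0])
      (rule comp00_closed)
  show "bihom (Hom0 C V W) (Hom1 C U V) (Hom1 C U W) (comp01 C)"
    by (rule bihomI[OF comp01_bilinear module0 submodule0 module1 submodule1 module1 submodule1])
      (rule comp01_closed)
  show "bihom (Hom1 C V W) (Hom0 C U V) (Hom1 C U W) (comp10 C)"
    by (rule bihomI[OF comp10_bilinear module1 submodule1 module0 submodule0 module1 submodule1])
      (rule comp10_closed)
qed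

end

context ch_tensor
begin

lemma bihom_tens:
  "bihom (Hom0 C U U') (Hom0 C V V') (Hom0 C (U \<odot> V) (U' \<odot> V')) (tens00 C)"
  "bihom (Hom1 C U U') (Hom0 C V V') (Hom1 C (U \<odot> V) (U' \<odot> V')) (tens10 C)"
  "bihom (Hom0 C U U') (Hom1 C V V') (Hom1 C (U \<odot> V) (U' \<odot> V')) (tens01 C)"
proof -
  show "bihom (Hom0 C U U') (Hom0 C V V') (Hom0 C (U \<odot> V) (U' \<odot> V')) (tens00 C)"
    by (rule bihomI[OF tens00_bilinear module0 submodule0 module0 submodule0 module0 submodule0])
      (rule tens00_closed)
  show "bihom (Hom1 C U U') (Hom0 C V V') (Hom1 C (U \<odot> V) (U' \<odot> V')) (tens10 C)"
    by (rule bihomI[OF tens10_bilinear module1 submodule1 module0 submodule0 module1 submodule1])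
      (rule tens10_closed)
  show "bihom (Hom0 C U U') (Hom1 C V V') (Hom1 C (U \<odot> V) (U' \<odot> V')) (tens01 C)"
    by (rule bihomI[OF tens01_bilinear module0 submodule0 module1 submodule1 module1 submodule1])
      (rule tens01_closed)
qed

end

lemma scalar_ext_simps [simp]:
  "Hom0 (scalar_ext C) U V = trunc_submodule (Hom0 C U V)"
  "Hom1 (scalar_ext C) U V = trunc_submodule (Hom1 C U V)"
  "smul0 (scalar_ext C) = trunc_mult (smul0 C)"
  "smul1 (scalar_ext C) = trunc_mult (smul1 C)"
  "bdry (scalar_ext C) = map_trunc (bdry C)"
  "ident (scalar_ext C) U = trunc_const (ident C U)"
  "comp00 (scalar_ext C) = trunc_mult (comp00 C)"
  "comp01 (scalar_ext C) = trunc_mult (comp01 C)"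
  "comp10 (scalar_ext C) = trunc_mult (comp10 C)"
  "tens_ob (scalar_ext C) = tens_ob C"
  "tens00 (scalar_ext C) = trunc_mult (tens00 C)"
  "tens10 (scalar_ext C) = trunc_mult (tens10 C)"
  "tens01 (scalar_ext C) = trunc_mult (tens01 C)"
  "unit_ob (scalar_ext C) = unit_ob C"
  by (simp_all add: scalar_ext_def)

section \<open>Extension of scalars for monoidal categories\<close>

lemma trunc_mult_const:
  assumes m: "bihom M N P m" and "y \<in> trunc_submodule N" "a \<in> M"
  shows "trunc_mult m (trunc_const a) y = Trunc (m a (cf0 y)) (m a (cf1 y)) (m a (cf2 y))"
  using assms(2,3)
  by (simp add: trunc_mult_def trunc_const_def trunc_submodule_def bihom_zero_left[OF m])

lemma trunc_mult_const_right:
  assumes m: "bihom M N P m" and "x \<in> trunc_submodule M" "b \<in> N"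
  shows "trunc_mult m x (trunc_const b) = Trunc (m (cf0 x) b) (m (cf1 x) b) (m (cf2 x) b)"
  using assms(2,3)
  by (simp add: trunc_mult_def trunc_const_def trunc_submodule_def bihom_zero_right[OF m])

lemma trunc_mult_const_const:
  assumes m: "bihom M N P m" and "a \<in> M" "b \<in> N"
  shows "trunc_mult m (trunc_const a) (trunc_const b) = trunc_const (m a b)"
proof -
  have "0 \<in> M" "0 \<in> N"
    using m by (auto simp: bihom_def)
  then show ?thesis
    using assms(2,3)
    by (simp add: trunc_mult_def trunc_const_def bihom_zero_left[OF m] bihom_zero_right[OF m])
qed

text \<open>
  Taking \<open>g\<close> or \<open>h\<close> to be the identity gives the rules for the boundary of a composite or a
  tensor product of a 1-cell and a 2-cell.
\<close>

lemma map_trunc_mult: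
  assumes m: "bihom M N P m"
    and f: "linear_on s s' P f"
    and "\<And>x y. \<lbrakk>x \<in> M; y \<in> N\<rbrakk> \<Longrightarrow> f (m x y) = n (g x) (h y)"
    and "x \<in> trunc_submodule M" "y \<in> trunc_submodule N"
  shows "map_trunc f (trunc_mult m x y) = trunc_mult n (map_trunc g x) (map_trunc h y)"
  using assms(2-)
  by (simp add: trunc_mult_def trunc_submodule_def linear_on_def bihom_closed[OF m]
      bihom_sum_closed[OF m] trunc.map_sel)

lemma map_trunc_closed:
  assumes "\<And>x. x \<in> M \<Longrightarrow> f x \<in> N" "x \<in> trunc_submodule M"
  shows "map_trunc f x \<in> trunc_submodule N"
  using assms by (simp add: trunc_submodule_def trunc.map_sel)

lemma ch_category_scalar_ext:
  fixes C :: "('k::comm_ring_1, 'o, 'a::ab_group_add, 'b::ab_group_add) mon_cat" (structure)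
  assumes "ch_category C"
  shows "ch_category (scalar_ext C)"
proof -
  interpret ch_category C by fact
  note zero = module.subspace_0[OF module0 submodule0] module.subspace_0[OF module1 submodule1]
  show ?thesis
  proof (rule ch_category.intro, unfold scalar_ext_simps, goal_cases)
    case 1 show ?case by (rule module_trunc[OF module0])
  next
    case 2 show ?case by (rule module_trunc[OF module1])
  next
    case 3 show ?case by (rule subspace_trunc[OF module0 submodule0])
  next
    case 4 show ?case by (rule subspace_trunc[OF module1 submodule1])
  next
    case 5 show ?case by (rule map_trunc_closed[OF _ 5]) (rule bdry_closed)
  next
    case 6 show ?case by (rule linear_on_map_trunc[OF bdry_linear module1 submodule1])
  next
    case 7 show ?case by (simp add: trunc_const_def ident_closed zero)
  next
    case 8 then show ?case by (rule trunc_mult_closed[OF bihom_comp(1)])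
  next
    case 9 then show ?case by (rule trunc_mult_closed[OF bihom_comp(2)])
  next
    case 10 then show ?case by (rule trunc_mult_closed[OF bihom_comp(3)])
  next
    case 11 show ?case
      by (rule bilinear_on_trunc_mult[OF comp00_bilinear module0 submodule0 module0 submodule0
            module0])
  next
    case 12 show ?case
      by (rule bilinear_on_trunc_mult[OF comp01_bilinear module0 submodule0 module1 submodule1
            module1])
  next
    case 13 show ?case
      by (rule bilinear_on_trunc_mult[OF comp10_bilinear module1 submodule1 module0 submodule0
            module1])
  next
    case 14 then show ?case
      using trunc_mult_const[OF bihom_comp(1) 14 ident_closed]
      by (auto simp: trunc_submodule_def ident_left0)
  next
    case 15 then show ?case
      using trunc_mult_const_right[OF bihom_comp(1) 15 ident_closed]
      by (auto simp: trunc_submodule_def ident_right0)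
  next
    case 16 then show ?case
      using trunc_mult_const[OF bihom_comp(2) 16 ident_closed]
      by (auto simp: trunc_submodule_def ident_left1)
  next
    case 17 then show ?case
      using trunc_mult_const_right[OF bihom_comp(3) 17 ident_closed]
      by (auto simp: trunc_submodule_def ident_right1)
  next
    case 18 show ?case
      by (rule trunc_mult_assoc[OF bihom_comp(1,1,1,1) _ 18]) (rule assoc000)
  next
    case 19 show ?case
      by (rule trunc_mult_assoc[OF bihom_comp(3,3,1,3) _ 19]) (rule assoc100)
  next
    case 20 show ?case
      by (rule trunc_mult_assoc[OF bihom_comp(2,3,3,2) _ 20]) (rule assoc010)
  next
    case 21 show ?case
      by (rule trunc_mult_assoc[OF bihom_comp(1,2,2,2) _ 21]) (rule assoc001)
  next
    case 22 show ?case
      by (rule map_trunc_mult[OF bihom_comp(2) bdry_linear _ 22, where g = "\<lambda>x. x",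
            unfolded trunc.map_ident]) (rule bdry_comp01)
  next
    case 23 show ?case
      by (rule map_trunc_mult[OF bihom_comp(3) bdry_linear _ 23, where h = "\<lambda>x. x",
            unfolded trunc.map_ident]) (rule bdry_comp10)
  next
    case 24 then show ?case
      by (auto simp: trunc_mult_def trunc_submodule_def trunc.map_sel truncation)
  qed
qed

lemma ch_tensor_scalar_ext:
  fixes C :: "('k::comm_ring_1, 'o, 'a::ab_group_add, 'b::ab_group_add) mon_cat" (structure)
  assumes "ch_tensor C"
  shows "ch_tensor (scalar_ext C)"
proof -
  interpret ch_tensor C by fact
  interpret D: ch_category "scalar_ext C"
    by (rule ch_category_scalar_ext) unfold_locales
  show ?thesis
  proof (unfold_locales, unfold scalar_ext_simps, goal_cases)
    case 1 then show ?case by (rule trunc_mult_closed[OF bihom_tens(1)])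
  next
    case 2 then show ?case by (rule trunc_mult_closed[OF bihom_tens(2)])
  next
    case 3 then show ?case by (rule trunc_mult_closed[OF bihom_tens(3)])
  next
    case 4 show ?case
      by (rule bilinear_on_trunc_mult[OF tens00_bilinear module0 submodule0 module0 submodule0
            module0])
  next
    case 5 show ?case
      by (rule bilinear_on_trunc_mult[OF tens10_bilinear module1 submodule1 module0 submodule0
            module1])
  next
    case 6 show ?case
      by (rule bilinear_on_trunc_mult[OF tens01_bilinear module0 submodule0 module1 submodule1
            module1])
  next
    case 7 then show ?case
      by (auto simp: trunc_mult_def trunc_submodule_def trunc.map_sel tens_truncation)
  next
    case 8 show ?case
      by (rule map_trunc_mult[OF bihom_tens(2) bdry_linear _ 8, where h = "\<lambda>x. x",
            unfolded trunc.map_ident]) (rule bdry_tens10)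
  next
    case 9 show ?case
      by (rule map_trunc_mult[OF bihom_tens(3) bdry_linear _ 9, where g = "\<lambda>x. x",
            unfolded trunc.map_ident]) (rule bdry_tens01)
  next
    case (10 U V) show ?case
      using trunc_mult_const_const[OF bihom_tens(1) ident_closed ident_closed]
      by (simp add: tens_ident)
  next
    case 11 show ?case
      by (rule trunc_mult_interchange[OF bihom_tens(1,1) bihom_comp(1,1,1) bihom_tens(1)
            _ 11(2,4,1,3)]) (rule interchange_00_00)
  next
    case 12 show ?case
      by (rule trunc_mult_interchange[OF bihom_tens(1,2) bihom_comp(2,2,1) bihom_tens(2)
            _ 12(2,4,1,3)]) (rule interchange_00_10)
  next
    case 13 show ?case
      by (rule trunc_mult_interchange[OF bihom_tens(1,3) bihom_comp(2,1,2) bihom_tens(3)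
            _ 13(2,4,1,3)]) (rule interchange_00_01)
  next
    case 14 show ?case
      by (rule trunc_mult_interchange[OF bihom_tens(2,1) bihom_comp(3,3,1) bihom_tens(2)
            _ 14(2,4,1,3)]) (rule interchange_10_00)
  next
    case 15 show ?case
      by (rule trunc_mult_interchange[OF bihom_tens(3,1) bihom_comp(3,1,3) bihom_tens(3)
            _ 15(2,4,1,3)]) (rule interchange_01_00)
  qed
qed

lemma strictly_unital_tensor_scalar_ext:
  fixes C :: "('k::comm_ring_1, 'o, 'a::ab_group_add, 'b::ab_group_add) mon_cat" (structure)
  assumes "strictly_unital_tensor C"
  shows "strictly_unital_tensor (scalar_ext C)"
proof -
  interpret strictly_unital_tensor C by fact
  interpret D: ch_tensor "scalar_ext C"
    by (rule ch_tensor_scalar_ext) unfold_locales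
  show ?thesis
  proof (unfold_locales, unfold scalar_ext_simps, goal_cases)
    case 1 show ?case by (rule unit_ob_left)
  next
    case 2 show ?case by (rule unit_ob_right)
  next
    case 3 then show ?case
      using trunc_mult_const[OF bihom_tens(1) 3 ident_closed]
      by (auto simp: trunc_submodule_def unit_left0)
  next
    case 4 then show ?case
      using trunc_mult_const_right[OF bihom_tens(1) 4 ident_closed]
      by (auto simp: trunc_submodule_def unit_right0)
  next
    case 5 then show ?case
      using trunc_mult_const[OF bihom_tens(3) 5 ident_closed]
      by (auto simp: trunc_submodule_def unit_left1)
  next
    case 6 then show ?case
      using trunc_mult_const_right[OF bihom_tens(2) 6 ident_closed]
      by (auto simp: trunc_submodule_def unit_right1)
  qed
qed

text \<open>
  The part of the symmetric strict monoidal structure that has to be carried over to the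
  extended category, where it identifies \<open>\<otimes>(\<otimes> \<boxtimes> id)\<close> with \<open>\<otimes>(id \<boxtimes> \<otimes>)\<close>.
\<close>

locale strict_tensor = strictly_unital_tensor C
  for C :: "('r::comm_ring_1, 'o, 'a::ab_group_add, 'b::ab_group_add, 'z) mon_cat_scheme" (structure) +
  assumes assoc_ob: "(U \<odot> V) \<odot> W = U \<odot> (V \<odot> W)"
    and tens_assoc000: "\<lbrakk>f \<in> Hom0 C U U'; g \<in> Hom0 C V V'; k \<in> Hom0 C W W'\<rbrakk>
      \<Longrightarrow> (f \<otimes> g) \<otimes> k = f \<otimes> (g \<otimes> k)"
    and tens_assoc100: "\<lbrakk>\<phi> \<in> Hom1 C U U'; g \<in> Hom0 C V V'; k \<in> Hom0 C W W'\<rbrakk>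
      \<Longrightarrow> (\<phi> \<ltimes> g) \<ltimes> k = \<phi> \<ltimes> (g \<otimes> k)"
    and tens_assoc010: "\<lbrakk>f \<in> Hom0 C U U'; \<phi> \<in> Hom1 C V V'; k \<in> Hom0 C W W'\<rbrakk>
      \<Longrightarrow> (f \<rtimes> \<phi>) \<ltimes> k = f \<rtimes> (\<phi> \<ltimes> k)"
    and tens_assoc001: "\<lbrakk>f \<in> Hom0 C U U'; g \<in> Hom0 C V V'; \<phi> \<in> Hom1 C W W'\<rbrakk>
      \<Longrightarrow> (f \<otimes> g) \<rtimes> \<phi> = f \<rtimes> (g \<rtimes> \<phi>)"

lemma (in symmetric_strict_monoidal) strict_tensor: "strict_tensor C"
  by unfold_locales
    (rule assoc_ob tens_assoc000 tens_assoc100 tens_assoc010 tens_assoc001; assumption)+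

lemma strict_tensor_scalar_ext:
  fixes C :: "('k::comm_ring_1, 'o, 'a::ab_group_add, 'b::ab_group_add) mon_cat" (structure)
  assumes "strict_tensor C"
  shows "strict_tensor (scalar_ext C)"
proof -
  interpret strict_tensor C by fact
  interpret D: strictly_unital_tensor "scalar_ext C"
    by (rule strictly_unital_tensor_scalar_ext) unfold_locales
  note bihom_left = bihom_tens[of "_ \<odot> _" "_ \<odot> _", unfolded assoc_ob]
  show ?thesis
  proof (unfold_locales, unfold scalar_ext_simps, goal_cases)
    case 1 show ?case by (rule assoc_ob)
  next
    case 2 show ?case
      by (rule trunc_mult_assoc[OF bihom_tens(1) bihom_left(1) bihom_tens(1,1) _ 2])
        (rule tens_assoc000)
  next
    case 3 show ?case
      by (rule trunc_mult_assoc[OF bihom_tens(2) bihom_left(2) bihom_tens(1,2) _ 3])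
        (rule tens_assoc100)
  next
    case 4 show ?case
      by (rule trunc_mult_assoc[OF bihom_tens(3) bihom_left(2) bihom_tens(2,3) _ 4])
        (rule tens_assoc010)
  next
    case 5 show ?case
      by (rule trunc_mult_assoc[OF bihom_tens(1) bihom_left(3) bihom_tens(3,3) _ 5])
        (rule tens_assoc001)
  qed
qed

section \<open>The category of homotopy-commutative squares\<close>

text \<open>
  Hom modules may overlap, so a 1-cell does not determine its source and target; an arrow records
  them. The components of a square \<open>u \<rightarrow> v\<close> are a 1-cell between the sources, a 1-cell
  between the targets, and the homotopy that fills the square.
\<close>

datatype ('o, 'a) arrow = Arrow (src: 'o) (tgt: 'o) (cell: 'a)

datatype ('a, 'b) square = Square (at_src: 'a) (at_tgt: 'a) (filler: 'b)

instantiation square :: (ab_group_add, ab_group_add) ab_group_add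
begin
definition "0 = Square 0 0 0"
definition "A + B = Square (at_src A + at_src B) (at_tgt A + at_tgt B) (filler A + filler B)"
definition "A - B = Square (at_src A - at_src B) (at_tgt A - at_tgt B) (filler A - filler B)"
definition "- A = Square (- at_src A) (- at_tgt A) (- filler A)"
instance
  by standard (simp_all add: zero_square_def plus_square_def minus_square_def uminus_square_def)
end

lemma square_sel [simp]:
  "at_src (A + B) = at_src A + at_src B" "at_tgt (A + B) = at_tgt A + at_tgt B"
  "filler (A + B) = filler A + filler B"
  "at_src (A - B) = at_src A - at_src B" "at_tgt (A - B) = at_tgt A - at_tgt B"
  "filler (A - B) = filler A - filler B"
  "at_src 0 = 0" "at_tgt 0 = 0" "filler 0 = 0"
  by (simp_all add: plus_square_def minus_square_def zero_square_def)

context ch_category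
begin

lemmas comp_add =
  bihom_add_left[OF bihom_comp(1)] bihom_add_left[OF bihom_comp(2)] bihom_add_left[OF bihom_comp(3)]
  bihom_add_right[OF bihom_comp(1)] bihom_add_right[OF bihom_comp(2)]
  bihom_add_right[OF bihom_comp(3)]

lemmas comp_zero =
  bihom_zero_left[OF bihom_comp(1)] bihom_zero_left[OF bihom_comp(2)]
  bihom_zero_left[OF bihom_comp(3)]
  bihom_zero_right[OF bihom_comp(1)] bihom_zero_right[OF bihom_comp(2)]
  bihom_zero_right[OF bihom_comp(3)]

lemmas comp_closed = comp00_closed comp01_closed comp10_closed

lemmas Hom_zero =
  module.subspace_0[OF module0 submodule0] module.subspace_0[OF module1 submodule1]

lemmas Hom_add =
  module.subspace_add[OF module0 submodule0] module.subspace_add[OF module1 submodule1]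

lemmas Hom_diff =
  module.subspace_diff[OF module0 submodule0] module.subspace_diff[OF module1 submodule1]

lemma bdry_add: "\<lbrakk>\<phi> \<in> Hom1 C U V; \<psi> \<in> Hom1 C U V\<rbrakk> \<Longrightarrow> \<partial> (\<phi> + \<psi>) = \<partial> \<phi> + \<partial> \<psi>"
  using bdry_linear[of U V] by (simp add: linear_on_def)

lemma bdry_zero: "\<partial> 0 = 0"
  using bdry_add[of 0 undefined undefined 0] by (simp add: Hom_zero)

lemma bdry_diff: "\<lbrakk>\<phi> \<in> Hom1 C U V; \<psi> \<in> Hom1 C U V\<rbrakk> \<Longrightarrow> \<partial> (\<phi> - \<psi>) = \<partial> \<phi> - \<partial> \<psi>"
  using bdry_add[of "\<phi> - \<psi>" U V \<psi>] by (simp add: Hom_diff)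

definition Arr :: "('o, 'a) arrow set" where
  "Arr = {u. cell u \<in> Hom0 C (src u) (tgt u)}"

text \<open>
  The sign of the homotopy is that of the naturality condition for pseudonatural
  transformations \<open>F \<Rightarrow> F\<close>, whose values along \<open>f\<close> are therefore endomorphisms of the arrow \<open>F(f)\<close>.
\<close>

definition Sq :: "('o, 'a) arrow \<Rightarrow> ('o, 'a) arrow \<Rightarrow> ('a, 'b) square set" where
  "Sq u v = {A. at_src A \<in> Hom0 C (src u) (src v) \<and> at_tgt A \<in> Hom0 C (tgt u) (tgt v) \<and>
     filler A \<in> Hom1 C (src u) (tgt v) \<and> (cell v \<cdot> at_src A) - (at_tgt A \<cdot> cell u) = \<partial> (filler A)}"

definition sq_id :: "('o, 'a) arrow \<Rightarrow> ('a, 'b) square" where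
  "sq_id u = Square (\<one> src u) (\<one> tgt u) 0"

text \<open>
  On endomorphisms of \<open>F(f)\<close> this is the formula for vertical composition of transformations.
\<close>

definition sq_comp :: "('a, 'b) square \<Rightarrow> ('a, 'b) square \<Rightarrow> ('a, 'b) square"  (infixr "\<star>" 70)
  where
  "B \<star> A =
     Square (at_src B \<cdot> at_src A) (at_tgt B \<cdot> at_tgt A) ((filler B \<lhd> at_src A) + (at_tgt B \<rhd> filler A))"

lemma ArrD: "u \<in> Arr \<Longrightarrow> cell u \<in> Hom0 C (src u) (tgt u)"
  by (simp add: Arr_def)

lemma SqD:
  assumes "A \<in> Sq u v"
  shows "at_src A \<in> Hom0 C (src u) (src v)" "at_tgt A \<in> Hom0 C (tgt u) (tgt v)"
    "filler A \<in> Hom1 C (src u) (tgt v)" "(cell v \<cdot> at_src A) - (at_tgt A \<cdot> cell u) = \<partial> (filler A)"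
  using assms by (auto simp: Sq_def)

lemma sq_comp_closed:
  assumes uvw: "u \<in> Arr" "v \<in> Arr" "w \<in> Arr" and B: "B \<in> Sq v w" and A: "A \<in> Sq u v"
  shows "B \<star> A \<in> Sq u w"
proof -
  note [intro] = comp_closed bdry_closed ArrD[OF uvw(1)] ArrD[OF uvw(2)] ArrD[OF uvw(3)]
    SqD(1-3)[OF A] SqD(1-3)[OF B]
  have "cell w \<cdot> at_src B = (at_tgt B \<cdot> cell v) + \<partial> (filler B)"
    using SqD(4)[OF B] by (simp add: algebra_simps)
  then have "cell w \<cdot> (at_src B \<cdot> at_src A) = ((at_tgt B \<cdot> cell v) + \<partial> (filler B)) \<cdot> at_src A"
    using assoc000[of "cell w" "src w" "tgt w" "at_src B" "src v" "at_src A" "src u"] by force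
  also have "\<dots> = ((at_tgt B \<cdot> cell v) \<cdot> at_src A) + (\<partial> (filler B) \<cdot> at_src A)"
    by (rule comp_add(1)) blast+
  also have "(at_tgt B \<cdot> cell v) \<cdot> at_src A = at_tgt B \<cdot> (cell v \<cdot> at_src A)"
    by (rule assoc000) blast+
  also have "cell v \<cdot> at_src A = (at_tgt A \<cdot> cell u) + \<partial> (filler A)"
    using SqD(4)[OF A] by (simp add: algebra_simps)
  also have "at_tgt B \<cdot> ((at_tgt A \<cdot> cell u) + \<partial> (filler A))
      = (at_tgt B \<cdot> (at_tgt A \<cdot> cell u)) + (at_tgt B \<cdot> \<partial> (filler A))"
    by (rule comp_add(4)) blast+
  also have "at_tgt B \<cdot> (at_tgt A \<cdot> cell u) = (at_tgt B \<cdot> at_tgt A) \<cdot> cell u"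
    by (rule assoc000[symmetric]) blast+
  also have "at_tgt B \<cdot> \<partial> (filler A) = \<partial> (at_tgt B \<rhd> filler A)"
    by (rule bdry_comp01[symmetric]) blast+
  also have "\<partial> (filler B) \<cdot> at_src A = \<partial> (filler B \<lhd> at_src A)"
    by (rule bdry_comp10[symmetric]) blast+
  finally have "(cell w \<cdot> (at_src B \<cdot> at_src A)) - ((at_tgt B \<cdot> at_tgt A) \<cdot> cell u)
      = \<partial> (filler B \<lhd> at_src A) + \<partial> (at_tgt B \<rhd> filler A)"
    by simp
  also have "\<dots> = \<partial> ((filler B \<lhd> at_src A) + (at_tgt B \<rhd> filler A))"
    by (rule bdry_add[symmetric]) blast+
  finally show ?thesis
    unfolding Sq_def sq_comp_def by (auto intro!: Hom_add)
qed

lemma sq_comp_assoc: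
  assumes D: "D \<in> Sq w x" and B: "B \<in> Sq v w" and A: "A \<in> Sq u v"
  shows "(D \<star> B) \<star> A = D \<star> (B \<star> A)"
proof -
  note [intro] = comp_closed SqD(1-3)[OF A] SqD(1-3)[OF B] SqD(1-3)[OF D]
  have "((filler D \<lhd> at_src B) + (at_tgt D \<rhd> filler B)) \<lhd> at_src A
      = ((filler D \<lhd> at_src B) \<lhd> at_src A) + ((at_tgt D \<rhd> filler B) \<lhd> at_src A)"
    by (rule comp_add(3)) blast+
  moreover have "(filler D \<lhd> at_src B) \<lhd> at_src A = filler D \<lhd> (at_src B \<cdot> at_src A)"
    by (rule assoc100) blast+
  moreover have "(at_tgt D \<rhd> filler B) \<lhd> at_src A = at_tgt D \<rhd> (filler B \<lhd> at_src A)"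
    by (rule assoc010) blast+
  moreover have "(at_tgt D \<cdot> at_tgt B) \<rhd> filler A = at_tgt D \<rhd> (at_tgt B \<rhd> filler A)"
    by (rule assoc001) blast+
  moreover have "at_tgt D \<rhd> ((filler B \<lhd> at_src A) + (at_tgt B \<rhd> filler A))
      = (at_tgt D \<rhd> (filler B \<lhd> at_src A)) + (at_tgt D \<rhd> (at_tgt B \<rhd> filler A))"
    by (rule comp_add(5)) blast+
  moreover have "(at_src D \<cdot> at_src B) \<cdot> at_src A = at_src D \<cdot> (at_src B \<cdot> at_src A)"
    "(at_tgt D \<cdot> at_tgt B) \<cdot> at_tgt A = at_tgt D \<cdot> (at_tgt B \<cdot> at_tgt A)"
    by (rule assoc000; blast)+
  ultimately show ?thesis
    by (simp add: sq_comp_def)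
qed

lemma sq_id_left: "A \<in> Sq u v \<Longrightarrow> sq_id v \<star> A = A"
  using ident_left0[OF SqD(1)] ident_left0[OF SqD(2)] ident_left1[OF SqD(3)]
    comp_zero(3)[OF SqD(1)]
  by (simp add: sq_id_def sq_comp_def)

lemma sq_id_right: "A \<in> Sq u v \<Longrightarrow> A \<star> sq_id u = A"
  using ident_right0[OF SqD(1)] ident_right0[OF SqD(2)] ident_right1[OF SqD(3)]
    comp_zero(5)[OF SqD(2)]
  by (simp add: sq_id_def sq_comp_def)

lemma Sq_zero: "\<lbrakk>u \<in> Arr; v \<in> Arr\<rbrakk> \<Longrightarrow> 0 \<in> Sq u v"
  using comp_zero(4)[OF ArrD, of v] comp_zero(1)[OF ArrD, of u]
  by (simp add: Sq_def Hom_zero bdry_zero)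

lemma Sq_add:
  assumes uv: "u \<in> Arr" "v \<in> Arr" and A: "A \<in> Sq u v" and B: "B \<in> Sq u v"
  shows "A + B \<in> Sq u v"
proof -
  have "cell v \<cdot> (at_src A + at_src B) = (cell v \<cdot> at_src A) + (cell v \<cdot> at_src B)"
    by (rule comp_add(4)[OF ArrD[OF uv(2)] SqD(1)[OF A] SqD(1)[OF B]])
  moreover have "(at_tgt A + at_tgt B) \<cdot> cell u = (at_tgt A \<cdot> cell u) + (at_tgt B \<cdot> cell u)"
    by (rule comp_add(1)[OF SqD(2)[OF A] SqD(2)[OF B] ArrD[OF uv(1)]])
  ultimately show ?thesis
    using SqD[OF A] SqD[OF B]
    by (simp add: Sq_def Hom_add bdry_add algebra_simps)
qed

lemma Sq_diff:
  assumes uv: "u \<in> Arr" "v \<in> Arr" and A: "A \<in> Sq u v" and B: "B \<in> Sq u v"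
  shows "A - B \<in> Sq u v"
proof -
  have "cell v \<cdot> at_src A = (cell v \<cdot> (at_src A - at_src B)) + (cell v \<cdot> at_src B)"
    using comp_add(4)[OF ArrD[OF uv(2)] Hom_diff(1)[OF SqD(1)[OF A] SqD(1)[OF B]] SqD(1)[OF B]]
    by simp
  moreover have "at_tgt A \<cdot> cell u = ((at_tgt A - at_tgt B) \<cdot> cell u) + (at_tgt B \<cdot> cell u)"
    using comp_add(1)[OF Hom_diff(1)[OF SqD(2)[OF A] SqD(2)[OF B]] SqD(2)[OF B] ArrD[OF uv(1)]]
    by simp
  ultimately show ?thesis
    using SqD[OF A] SqD[OF B]
    by (simp add: Sq_def Hom_diff bdry_diff algebra_simps)
qed

lemma bihom_sq_comp:
  assumes "u \<in> Arr" "v \<in> Arr" "w \<in> Arr"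
  shows "bihom (Sq v w) (Sq u v) (Sq u w) (\<star>)"
proof -
  have "(B + B') \<star> A = (B \<star> A) + (B' \<star> A)"
    if "B \<in> Sq v w" "B' \<in> Sq v w" "A \<in> Sq u v" for A B B'
    using that[THEN SqD(1)] that[THEN SqD(2)] that[THEN SqD(3)]
    by (simp add: sq_comp_def plus_square_def comp_add(1)[where V = "src v" and W = "src w"]
        comp_add(1)[where V = "tgt v" and W = "tgt w"]
        comp_add(2)[where V = "tgt v" and W = "tgt w"]
        comp_add(3)[where V = "src v" and W = "tgt w"])
  moreover have "B \<star> (A + A') = (B \<star> A) + (B \<star> A')"
    if "B \<in> Sq v w" "A \<in> Sq u v" "A' \<in> Sq u v" for A A' B
    using that[THEN SqD(1)] that[THEN SqD(2)] that[THEN SqD(3)]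
    by (simp add: sq_comp_def plus_square_def comp_add(4)[where V = "src v" and W = "src w"]
        comp_add(4)[where V = "tgt v" and W = "tgt w"]
        comp_add(5)[where V = "tgt v" and W = "tgt w"]
        comp_add(6)[where V = "src v" and W = "tgt w"])
  ultimately show ?thesis
    using assms by (auto simp: bihom_def intro: Sq_zero Sq_add sq_comp_closed)
qed

end

section \<open>Tensor products of squares\<close>

context ch_tensor
begin

definition tens_arrow :: "('o, 'a) arrow \<Rightarrow> ('o, 'a) arrow \<Rightarrow> ('o, 'a) arrow"  (infixr "\<boxtimes>" 75)
  where "u \<boxtimes> v = Arrow (src u \<odot> src v) (tgt u \<odot> tgt v) (cell u \<otimes> cell v)"

text \<open>
  Whiskering by an arrow is the tensor product with its identity square.
\<close>

definition whisker_left :: "('o, 'a) arrow \<Rightarrow> ('a, 'b) square \<Rightarrow> ('a, 'b) square"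
    (infixr "\<triangleright>" 75)
  where "u \<triangleright> A = Square (\<one> src u \<otimes> at_src A) (\<one> tgt u \<otimes> at_tgt A) (cell u \<rtimes> filler A)"

definition whisker_right :: "('a, 'b) square \<Rightarrow> ('o, 'a) arrow \<Rightarrow> ('a, 'b) square"
    (infixl "\<triangleleft>" 76)
  where "A \<triangleleft> u = Square (at_src A \<otimes> \<one> src u) (at_tgt A \<otimes> \<one> tgt u) (filler A \<ltimes> cell u)"

lemmas tens_add =
  bihom_add_left[OF bihom_tens(1)] bihom_add_left[OF bihom_tens(2)] bihom_add_left[OF bihom_tens(3)]
  bihom_add_right[OF bihom_tens(1)] bihom_add_right[OF bihom_tens(2)]
  bihom_add_right[OF bihom_tens(3)]

lemmas tens_zero =
  bihom_zero_left[OF bihom_tens(1)] bihom_zero_left[OF bihom_tens(2)]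
  bihom_zero_left[OF bihom_tens(3)]
  bihom_zero_right[OF bihom_tens(1)] bihom_zero_right[OF bihom_tens(2)]
  bihom_zero_right[OF bihom_tens(3)]

lemmas tens_closed = tens00_closed tens10_closed tens01_closed

lemma tens_arrow_closed: "\<lbrakk>u \<in> Arr; v \<in> Arr\<rbrakk> \<Longrightarrow> u \<boxtimes> v \<in> Arr"
  by (simp add: Arr_def tens_arrow_def tens00_closed)

lemma ident_tens_comp:
  assumes "f \<in> Hom0 C U U'" "g \<in> Hom0 C V V'"
  shows "(f \<otimes> \<one> V') \<cdot> (\<one> U \<otimes> g) = f \<otimes> g" "(\<one> U' \<otimes> g) \<cdot> (f \<otimes> \<one> V) = f \<otimes> g"
  using interchange_00_00[of "\<one> U" U U f U' g V V' "\<one> V'" V']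
    interchange_00_00[of f U U' "\<one> U'" U' "\<one> V" V V g V'] assms
  by (simp_all add: ident_closed ident_left0 ident_right0)

lemma whisker_left_closed:
  assumes u: "u \<in> Arr" and v: "v \<in> Arr" and w: "w \<in> Arr" and A: "A \<in> Sq v w"
  shows "u \<triangleright> A \<in> Sq (u \<boxtimes> v) (u \<boxtimes> w)"
proof -
  note [intro] = comp_closed tens_closed ident_closed ArrD[OF u] ArrD[OF v] ArrD[OF w]
    SqD(1-3)[OF A]
  have "(cell u \<otimes> cell w) \<cdot> (\<one> src u \<otimes> at_src A) = (cell u \<cdot> \<one> src u) \<otimes> (cell w \<cdot> at_src A)"
    by (rule interchange_00_00) blast+
  moreover have "(\<one> tgt u \<otimes> at_tgt A) \<cdot> (cell u \<otimes> cell v) = (\<one> tgt u \<cdot> cell u) \<otimes> (at_tgt A \<cdot> cell v)"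
    by (rule interchange_00_00) blast+
  moreover have "cell w \<cdot> at_src A = (at_tgt A \<cdot> cell v) + \<partial> (filler A)"
    using SqD(4)[OF A] by (simp add: algebra_simps)
  moreover have "cell u \<otimes> ((at_tgt A \<cdot> cell v) + \<partial> (filler A))
      = (cell u \<otimes> (at_tgt A \<cdot> cell v)) + (cell u \<otimes> \<partial> (filler A))"
    by (rule tens_add(4)) (blast intro: bdry_closed)+
  moreover have "cell u \<otimes> \<partial> (filler A) = \<partial> (cell u \<rtimes> filler A)"
    by (rule bdry_tens01[symmetric]) blast+
  moreover have "cell u \<cdot> \<one> src u = cell u" "\<one> tgt u \<cdot> cell u = cell u"
    by (rule ident_left0 ident_right0; blast)+
  ultimately show ?thesis
    by (auto simp: Sq_def tens_arrow_def whisker_left_def)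
qed

lemma whisker_right_closed:
  assumes u: "u \<in> Arr" and v: "v \<in> Arr" and w: "w \<in> Arr" and A: "A \<in> Sq v w"
  shows "A \<triangleleft> u \<in> Sq (v \<boxtimes> u) (w \<boxtimes> u)"
proof -
  note [intro] = comp_closed tens_closed ident_closed ArrD[OF u] ArrD[OF v] ArrD[OF w]
    SqD(1-3)[OF A]
  have "(cell w \<otimes> cell u) \<cdot> (at_src A \<otimes> \<one> src u) = (cell w \<cdot> at_src A) \<otimes> (cell u \<cdot> \<one> src u)"
    by (rule interchange_00_00) blast+
  moreover have "(at_tgt A \<otimes> \<one> tgt u) \<cdot> (cell v \<otimes> cell u) = (at_tgt A \<cdot> cell v) \<otimes> (\<one> tgt u \<cdot> cell u)"
    by (rule interchange_00_00) blast+
  moreover have "cell w \<cdot> at_src A = (at_tgt A \<cdot> cell v) + \<partial> (filler A)"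
    using SqD(4)[OF A] by (simp add: algebra_simps)
  moreover have "((at_tgt A \<cdot> cell v) + \<partial> (filler A)) \<otimes> cell u
      = ((at_tgt A \<cdot> cell v) \<otimes> cell u) + (\<partial> (filler A) \<otimes> cell u)"
    by (rule tens_add(1)) (blast intro: bdry_closed)+
  moreover have "\<partial> (filler A) \<otimes> cell u = \<partial> (filler A \<ltimes> cell u)"
    by (rule bdry_tens10[symmetric]) blast+
  moreover have "cell u \<cdot> \<one> src u = cell u" "\<one> tgt u \<cdot> cell u = cell u"
    by (rule ident_left0 ident_right0; blast)+
  ultimately show ?thesis
    by (auto simp: Sq_def tens_arrow_def whisker_right_def)
qed

lemma whisker_left_add:
  assumes u: "u \<in> Arr" and A: "A \<in> Sq v w" and B: "B \<in> Sq v w"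
  shows "u \<triangleright> (A + B) = u \<triangleright> A + u \<triangleright> B"
  using tens_add(4)[OF ident_closed SqD(1)[OF A] SqD(1)[OF B]]
    tens_add(4)[OF ident_closed SqD(2)[OF A] SqD(2)[OF B]]
    tens_add(6)[OF ArrD[OF u] SqD(3)[OF A] SqD(3)[OF B]]
  by (simp add: whisker_left_def plus_square_def)

lemma whisker_right_add:
  assumes u: "u \<in> Arr" and A: "A \<in> Sq v w" and B: "B \<in> Sq v w"
  shows "(A + B) \<triangleleft> u = A \<triangleleft> u + B \<triangleleft> u"
  using tens_add(1)[OF SqD(1)[OF A] SqD(1)[OF B] ident_closed]
    tens_add(1)[OF SqD(2)[OF A] SqD(2)[OF B] ident_closed]
    tens_add(2)[OF SqD(3)[OF A] SqD(3)[OF B] ArrD[OF u]]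
  by (simp add: whisker_right_def plus_square_def)

lemma whisker_left_diff:
  assumes u: "u \<in> Arr" and "v \<in> Arr" "w \<in> Arr" and A: "A \<in> Sq v w" and B: "B \<in> Sq v w"
  shows "u \<triangleright> (A - B) = u \<triangleright> A - u \<triangleright> B"
  using whisker_left_add[OF u Sq_diff[OF assms(2,3) A B] B] by simp

lemma whisker_right_diff:
  assumes u: "u \<in> Arr" and "v \<in> Arr" "w \<in> Arr" and A: "A \<in> Sq v w" and B: "B \<in> Sq v w"
  shows "(A - B) \<triangleleft> u = A \<triangleleft> u - B \<triangleleft> u"
  using whisker_right_add[OF u Sq_diff[OF assms(2,3) A B] B] by simp

lemma whisker_left_id:
  assumes "u \<in> Arr"
  shows "u \<triangleright> sq_id v = sq_id (u \<boxtimes> v)"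
  using tens_zero(6)[OF ArrD[OF assms]]
  by (simp add: whisker_left_def sq_id_def tens_arrow_def tens_ident)

lemma whisker_right_id:
  assumes "u \<in> Arr"
  shows "sq_id v \<triangleleft> u = sq_id (v \<boxtimes> u)"
  using tens_zero(2)[OF ArrD[OF assms]]
  by (simp add: whisker_right_def sq_id_def tens_arrow_def tens_ident)

lemma whisker_left_comp:
  assumes u: "u \<in> Arr" and B: "B \<in> Sq w x" and A: "A \<in> Sq v w"
  shows "u \<triangleright> (B \<star> A) = (u \<triangleright> B) \<star> (u \<triangleright> A)"
proof -
  note [intro] = comp_closed ident_closed ArrD[OF u] SqD(1-3)[OF A] SqD(1-3)[OF B]
  have "(\<one> src u \<otimes> at_src B) \<cdot> (\<one> src u \<otimes> at_src A) = (\<one> src u \<cdot> \<one> src u) \<otimes> (at_src B \<cdot> at_src A)"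
    "(\<one> tgt u \<otimes> at_tgt B) \<cdot> (\<one> tgt u \<otimes> at_tgt A) = (\<one> tgt u \<cdot> \<one> tgt u) \<otimes> (at_tgt B \<cdot> at_tgt A)"
    by (rule interchange_00_00; blast)+
  moreover have "(cell u \<rtimes> filler B) \<lhd> (\<one> src u \<otimes> at_src A)
      = (cell u \<cdot> \<one> src u) \<rtimes> (filler B \<lhd> at_src A)"
    by (rule interchange_01_00) blast+
  moreover have "(\<one> tgt u \<otimes> at_tgt B) \<rhd> (cell u \<rtimes> filler A)
      = (\<one> tgt u \<cdot> cell u) \<rtimes> (at_tgt B \<rhd> filler A)"
    by (rule interchange_00_01) blast+
  moreover have "cell u \<rtimes> ((filler B \<lhd> at_src A) + (at_tgt B \<rhd> filler A))
      = (cell u \<rtimes> (filler B \<lhd> at_src A)) + (cell u \<rtimes> (at_tgt B \<rhd> filler A))"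
    by (rule tens_add(6)) blast+
  moreover have "cell u \<cdot> \<one> src u = cell u" "\<one> tgt u \<cdot> cell u = cell u"
    by (rule ident_left0 ident_right0; blast)+
  ultimately show ?thesis
    by (simp add: whisker_left_def sq_comp_def ident_left0[OF ident_closed])
qed

lemma whisker_right_comp:
  assumes u: "u \<in> Arr" and B: "B \<in> Sq w x" and A: "A \<in> Sq v w"
  shows "(B \<star> A) \<triangleleft> u = (B \<triangleleft> u) \<star> (A \<triangleleft> u)"
proof -
  note [intro] = comp_closed ident_closed ArrD[OF u] SqD(1-3)[OF A] SqD(1-3)[OF B]
  have "(at_src B \<otimes> \<one> src u) \<cdot> (at_src A \<otimes> \<one> src u) = (at_src B \<cdot> at_src A) \<otimes> (\<one> src u \<cdot> \<one> src u)"
    "(at_tgt B \<otimes> \<one> tgt u) \<cdot> (at_tgt A \<otimes> \<one> tgt u) = (at_tgt B \<cdot> at_tgt A) \<otimes> (\<one> tgt u \<cdot> \<one> tgt u)"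
    by (rule interchange_00_00; blast)+
  moreover have "(filler B \<ltimes> cell u) \<lhd> (at_src A \<otimes> \<one> src u)
      = (filler B \<lhd> at_src A) \<ltimes> (cell u \<cdot> \<one> src u)"
    by (rule interchange_10_00) blast+
  moreover have "(at_tgt B \<otimes> \<one> tgt u) \<rhd> (filler A \<ltimes> cell u)
      = (at_tgt B \<rhd> filler A) \<ltimes> (\<one> tgt u \<cdot> cell u)"
    by (rule interchange_00_10) blast+
  moreover have "((filler B \<lhd> at_src A) + (at_tgt B \<rhd> filler A)) \<ltimes> cell u
      = ((filler B \<lhd> at_src A) \<ltimes> cell u) + ((at_tgt B \<rhd> filler A) \<ltimes> cell u)"
    by (rule tens_add(2)) blast+
  moreover have "cell u \<cdot> \<one> src u = cell u" "\<one> tgt u \<cdot> cell u = cell u"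
    by (rule ident_left0 ident_right0; blast)+
  ultimately show ?thesis
    by (simp add: whisker_right_def sq_comp_def ident_left0[OF ident_closed])
qed

text \<open>
  The homotopies on the two sides differ by \<open>\<phi> \<otimes> \<partial> \<psi> - \<partial> \<phi> \<otimes> \<psi>\<close>, where \<open>\<phi>\<close> and \<open>\<psi>\<close> fill \<open>A\<close> and
  \<open>B\<close>. This vanishes in the truncated tensor product, and the interchange law of a monoidal category
  holds strictly for squares.
\<close>

lemma whisker_exchange:
  assumes uv: "u \<in> Arr" "u' \<in> Arr" "v \<in> Arr" "v' \<in> Arr" and A: "A \<in> Sq u u'" and B: "B \<in> Sq v v'"
  shows "(A \<triangleleft> v') \<star> (u \<triangleright> B) = (u' \<triangleright> B) \<star> (A \<triangleleft> v)"
proof -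
  note [intro] = comp_closed ident_closed bdry_closed uv[THEN ArrD] SqD(1-3)[OF A] SqD(1-3)[OF B]
  have "(filler A \<ltimes> cell v') \<lhd> (\<one> src u \<otimes> at_src B)
      = (filler A \<lhd> \<one> src u) \<ltimes> (cell v' \<cdot> at_src B)"
    by (rule interchange_10_00) blast+
  moreover have "filler A \<lhd> \<one> src u = filler A"
    by (rule ident_right1) blast
  moreover have "cell v' \<cdot> at_src B = (at_tgt B \<cdot> cell v) + \<partial> (filler B)"
    using SqD(4)[OF B] by (simp add: algebra_simps)
  moreover have "filler A \<ltimes> ((at_tgt B \<cdot> cell v) + \<partial> (filler B))
      = (filler A \<ltimes> (at_tgt B \<cdot> cell v)) + (filler A \<ltimes> \<partial> (filler B))"
    by (rule tens_add(5)) blast+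
  moreover have "(at_tgt A \<otimes> \<one> tgt v') \<rhd> (cell u \<rtimes> filler B)
      = (at_tgt A \<cdot> cell u) \<rtimes> (\<one> tgt v' \<rhd> filler B)"
    by (rule interchange_00_01) blast+
  moreover have "\<one> tgt v' \<rhd> filler B = filler B"
    by (rule ident_left1) blast
  moreover have "(cell u' \<rtimes> filler B) \<lhd> (at_src A \<otimes> \<one> src v)
      = (cell u' \<cdot> at_src A) \<rtimes> (filler B \<lhd> \<one> src v)"
    by (rule interchange_01_00) blast+
  moreover have "filler B \<lhd> \<one> src v = filler B"
    by (rule ident_right1) blast
  moreover have "cell u' \<cdot> at_src A = (at_tgt A \<cdot> cell u) + \<partial> (filler A)"
    using SqD(4)[OF A] by (simp add: algebra_simps)
  moreover have "((at_tgt A \<cdot> cell u) + \<partial> (filler A)) \<rtimes> filler B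
      = ((at_tgt A \<cdot> cell u) \<rtimes> filler B) + (\<partial> (filler A) \<rtimes> filler B)"
    by (rule tens_add(3)) blast+
  moreover have "\<partial> (filler A) \<rtimes> filler B = filler A \<ltimes> \<partial> (filler B)"
    by (rule tens_truncation) blast+
  moreover have "(\<one> tgt u' \<otimes> at_tgt B) \<rhd> (filler A \<ltimes> cell v)
      = (\<one> tgt u' \<rhd> filler A) \<ltimes> (at_tgt B \<cdot> cell v)"
    by (rule interchange_00_10) blast+
  moreover have "\<one> tgt u' \<rhd> filler A = filler A"
    by (rule ident_left1) blast
  moreover note ident_tens_comp[OF SqD(1)[OF A] SqD(1)[OF B]]
    ident_tens_comp[OF SqD(2)[OF A] SqD(2)[OF B]]
  ultimately show ?thesis
    by (simp add: sq_comp_def whisker_left_def whisker_right_def algebra_simps)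
qed

end

context strict_tensor
begin

lemma tens_arrow_assoc:
  "\<lbrakk>u \<in> Arr; v \<in> Arr; w \<in> Arr\<rbrakk> \<Longrightarrow> (u \<boxtimes> v) \<boxtimes> w = u \<boxtimes> (v \<boxtimes> w)"
  using tens_assoc000[OF ArrD ArrD ArrD] by (simp add: tens_arrow_def assoc_ob)

lemma whisker_left_left:
  assumes uv: "u \<in> Arr" "v \<in> Arr" and A: "A \<in> Sq w x"
  shows "u \<triangleright> (v \<triangleright> A) = (u \<boxtimes> v) \<triangleright> A"
  using tens_assoc000[OF ident_closed ident_closed SqD(1)[OF A]]
    tens_assoc000[OF ident_closed ident_closed SqD(2)[OF A]]
    tens_assoc001[OF ArrD[OF uv(1)] ArrD[OF uv(2)] SqD(3)[OF A]]
  by (simp add: tens_arrow_def whisker_left_def tens_ident[symmetric])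

lemma whisker_right_right:
  assumes uv: "u \<in> Arr" "v \<in> Arr" and A: "A \<in> Sq w x"
  shows "A \<triangleleft> u \<triangleleft> v = A \<triangleleft> (u \<boxtimes> v)"
  using tens_assoc000[OF SqD(1)[OF A] ident_closed ident_closed]
    tens_assoc000[OF SqD(2)[OF A] ident_closed ident_closed]
    tens_assoc100[OF SqD(3)[OF A] ArrD[OF uv(1)] ArrD[OF uv(2)]]
  by (simp add: tens_arrow_def whisker_right_def tens_ident[symmetric])

lemma whisker_left_right:
  assumes uv: "u \<in> Arr" "v \<in> Arr" and A: "A \<in> Sq w x"
  shows "(u \<triangleright> A) \<triangleleft> v = u \<triangleright> (A \<triangleleft> v)"
  using tens_assoc000[OF ident_closed SqD(1)[OF A] ident_closed]
    tens_assoc000[OF ident_closed SqD(2)[OF A] ident_closed]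
    tens_assoc010[OF ArrD[OF uv(1)] SqD(3)[OF A] ArrD[OF uv(2)]]
  by (simp add: whisker_left_def whisker_right_def)

end

section \<open>The pentagon for the commutator\<close>

context ch_category
begin

text \<open>
  If \<open>R' \<star> L\<close> carries \<open>A\<close> to \<open>B\<close>, then transporting \<open>A\<close> along \<open>L\<close> and \<open>B\<close> along \<open>R\<close> gives the same
  endomorphism of \<open>x\<close>. The two ways of moving a factor out of the way will be \<open>L\<close> and \<open>R\<close>.
\<close>

lemma sq_conj_eq:
  assumes arr: "x \<in> Arr" "y \<in> Arr" "z \<in> Arr"
    and L: "L \<in> Sq y x" "L' \<in> Sq x y" and R: "R \<in> Sq z x" "R' \<in> Sq x z"
    and A: "A \<in> Sq y y" "B \<in> Sq z z"
    and inv: "R \<star> R' = sq_id x" "L \<star> L' = sq_id x"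
    and nat: "(R' \<star> L) \<star> A = B \<star> (R' \<star> L)"
  shows "L \<star> A \<star> L' = R \<star> B \<star> R'"
proof -
  have AL: "A \<star> L' \<in> Sq x y" and RL: "R' \<star> L \<in> Sq y z"
    using arr L R A by (auto intro: sq_comp_closed)
  have LAL: "L \<star> A \<star> L' \<in> Sq x x"
    using arr L AL by (auto intro: sq_comp_closed)
  \<comment> \<open>Insert \<open>R \<star> R'\<close>, so that \<open>nat\<close> applies to \<open>R' \<star> L \<star> A\<close>.\<close>
  have "L \<star> A \<star> L' = (R \<star> R') \<star> (L \<star> A \<star> L')"
    unfolding inv by (rule sq_id_left[symmetric, OF LAL])
  also have "\<dots> = R \<star> R' \<star> L \<star> A \<star> L'"
    by (rule sq_comp_assoc[OF R LAL])
  also have "R' \<star> L \<star> A \<star> L' = (R' \<star> L) \<star> A \<star> L'"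
    by (rule sq_comp_assoc[symmetric, OF R(2) L(1) AL])
  also have "\<dots> = ((R' \<star> L) \<star> A) \<star> L'"
    by (rule sq_comp_assoc[symmetric, OF RL A(1) L(2)])
  also have "\<dots> = B \<star> (R' \<star> L) \<star> L'"
    unfolding nat by (rule sq_comp_assoc[OF A(2) RL L(2)])
  also have "(R' \<star> L) \<star> L' = R'"
    unfolding sq_comp_assoc[OF R(2) L] inv by (rule sq_id_right[OF R(2)])
  finally show ?thesis .
qed

lemma sq_conj_comp:
  assumes arr: "x \<in> Arr" "y \<in> Arr"
    and PQ: "P \<in> Sq x y" "Q \<in> Sq y x" and A: "A \<in> Sq y y" "B \<in> Sq y y"
    and inv: "P \<star> Q = sq_id y"
  shows "(Q \<star> A \<star> P) \<star> (Q \<star> B \<star> P) = Q \<star> (A \<star> B) \<star> P"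
proof -
  have AP: "A \<star> P \<in> Sq x y" and BP: "B \<star> P \<in> Sq x y"
    using arr PQ A by (auto intro: sq_comp_closed)
  have QBP: "Q \<star> B \<star> P \<in> Sq x x"
    using arr PQ BP by (auto intro: sq_comp_closed)
  have "(Q \<star> A \<star> P) \<star> (Q \<star> B \<star> P) = Q \<star> (A \<star> P) \<star> Q \<star> B \<star> P"
    by (rule sq_comp_assoc[OF PQ(2) AP QBP])
  also have "(A \<star> P) \<star> Q \<star> B \<star> P = A \<star> P \<star> Q \<star> B \<star> P"
    by (rule sq_comp_assoc[OF A(1) PQ(1) QBP])
  also have "P \<star> Q \<star> B \<star> P = B \<star> P"
    unfolding sq_comp_assoc[symmetric, OF PQ BP] inv by (rule sq_id_left[OF BP])
  also have "A \<star> B \<star> P = (A \<star> B) \<star> P"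
    by (rule sq_comp_assoc[symmetric, OF A PQ(1)])
  finally show ?thesis .
qed

definition sq_commutator :: "('a, 'b) square \<Rightarrow> ('a, 'b) square \<Rightarrow> ('a, 'b) square" where
  "sq_commutator A B = (A \<star> B) - (B \<star> A)"

end

context ch_tensor
begin

lemma whisker_left_commutator:
  assumes "u \<in> Arr" "v \<in> Arr" "A \<in> Sq v v" "B \<in> Sq v v"
  shows "u \<triangleright> sq_commutator A B = sq_commutator (u \<triangleright> A) (u \<triangleright> B)"
  using assms by (simp add: sq_commutator_def sq_comp_closed whisker_left_comp
      whisker_left_diff[where v = v and w = v])

lemma whisker_right_commutator:
  assumes "u \<in> Arr" "v \<in> Arr" "A \<in> Sq v v" "B \<in> Sq v v"
  shows "sq_commutator A B \<triangleleft> u = sq_commutator (A \<triangleleft> u) (B \<triangleleft> u)"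
  using assms by (simp add: sq_commutator_def sq_comp_closed whisker_right_comp
      whisker_right_diff[where v = v and w = v])

end

context symmetric_strict_monoidal
begin

sublocale strict_tensor C
  by (rule strict_tensor)

definition braid_square :: "('o, 'a) arrow \<Rightarrow> ('o, 'a) arrow \<Rightarrow> ('a, 'b) square" where
  "braid_square u v = Square (\<gamma> (src u, src v)) (\<gamma> (tgt u, tgt v)) 0"

lemma braid_square_closed:
  assumes "u \<in> Arr" "v \<in> Arr"
  shows "braid_square u v \<in> Sq (u \<boxtimes> v) (v \<boxtimes> u)"
proof -
  interpret \<gamma>: pseudonatural2 C "tensor C" "tensor_flip C" "\<lparr>at_ob = \<gamma>, along = (\<lambda>s s' p. 0)\<rparr>"
    by (rule symmetry_natural)
  show ?thesis
    using \<gamma>.natural_00[OF ArrD[OF assms(1)] ArrD[OF assms(2)]] \<gamma>.at_closed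
    by (simp add: braid_square_def Sq_def tens_arrow_def tensor_def tensor_flip_def Hom_zero)
qed

lemma braid_square_involutive:
  assumes "u \<in> Arr" "v \<in> Arr"
  shows "braid_square v u \<star> braid_square u v = sq_id (u \<boxtimes> v)"
  using comp_zero(3)[OF SqD(1)[OF braid_square_closed[OF assms]]]
    comp_zero(5)[OF SqD(2)[OF braid_square_closed[OF assms(2,1)]]]
  by (simp add: braid_square_def sq_comp_def sq_id_def tens_arrow_def symmetry_involutive)

text \<open>
  The homotopies agree because the vanishing of the 2-cells of \<open>\<gamma>\<close> forces \<open>\<gamma>\<close> to commute strictly
  with 2-cells.
\<close>

lemma braid_square_natural:
  assumes "u \<in> Arr" "v \<in> Arr" "w \<in> Arr" and A: "A \<in> Sq v w"
  shows "braid_square u w \<star> (u \<triangleright> A) = (A \<triangleleft> u) \<star> braid_square u v"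
proof -
  interpret \<gamma>: pseudonatural2 C "tensor C" "tensor_flip C" "\<lparr>at_ob = \<gamma>, along = (\<lambda>s s' p. 0)\<rparr>"
    by (rule symmetry_natural)
  show ?thesis
    using \<gamma>.natural_00[OF ident_closed SqD(1)[OF A], of "src u"]
      \<gamma>.natural_00[OF ident_closed SqD(2)[OF A], of "tgt u"]
      \<gamma>.natural_01[OF ArrD[OF assms(1)] SqD(3)[OF A]]
      comp_zero(3)[OF SqD(1)[OF whisker_left_closed[OF assms]]]
      comp_zero(5)[OF SqD(2)[OF whisker_right_closed[OF assms]]]
    by (simp add: braid_square_def sq_comp_def tensor_def tensor_flip_def bdry_zero
        whisker_left_def whisker_right_def)
qed

lemma braid_square_hexagon:
  assumes "u \<in> Arr" "v \<in> Arr" "w \<in> Arr"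
  shows "braid_square u (v \<boxtimes> w) = (v \<triangleright> braid_square u w) \<star> (braid_square u v \<triangleleft> w)"
proof -
  have 1: "v \<triangleright> braid_square u w \<in> Sq (v \<boxtimes> (u \<boxtimes> w)) (v \<boxtimes> (w \<boxtimes> u))"
    by (intro whisker_left_closed tens_arrow_closed braid_square_closed assms)
  have 2: "braid_square u v \<triangleleft> w \<in> Sq ((u \<boxtimes> v) \<boxtimes> w) ((v \<boxtimes> u) \<boxtimes> w)"
    by (intro whisker_right_closed tens_arrow_closed braid_square_closed assms)
  show ?thesis
    using comp_zero(3)[OF SqD(1)[OF 2]] comp_zero(5)[OF SqD(2)[OF 1]]
      tens_zero(6)[OF ArrD[OF assms(2)]] tens_zero(2)[OF ArrD[OF assms(3)]]
    by (simp add: braid_square_def sq_comp_def whisker_left_def whisker_right_def tens_arrow_def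
        symmetry_hexagon)
qed

text \<open>
  The factor \<open>v\<close> between \<open>u\<close> and \<open>w\<close> can be moved past \<open>u\<close> or past \<open>w\<close> before \<open>A\<close> acts. By the hexagon
  the two choices differ by the symmetry of \<open>v\<close> with \<open>u \<boxtimes> w\<close>, which is natural in \<open>A\<close>. The two strictness
  conditions on \<open>t\<close> use different choices, so this lemma is what makes them define the same \<open>t13\<close>.
\<close>

lemma conjugate_braid_square:
  assumes u: "u \<in> Arr" and v: "v \<in> Arr" and w: "w \<in> Arr"
    and A: "A \<in> Sq (u \<boxtimes> w) (u \<boxtimes> w)"
  shows "(braid_square v u \<triangleleft> w) \<star> (v \<triangleright> A) \<star> (braid_square u v \<triangleleft> w)
    = (u \<triangleright> braid_square w v) \<star> (A \<triangleleft> v) \<star> (u \<triangleright> braid_square v w)"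
proof -
  note closed = u v w tens_arrow_closed braid_square_closed whisker_left_closed
  let ?L = "braid_square v u \<triangleleft> w" and ?L' = "braid_square u v \<triangleleft> w"
  let ?R = "u \<triangleright> braid_square w v" and ?R' = "u \<triangleright> braid_square v w"
  let ?\<Gamma> = "braid_square v (u \<boxtimes> w)"
  have L: "?L \<in> Sq (v \<boxtimes> u \<boxtimes> w) (u \<boxtimes> v \<boxtimes> w)" "?L' \<in> Sq (u \<boxtimes> v \<boxtimes> w) (v \<boxtimes> u \<boxtimes> w)"
    using whisker_right_closed[OF w _ _ braid_square_closed[OF v u]]
      whisker_right_closed[OF w _ _ braid_square_closed[OF u v]]
    by (simp_all add: tens_arrow_assoc tens_arrow_closed u v w)
  have R: "?R \<in> Sq (u \<boxtimes> w \<boxtimes> v) (u \<boxtimes> v \<boxtimes> w)" "?R' \<in> Sq (u \<boxtimes> v \<boxtimes> w) (u \<boxtimes> w \<boxtimes> v)"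
    by (intro closed)+
  have A': "v \<triangleright> A \<in> Sq (v \<boxtimes> u \<boxtimes> w) (v \<boxtimes> u \<boxtimes> w)" "A \<triangleleft> v \<in> Sq (u \<boxtimes> w \<boxtimes> v) (u \<boxtimes> w \<boxtimes> v)"
    using whisker_right_closed[OF v _ _ A] whisker_left_closed[OF v _ _ A]
    by (simp_all add: tens_arrow_assoc tens_arrow_closed u v w)
  have arr: "u \<boxtimes> v \<boxtimes> w \<in> Arr" "v \<boxtimes> u \<boxtimes> w \<in> Arr" "u \<boxtimes> w \<boxtimes> v \<in> Arr"
    by (intro closed)+
  have \<Gamma>: "?\<Gamma> = ?R' \<star> ?L"
    by (intro braid_square_hexagon u v w)
  have RR: "?R \<star> ?R' = sq_id (u \<boxtimes> v \<boxtimes> w)"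
    using whisker_left_comp[OF u braid_square_closed[OF w v] braid_square_closed[OF v w]]
    by (simp add: braid_square_involutive v w whisker_left_id u)
  have LL: "?L \<star> ?L' = sq_id (u \<boxtimes> v \<boxtimes> w)"
    using whisker_right_comp[OF w braid_square_closed[OF v u] braid_square_closed[OF u v]]
    by (simp add: braid_square_involutive u v whisker_right_id w tens_arrow_assoc)
  have nat: "(?R' \<star> ?L) \<star> (v \<triangleright> A) = (A \<triangleleft> v) \<star> (?R' \<star> ?L)"
    using braid_square_natural[OF v _ _ A] by (simp add: \<Gamma> u w tens_arrow_closed)
  show ?thesis
    by (rule sq_conj_eq[OF arr L R A' RR LL nat])
qed

end

locale infinitesimally_braided =
  symmetric_strict_monoidal C \<gamma> + strict_infinitesimal_2braiding C \<gamma> t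
  for C :: "('r::comm_ring_1, 'o, 'a::ab_group_add, 'b::ab_group_add, 'z) mon_cat_scheme" (structure)
    and \<gamma> t
begin

sublocale t: pseudonatural2 C "tensor C" "tensor C" t
  by (rule pseudonatural)

definition t_square :: "('o, 'a) arrow \<Rightarrow> ('o, 'a) arrow \<Rightarrow> ('a, 'b) square" where
  "t_square u v = Square (at_ob t (src u, src v)) (at_ob t (tgt u, tgt v))
     (along t (src u, src v) (tgt u, tgt v) (cell u, cell v))"

definition t13_square ::
  "('o, 'a) arrow \<Rightarrow> ('o, 'a) arrow \<Rightarrow> ('o, 'a) arrow \<Rightarrow> ('a, 'b) square" where
  "t13_square u v w =
     (braid_square v u \<triangleleft> w) \<star> (v \<triangleright> t_square u w) \<star> (braid_square u v \<triangleleft> w)"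

definition commutator_square ::
  "('o, 'a) arrow \<Rightarrow> ('o, 'a) arrow \<Rightarrow> ('o, 'a) arrow \<Rightarrow> ('a, 'b) square" where
  "commutator_square u v w =
     sq_commutator (t_square u v \<triangleleft> w) (u \<triangleright> t_square v w)"

lemma t_square_closed:
  assumes "u \<in> Arr" "v \<in> Arr"
  shows "t_square u v \<in> Sq (u \<boxtimes> v) (u \<boxtimes> v)"
  using t.at_closed t.along_closed[OF ArrD[OF assms(1)] ArrD[OF assms(2)]]
    t.natural_00[OF ArrD[OF assms(1)] ArrD[OF assms(2)]]
  by (simp add: t_square_def Sq_def tens_arrow_def tensor_def)

lemma t_square_right:
  assumes u: "u \<in> Arr" and v: "v \<in> Arr" and w: "w \<in> Arr"
  shows "t_square u (v \<boxtimes> w) = t_square u v \<triangleleft> w + t13_square u v w"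
proof -
  have 1: "braid_square v u \<triangleleft> w \<in> Sq ((v \<boxtimes> u) \<boxtimes> w) ((u \<boxtimes> v) \<boxtimes> w)"
    "braid_square u v \<triangleleft> w \<in> Sq ((u \<boxtimes> v) \<boxtimes> w) ((v \<boxtimes> u) \<boxtimes> w)"
    by (intro whisker_right_closed tens_arrow_closed braid_square_closed u v w)+
  have 2: "v \<triangleright> t_square u w \<in> Sq ((v \<boxtimes> u) \<boxtimes> w) ((v \<boxtimes> u) \<boxtimes> w)"
    unfolding tens_arrow_assoc[OF v u w]
    by (intro whisker_left_closed tens_arrow_closed t_square_closed u v w)
  show ?thesis
    using comp_zero(5)[OF SqD(2)[OF 2]]
      comp_zero(3)[OF comp00_closed[OF SqD(1)[OF 2] SqD(1)[OF 1(2)]]]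
      tens_zero(2)[OF ArrD[OF w]] strict_right_along[OF ArrD[OF u] ArrD[OF v] ArrD[OF w]]
    by (simp add: t_square_def t13_square_def sq_comp_def braid_square_def whisker_left_def
        whisker_right_def tens_arrow_def plus_square_def strict_right_at)
qed

lemma t_square_left:
  assumes u: "u \<in> Arr" and v: "v \<in> Arr" and w: "w \<in> Arr"
  shows "t_square (u \<boxtimes> v) w = u \<triangleright> t_square v w + t13_square u v w"
proof -
  have 1: "u \<triangleright> braid_square w v \<in> Sq (u \<boxtimes> w \<boxtimes> v) (u \<boxtimes> v \<boxtimes> w)"
    "u \<triangleright> braid_square v w \<in> Sq (u \<boxtimes> v \<boxtimes> w) (u \<boxtimes> w \<boxtimes> v)"
    by (intro whisker_left_closed tens_arrow_closed braid_square_closed u v w)+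
  have 2: "t_square u w \<triangleleft> v \<in> Sq (u \<boxtimes> w \<boxtimes> v) (u \<boxtimes> w \<boxtimes> v)"
    unfolding tens_arrow_assoc[OF u w v, symmetric]
    by (intro whisker_right_closed tens_arrow_closed t_square_closed u v w)
  show ?thesis
    unfolding t13_square_def conjugate_braid_square[OF u v w t_square_closed[OF u w]]
    using comp_zero(5)[OF SqD(2)[OF 2]]
      comp_zero(3)[OF comp00_closed[OF SqD(1)[OF 2] SqD(1)[OF 1(2)]]]
      tens_zero(6)[OF ArrD[OF u]] strict_left_along[OF ArrD[OF u] ArrD[OF v] ArrD[OF w]]
    by (simp add: t_square_def sq_comp_def braid_square_def whisker_left_def
        whisker_right_def tens_arrow_def plus_square_def strict_left_at)
qed

lemma t13_square_closed:
  assumes u: "u \<in> Arr" and v: "v \<in> Arr" and w: "w \<in> Arr"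
  shows "t13_square u v w \<in> Sq (u \<boxtimes> v \<boxtimes> w) (u \<boxtimes> v \<boxtimes> w)"
proof -
  have "v \<triangleright> t_square u w \<in> Sq ((v \<boxtimes> u) \<boxtimes> w) ((v \<boxtimes> u) \<boxtimes> w)"
    unfolding tens_arrow_assoc[OF v u w]
    by (intro whisker_left_closed tens_arrow_closed t_square_closed u v w)
  then show ?thesis
    unfolding t13_square_def tens_arrow_assoc[OF u v w, symmetric]
    by (rule sq_comp_closed[OF _ _ _ _ sq_comp_closed, rotated -2])
      (intro whisker_right_closed tens_arrow_closed braid_square_closed u v w)+
qed

lemma t_squares_commute_12_34:
  assumes "u \<in> Arr" "v \<in> Arr" "w \<in> Arr" "x \<in> Arr"
  shows "(t_square u v \<triangleleft> (w \<boxtimes> x)) \<star> ((u \<boxtimes> v) \<triangleright> t_square w x)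
    = ((u \<boxtimes> v) \<triangleright> t_square w x) \<star> (t_square u v \<triangleleft> (w \<boxtimes> x))"
  using assms by (intro whisker_exchange tens_arrow_closed t_square_closed)

text \<open>
  Both squares are conjugates, by the symmetry of \<open>v\<close> and \<open>w\<close>, of squares acting on disjoint pairs of
  neighbours in \<open>u \<boxtimes> w \<boxtimes> v \<boxtimes> x\<close>.
\<close>

lemma t_squares_commute_13_24:
  assumes u: "u \<in> Arr" and v: "v \<in> Arr" and w: "w \<in> Arr" and x: "x \<in> Arr"
  shows "(t13_square u v w \<triangleleft> x) \<star> (u \<triangleright> t13_square v w x)
    = (u \<triangleright> t13_square v w x) \<star> (t13_square u v w \<triangleleft> x)"
proof -
  let ?y = "u \<boxtimes> w \<boxtimes> v \<boxtimes> x" and ?z = "u \<boxtimes> v \<boxtimes> w \<boxtimes> x"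
  let ?P = "(u \<triangleright> braid_square v w) \<triangleleft> x" and ?Q = "(u \<triangleright> braid_square w v) \<triangleleft> x"
  let ?A = "t_square u w \<triangleleft> (v \<boxtimes> x)" and ?B = "(u \<boxtimes> w) \<triangleright> t_square v x"
  note arr = u v w x tens_arrow_closed
  note closed = arr braid_square_closed t_square_closed whisker_left_closed whisker_right_closed
  have b: "u \<triangleright> braid_square w v \<in> Sq (u \<boxtimes> w \<boxtimes> v) (u \<boxtimes> v \<boxtimes> w)"
    "u \<triangleright> braid_square v w \<in> Sq (u \<boxtimes> v \<boxtimes> w) (u \<boxtimes> w \<boxtimes> v)"
    "braid_square w v \<triangleleft> x \<in> Sq ((w \<boxtimes> v) \<boxtimes> x) ((v \<boxtimes> w) \<boxtimes> x)"
    "braid_square v w \<triangleleft> x \<in> Sq ((v \<boxtimes> w) \<boxtimes> x) ((w \<boxtimes> v) \<boxtimes> x)"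
    by (intro closed)+
  have t: "t_square u w \<triangleleft> v \<in> Sq ((u \<boxtimes> w) \<boxtimes> v) ((u \<boxtimes> w) \<boxtimes> v)"
    "w \<triangleright> t_square v x \<in> Sq (w \<boxtimes> v \<boxtimes> x) (w \<boxtimes> v \<boxtimes> x)"
    by (intro closed)+
  have "?P \<in> Sq ((u \<boxtimes> v \<boxtimes> w) \<boxtimes> x) ((u \<boxtimes> w \<boxtimes> v) \<boxtimes> x)"
    "?Q \<in> Sq ((u \<boxtimes> w \<boxtimes> v) \<boxtimes> x) ((u \<boxtimes> v \<boxtimes> w) \<boxtimes> x)"
    "?A \<in> Sq ((u \<boxtimes> w) \<boxtimes> (v \<boxtimes> x)) ((u \<boxtimes> w) \<boxtimes> (v \<boxtimes> x))"
    "?B \<in> Sq ((u \<boxtimes> w) \<boxtimes> (v \<boxtimes> x)) ((u \<boxtimes> w) \<boxtimes> (v \<boxtimes> x))"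
    by (intro closed)+
  then have PQ: "?P \<in> Sq ?z ?y" "?Q \<in> Sq ?y ?z" and AB: "?A \<in> Sq ?y ?y" "?B \<in> Sq ?y ?y"
    by (simp_all add: tens_arrow_assoc arr)
  have yz: "?y \<in> Arr" "?z \<in> Arr"
    by (intro closed)+
  have id: "?P \<star> ?Q = sq_id ?y"
    using whisker_right_comp[OF x b(2) b(1), symmetric]
      whisker_left_comp[OF u braid_square_closed[OF v w] braid_square_closed[OF w v], symmetric]
    by (simp add: braid_square_involutive whisker_left_id whisker_right_id tens_arrow_assoc arr)
  have t13: "t13_square u v w \<triangleleft> x = ?Q \<star> ?A \<star> ?P"
  proof -
    have t': "t_square u w \<triangleleft> v \<in> Sq (u \<boxtimes> w \<boxtimes> v) (u \<boxtimes> w \<boxtimes> v)"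
      using t(1) by (simp add: tens_arrow_assoc arr)
    have "t13_square u v w
        = (u \<triangleright> braid_square w v) \<star> (t_square u w \<triangleleft> v) \<star> (u \<triangleright> braid_square v w)"
      unfolding t13_square_def by (rule conjugate_braid_square[OF u v w t_square_closed[OF u w]])
    also have "\<dots> \<triangleleft> x = ?Q \<star> ((t_square u w \<triangleleft> v) \<star> (u \<triangleright> braid_square v w)) \<triangleleft> x"
      by (rule whisker_right_comp[OF x b(1) sq_comp_closed[OF _ _ _ t' b(2)]]) (intro arr)+
    also have "((t_square u w \<triangleleft> v) \<star> (u \<triangleright> braid_square v w)) \<triangleleft> x
        = (t_square u w \<triangleleft> v \<triangleleft> x) \<star> ?P"
      by (rule whisker_right_comp[OF x t' b(2)])
    also have "t_square u w \<triangleleft> v \<triangleleft> x = ?A"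
      by (rule whisker_right_right[OF v x t_square_closed[OF u w]])
    finally show ?thesis .
  qed
  have t24: "u \<triangleright> t13_square v w x = ?Q \<star> ?B \<star> ?P"
  proof -
    have t': "w \<triangleright> t_square v x \<in> Sq ((w \<boxtimes> v) \<boxtimes> x) ((w \<boxtimes> v) \<boxtimes> x)"
      using t(2) by (simp add: tens_arrow_assoc arr)
    have "u \<triangleright> t13_square v w x = (u \<triangleright> (braid_square w v \<triangleleft> x))
        \<star> (u \<triangleright> ((w \<triangleright> t_square v x) \<star> (braid_square v w \<triangleleft> x)))"
      unfolding t13_square_def
      by (rule whisker_left_comp[OF u b(3) sq_comp_closed[OF _ _ _ t' b(4)]]) (intro arr)+
    also have "u \<triangleright> ((w \<triangleright> t_square v x) \<star> (braid_square v w \<triangleleft> x))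
        = (u \<triangleright> w \<triangleright> t_square v x) \<star> (u \<triangleright> (braid_square v w \<triangleleft> x))"
      by (rule whisker_left_comp[OF u t' b(4)])
    also have "u \<triangleright> w \<triangleright> t_square v x = ?B"
      by (rule whisker_left_left[OF u w t_square_closed[OF v x]])
    also have "u \<triangleright> (braid_square w v \<triangleleft> x) = ?Q"
      by (rule whisker_left_right[OF u x braid_square_closed[OF w v], symmetric])
    also have "u \<triangleright> (braid_square v w \<triangleleft> x) = ?P"
      by (rule whisker_left_right[OF u x braid_square_closed[OF v w], symmetric])
    finally show ?thesis .
  qed
  have "?A \<star> ?B = ?B \<star> ?A"
    by (intro whisker_exchange closed)
  then show ?thesis
    unfolding t13 t24 using sq_conj_comp[OF yz(2,1) PQ AB id] sq_conj_comp[OF yz(2,1) PQ AB(2,1) id]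
    by simp
qed

text \<open>
  After expansion into \<open>t12\<close>, ..., \<open>t34\<close> the two sides differ by the commutators of \<open>t12\<close> with \<open>t34\<close>
  and of \<open>t13\<close> with \<open>t24\<close>.
\<close>

lemma commutator_pentagon:
  assumes u: "u \<in> Arr" and v: "v \<in> Arr" and w: "w \<in> Arr" and x: "x \<in> Arr"
  shows "u \<triangleright> commutator_square v w x + commutator_square u (v \<boxtimes> w) x
      + commutator_square u v w \<triangleleft> x
    = commutator_square u v (w \<boxtimes> x) + commutator_square (u \<boxtimes> v) w x"
proof -
  let ?z = "u \<boxtimes> v \<boxtimes> w \<boxtimes> x"
  define t12 where "t12 = t_square u v \<triangleleft> (w \<boxtimes> x)"
  define t34 where "t34 = (u \<boxtimes> v) \<triangleright> t_square w x"
  define t23 where "t23 = (u \<triangleright> t_square v w) \<triangleleft> x"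
  define t13 where "t13 = t13_square u v w \<triangleleft> x"
  define t24 where "t24 = u \<triangleright> t13_square v w x"
  note arr = u v w x tens_arrow_closed
  note closed = arr t_square_closed t13_square_closed whisker_left_closed whisker_right_closed
  have "t12 \<in> Sq ((u \<boxtimes> v) \<boxtimes> (w \<boxtimes> x)) ((u \<boxtimes> v) \<boxtimes> (w \<boxtimes> x))"
    "t34 \<in> Sq ((u \<boxtimes> v) \<boxtimes> (w \<boxtimes> x)) ((u \<boxtimes> v) \<boxtimes> (w \<boxtimes> x))"
    "t23 \<in> Sq ((u \<boxtimes> (v \<boxtimes> w)) \<boxtimes> x) ((u \<boxtimes> (v \<boxtimes> w)) \<boxtimes> x)"
    "t13 \<in> Sq ((u \<boxtimes> (v \<boxtimes> w)) \<boxtimes> x) ((u \<boxtimes> (v \<boxtimes> w)) \<boxtimes> x)"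
    "t24 \<in> Sq ?z ?z"
    unfolding t12_def t34_def t23_def t13_def t24_def by (intro closed)+
  then have tz: "t12 \<in> Sq ?z ?z" "t34 \<in> Sq ?z ?z" "t23 \<in> Sq ?z ?z" "t13 \<in> Sq ?z ?z" "t24 \<in> Sq ?z ?z"
    by (simp_all add: tens_arrow_assoc arr)
  have z: "?z \<in> Arr"
    by (intro arr)
  note bihom = bihom_sq_comp[OF z z z]
  have uvw: "t_square u v \<triangleleft> w \<in> Sq ((u \<boxtimes> v) \<boxtimes> w) ((u \<boxtimes> v) \<boxtimes> w)"
    "u \<triangleright> t_square v w \<in> Sq (u \<boxtimes> (v \<boxtimes> w)) (u \<boxtimes> (v \<boxtimes> w))"
    "t_square v w \<triangleleft> x \<in> Sq ((v \<boxtimes> w) \<boxtimes> x) ((v \<boxtimes> w) \<boxtimes> x)"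
    "v \<triangleright> t_square w x \<in> Sq (v \<boxtimes> (w \<boxtimes> x)) (v \<boxtimes> (w \<boxtimes> x))"
    by (intro closed)+
  have t13': "t13_square u v w \<in> Sq (u \<boxtimes> v \<boxtimes> w) (u \<boxtimes> v \<boxtimes> w)"
    "t13_square v w x \<in> Sq (v \<boxtimes> w \<boxtimes> x) (v \<boxtimes> w \<boxtimes> x)"
    by (intro closed)+
  have "u \<triangleright> commutator_square v w x = sq_commutator t23 t34"
  proof -
    have "u \<triangleright> commutator_square v w x
        = sq_commutator (u \<triangleright> (t_square v w \<triangleleft> x)) (u \<triangleright> (v \<triangleright> t_square w x))"
      unfolding commutator_square_def
      using uvw(3,4) by (intro whisker_left_commutator[of _ "v \<boxtimes> w \<boxtimes> x"])
        (simp_all add: tens_arrow_assoc arr)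
    then show ?thesis
      by (simp add: t23_def t34_def whisker_left_right[OF u x t_square_closed[OF v w]]
          whisker_left_left[OF u v t_square_closed[OF w x]])
  qed
  moreover have "commutator_square u v w \<triangleleft> x = sq_commutator t12 t23"
  proof -
    have "commutator_square u v w \<triangleleft> x
        = sq_commutator (t_square u v \<triangleleft> w \<triangleleft> x) ((u \<triangleright> t_square v w) \<triangleleft> x)"
      unfolding commutator_square_def
      using uvw(1,2) by (intro whisker_right_commutator[of _ "u \<boxtimes> v \<boxtimes> w"])
        (simp_all add: tens_arrow_assoc arr)
    then show ?thesis
      by (simp add: t12_def t23_def whisker_right_right[OF w x t_square_closed[OF u v]])
  qed
  moreover have "commutator_square u (v \<boxtimes> w) x = sq_commutator (t12 + t13) (t34 + t24)"
  proof -
    have "t_square u (v \<boxtimes> w) \<triangleleft> x = t12 + t13"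
      unfolding t_square_right[OF u v w] t12_def t13_def
      using whisker_right_add[OF x _ t13'(1), of "t_square u v \<triangleleft> w"] uvw(1)
      by (simp add: tens_arrow_assoc arr whisker_right_right[OF w x t_square_closed[OF u v]])
    moreover have "u \<triangleright> t_square (v \<boxtimes> w) x = t34 + t24"
      unfolding t_square_left[OF v w x] t34_def t24_def
      using whisker_left_add[OF u uvw(4) t13'(2)]
      by (simp add: whisker_left_left[OF u v t_square_closed[OF w x]])
    ultimately show ?thesis
      by (simp add: commutator_square_def)
  qed
  moreover have "commutator_square u v (w \<boxtimes> x) = sq_commutator t12 (t23 + t24)"
  proof -
    have "u \<triangleright> t_square v (w \<boxtimes> x) = t23 + t24"
      unfolding t_square_right[OF v w x] t23_def t24_def
      using whisker_left_add[OF u _ t13'(2), of "t_square v w \<triangleleft> x"] uvw(3)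
      by (simp add: tens_arrow_assoc arr whisker_left_right[OF u x t_square_closed[OF v w]])
    then show ?thesis
      by (simp add: commutator_square_def t12_def)
  qed
  moreover have "commutator_square (u \<boxtimes> v) w x = sq_commutator (t23 + t13) t34"
  proof -
    have "t_square (u \<boxtimes> v) w \<triangleleft> x = t23 + t13"
      unfolding t_square_left[OF u v w] t23_def t13_def
      by (rule whisker_right_add[OF x uvw(2) t13'(1)])
    then show ?thesis
      by (simp add: commutator_square_def t34_def)
  qed
  moreover have "t12 \<star> t34 = t34 \<star> t12"
    unfolding t12_def t34_def by (rule t_squares_commute_12_34[OF u v w x])
  moreover have "t13 \<star> t24 = t24 \<star> t13"
    unfolding t13_def t24_def by (rule t_squares_commute_13_24[OF u v w x])
  ultimately show ?thesis
    by (simp add: sq_commutator_def tz bihom_add_left[OF bihom] bihom_add_right[OF bihom]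
        bihom_sum_closed[OF bihom])
qed

end

section \<open>Operations on pseudonatural transformations\<close>

text \<open>
  In a strict monoidal category \<open>\<otimes>(\<otimes> \<boxtimes> id)\<close> and \<open>\<otimes>(id \<boxtimes> \<otimes>)\<close> are the same functor, but their
  representing functions may differ outside the hom modules.
\<close>

definition fun3_agree :: "('r, 'o, 'a, 'b, 'z) ch_cat_scheme \<Rightarrow>
    ('o, 'a, 'b) fun3 \<Rightarrow> ('o, 'a, 'b) fun3 \<Rightarrow> bool"
  where
  "fun3_agree C F G \<longleftrightarrow> fun3_ob F = fun3_ob G \<and>
     (\<forall>U U' V V' W W'.
       (\<forall>f\<in>Hom0 C U U'. \<forall>g\<in>Hom0 C V V'. \<forall>k\<in>Hom0 C W W'. fun3_000 F f g k = fun3_000 G f g k) \<and>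
       (\<forall>\<phi>\<in>Hom1 C U U'. \<forall>g\<in>Hom0 C V V'. \<forall>k\<in>Hom0 C W W'. fun3_100 F \<phi> g k = fun3_100 G \<phi> g k) \<and>
       (\<forall>f\<in>Hom0 C U U'. \<forall>\<phi>\<in>Hom1 C V V'. \<forall>k\<in>Hom0 C W W'. fun3_010 F f \<phi> k = fun3_010 G f \<phi> k) \<and>
       (\<forall>f\<in>Hom0 C U U'. \<forall>g\<in>Hom0 C V V'. \<forall>\<phi>\<in>Hom1 C W W'. fun3_001 F f g \<phi> = fun3_001 G f g \<phi>))"

lemma fun3_agreeD:
  assumes "fun3_agree C F G"
  shows "fun3_ob F U V W = fun3_ob G U V W"
    and "\<lbrakk>f \<in> Hom0 C U U'; g \<in> Hom0 C V V'; k \<in> Hom0 C W W'\<rbrakk> \<Longrightarrow> fun3_000 F f g k = fun3_000 G f g k"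
    and "\<lbrakk>\<phi> \<in> Hom1 C U U'; g \<in> Hom0 C V V'; k \<in> Hom0 C W W'\<rbrakk> \<Longrightarrow> fun3_100 F \<phi> g k = fun3_100 G \<phi> g k"
    and "\<lbrakk>f \<in> Hom0 C U U'; \<phi> \<in> Hom1 C V V'; k \<in> Hom0 C W W'\<rbrakk> \<Longrightarrow> fun3_010 F f \<phi> k = fun3_010 G f \<phi> k"
    and "\<lbrakk>f \<in> Hom0 C U U'; g \<in> Hom0 C V V'; \<phi> \<in> Hom1 C W W'\<rbrakk> \<Longrightarrow> fun3_001 F f g \<phi> = fun3_001 G f g \<phi>"
  using assms by (auto simp: fun3_agree_def)

lemma pseudonatural3_cong:
  assumes F: "fun3_agree C F F'" and G: "fun3_agree C G G'" and "pseudonatural3 C F G \<xi>"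
  shows "pseudonatural3 C F' G' \<xi>"
proof -
  interpret pseudonatural3 C F G \<xi> by fact
  show ?thesis
  proof (unfold_locales, goal_cases)
    case 1 show ?case
      using at_closed by (simp add: fun3_agreeD[OF F] fun3_agreeD[OF G])
  next
    case 2 then show ?case
      using along_closed by (simp add: fun3_agreeD[OF F] fun3_agreeD[OF G])
  next
    case 3 show ?case by (rule along_trilinear)
  next
    case 4 then show ?case
      using natural_000[OF 4] by (simp add: fun3_agreeD(2)[OF F 4] fun3_agreeD(2)[OF G 4])
  next
    case 5 then show ?case
      using natural_100[OF 5] by (simp add: fun3_agreeD(3)[OF F 5] fun3_agreeD(3)[OF G 5])
  next
    case 6 then show ?case
      using natural_010[OF 6] by (simp add: fun3_agreeD(4)[OF F 6] fun3_agreeD(4)[OF G 6])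
  next
    case 7 then show ?case
      using natural_001[OF 7] by (simp add: fun3_agreeD(5)[OF F 7] fun3_agreeD(5)[OF G 7])
  next
    case 8 show ?case by (rule along_ident)
  next
    case 9 then show ?case
      using along_comp[OF 9]
      by (simp add: fun3_agreeD(2)[OF F 9(1,3,5)] fun3_agreeD(2)[OF G 9(2,4,6)])
  qed
qed

definition fun3_closed :: "('r, 'o, 'a, 'b, 'z) ch_cat_scheme \<Rightarrow> ('o, 'a, 'b) fun3 \<Rightarrow> bool" where
  "fun3_closed C F \<longleftrightarrow>
     (\<forall>U U' V V' W W'.
       (\<forall>f\<in>Hom0 C U U'. \<forall>g\<in>Hom0 C V V'. \<forall>k\<in>Hom0 C W W'.
         fun3_000 F f g k \<in> Hom0 C (fun3_ob F U V W) (fun3_ob F U' V' W')) \<and>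
       (\<forall>\<phi>\<in>Hom1 C U U'. \<forall>g\<in>Hom0 C V V'. \<forall>k\<in>Hom0 C W W'.
         fun3_100 F \<phi> g k \<in> Hom1 C (fun3_ob F U V W) (fun3_ob F U' V' W')) \<and>
       (\<forall>f\<in>Hom0 C U U'. \<forall>\<phi>\<in>Hom1 C V V'. \<forall>k\<in>Hom0 C W W'.
         fun3_010 F f \<phi> k \<in> Hom1 C (fun3_ob F U V W) (fun3_ob F U' V' W')) \<and>
       (\<forall>f\<in>Hom0 C U U'. \<forall>g\<in>Hom0 C V V'. \<forall>\<phi>\<in>Hom1 C W W'.
         fun3_001 F f g \<phi> \<in> Hom1 C (fun3_ob F U V W) (fun3_ob F U' V' W')))"

lemma fun3_closedD:
  assumes "fun3_closed C F"
  shows "\<lbrakk>f \<in> Hom0 C U U'; g \<in> Hom0 C V V'; k \<in> Hom0 C W W'\<rbrakk>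
      \<Longrightarrow> fun3_000 F f g k \<in> Hom0 C (fun3_ob F U V W) (fun3_ob F U' V' W')"
    and "\<lbrakk>\<phi> \<in> Hom1 C U U'; g \<in> Hom0 C V V'; k \<in> Hom0 C W W'\<rbrakk>
      \<Longrightarrow> fun3_100 F \<phi> g k \<in> Hom1 C (fun3_ob F U V W) (fun3_ob F U' V' W')"
    and "\<lbrakk>f \<in> Hom0 C U U'; \<phi> \<in> Hom1 C V V'; k \<in> Hom0 C W W'\<rbrakk>
      \<Longrightarrow> fun3_010 F f \<phi> k \<in> Hom1 C (fun3_ob F U V W) (fun3_ob F U' V' W')"
    and "\<lbrakk>f \<in> Hom0 C U U'; g \<in> Hom0 C V V'; \<phi> \<in> Hom1 C W W'\<rbrakk>
      \<Longrightarrow> fun3_001 F f g \<phi> \<in> Hom1 C (fun3_ob F U V W) (fun3_ob F U' V' W')"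
  using assms by (auto simp: fun3_closed_def)

context ch_category
begin

lemma comp_diff:
  "\<lbrakk>g \<in> Hom0 C V W; g' \<in> Hom0 C V W; f \<in> Hom0 C U V\<rbrakk> \<Longrightarrow> (g - g') \<cdot> f = (g \<cdot> f) - (g' \<cdot> f)"
  "\<lbrakk>g \<in> Hom0 C V W; g' \<in> Hom0 C V W; \<phi> \<in> Hom1 C U V\<rbrakk> \<Longrightarrow> (g - g') \<rhd> \<phi> = (g \<rhd> \<phi>) - (g' \<rhd> \<phi>)"
  "\<lbrakk>\<psi> \<in> Hom1 C V W; \<psi>' \<in> Hom1 C V W; f \<in> Hom0 C U V\<rbrakk> \<Longrightarrow> (\<psi> - \<psi>') \<lhd> f = (\<psi> \<lhd> f) - (\<psi>' \<lhd> f)"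
  "\<lbrakk>g \<in> Hom0 C V W; f \<in> Hom0 C U V; f' \<in> Hom0 C U V\<rbrakk> \<Longrightarrow> g \<cdot> (f - f') = (g \<cdot> f) - (g \<cdot> f')"
  "\<lbrakk>g \<in> Hom0 C V W; \<phi> \<in> Hom1 C U V; \<phi>' \<in> Hom1 C U V\<rbrakk> \<Longrightarrow> g \<rhd> (\<phi> - \<phi>') = (g \<rhd> \<phi>) - (g \<rhd> \<phi>')"
  "\<lbrakk>\<psi> \<in> Hom1 C V W; f \<in> Hom0 C U V; f' \<in> Hom0 C U V\<rbrakk> \<Longrightarrow> \<psi> \<lhd> (f - f') = (\<psi> \<lhd> f) - (\<psi> \<lhd> f')"
  using comp_add(1)[of "g - g'" V W g' f U] comp_add(2)[of "g - g'" V W g' \<phi> U]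
    comp_add(3)[of "\<psi> - \<psi>'" V W \<psi>' f U] comp_add(4)[of g V W "f - f'" U f']
    comp_add(5)[of g V W "\<phi> - \<phi>'" U \<phi>'] comp_add(6)[of \<psi> V W "f - f'" U f']
  by (simp_all add: Hom_diff)

lemma comp_smul:
  "\<lbrakk>g \<in> Hom0 C V W; f \<in> Hom0 C U V\<rbrakk> \<Longrightarrow> smul0 C r g \<cdot> f = smul0 C r (g \<cdot> f)"
  "\<lbrakk>g \<in> Hom0 C V W; \<phi> \<in> Hom1 C U V\<rbrakk> \<Longrightarrow> smul0 C r g \<rhd> \<phi> = smul1 C r (g \<rhd> \<phi>)"
  "\<lbrakk>\<psi> \<in> Hom1 C V W; f \<in> Hom0 C U V\<rbrakk> \<Longrightarrow> smul1 C r \<psi> \<lhd> f = smul1 C r (\<psi> \<lhd> f)"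
  "\<lbrakk>g \<in> Hom0 C V W; f \<in> Hom0 C U V\<rbrakk> \<Longrightarrow> g \<cdot> smul0 C r f = smul0 C r (g \<cdot> f)"
  "\<lbrakk>g \<in> Hom0 C V W; \<phi> \<in> Hom1 C U V\<rbrakk> \<Longrightarrow> g \<rhd> smul1 C r \<phi> = smul1 C r (g \<rhd> \<phi>)"
  "\<lbrakk>\<psi> \<in> Hom1 C V W; f \<in> Hom0 C U V\<rbrakk> \<Longrightarrow> \<psi> \<lhd> smul0 C r f = smul1 C r (\<psi> \<lhd> f)"
  using comp00_bilinear[of V W U] comp01_bilinear[of V W U] comp10_bilinear[of V W U]
  by (simp_all add: bilinear_on_def linear_on_def)

lemma Hom_smul:
  "f \<in> Hom0 C U V \<Longrightarrow> smul0 C r f \<in> Hom0 C U V" "\<phi> \<in> Hom1 C U V \<Longrightarrow> smul1 C r \<phi> \<in> Hom1 C U V"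
  using module.subspace_scale[OF module0 submodule0] module.subspace_scale[OF module1 submodule1]
  by auto

lemma bdry_smul: "\<phi> \<in> Hom1 C U V \<Longrightarrow> \<partial> (smul1 C r \<phi>) = smul0 C r (\<partial> \<phi>)"
  using bdry_linear[of U V] by (simp add: linear_on_def)

lemma linear_on_add:
  assumes "linear_on s (smul1 C) M \<phi>" "linear_on s (smul1 C) M \<psi>"
  shows "linear_on s (smul1 C) M (\<lambda>x. \<phi> x + \<psi> x)"
  using assms by (simp add: linear_on_def module.scale_right_distrib[OF module1] algebra_simps)

lemma linear_on_diff:
  assumes "linear_on s (smul1 C) M \<phi>" "linear_on s (smul1 C) M \<psi>"
  shows "linear_on s (smul1 C) M (\<lambda>x. \<phi> x - \<psi> x)"
  using assms by (simp add: linear_on_def module.scale_right_diff_distrib[OF module1] algebra_simps)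

lemma linear_on_smul:
  assumes "linear_on s (smul1 C) M \<phi>"
  shows "linear_on s (smul1 C) M (\<lambda>x. smul1 C r (\<phi> x))"
  using assms by (simp add: linear_on_def module.scale_right_distrib[OF module1]
      module.scale_scale[OF module1] mult.commute)

lemma linear_on_comp:
  assumes "linear_on s (smul1 C) M \<phi>"
  shows "\<lbrakk>\<And>x. x \<in> M \<Longrightarrow> \<phi> x \<in> Hom1 C V W; f \<in> Hom0 C U V\<rbrakk> \<Longrightarrow> linear_on s (smul1 C) M (\<lambda>x. \<phi> x \<lhd> f)"
    and "\<lbrakk>\<And>x. x \<in> M \<Longrightarrow> \<phi> x \<in> Hom1 C U V; g \<in> Hom0 C V W\<rbrakk> \<Longrightarrow> linear_on s (smul1 C) M (\<lambda>x. g \<rhd> \<phi> x)"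
  using assms comp_add(3)[of _ V W _ f U] comp_add(5)[of g V W _ U] comp_smul(3)[of _ V W f U]
    comp_smul(5)[of g V W _ U]
  by (simp_all add: linear_on_def)

lemma natural_comp:
  assumes F: "\<Phi> \<in> Hom1 C X X'" and \<xi>: "\<xi> \<in> Hom0 C X X" "\<xi>' \<in> Hom0 C X' X'"
    and \<theta>: "\<theta> \<in> Hom0 C X X" "\<theta>' \<in> Hom0 C X' X'"
  shows "(\<Phi> \<lhd> (\<theta> \<cdot> \<xi>)) - ((\<theta>' \<cdot> \<xi>') \<rhd> \<Phi>)
    = (((\<Phi> \<lhd> \<theta>) - (\<theta>' \<rhd> \<Phi>)) \<lhd> \<xi>) + (\<theta>' \<rhd> ((\<Phi> \<lhd> \<xi>) - (\<xi>' \<rhd> \<Phi>)))"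
  using comp_diff(3)[OF comp10_closed[OF F \<theta>(1)] comp01_closed[OF \<theta>(2) F] \<xi>(1)]
    comp_diff(5)[OF \<theta>(2) comp10_closed[OF F \<xi>(1)] comp01_closed[OF \<xi>(2) F]]
    assoc100[OF F \<theta>(1) \<xi>(1)] assoc010[OF \<theta>(2) F \<xi>(1)] assoc001[OF \<theta>(2) \<xi>(2) F]
  by simp

text \<open>
  Compatibility of vertical composition with composition of 1-cells \<open>a\<close>, \<open>b\<close>. The two sides differ by
  \<open>q' (\<partial> p) - (\<partial> q') p\<close>, which vanishes by truncation.
\<close>

lemma along_comp_vcomp:
  assumes a: "a \<in> Hom0 C X X'" and b: "b \<in> Hom0 C X' X''"
    and \<xi>: "\<xi> \<in> Hom0 C X X" "\<xi>' \<in> Hom0 C X' X'"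
    and \<theta>: "\<theta>' \<in> Hom0 C X' X'" "\<theta>'' \<in> Hom0 C X'' X''"
    and p: "p \<in> Hom1 C X X'" "p' \<in> Hom1 C X' X''"
    and q: "q \<in> Hom1 C X X'" "q' \<in> Hom1 C X' X''"
    and nat: "(a \<cdot> \<xi>) - (\<xi>' \<cdot> a) = \<partial> p" "(b \<cdot> \<theta>') - (\<theta>'' \<cdot> b) = \<partial> q'"
  shows "(((q' \<lhd> a) + (b \<rhd> q)) \<lhd> \<xi>) + (\<theta>'' \<rhd> ((p' \<lhd> a) + (b \<rhd> p)))
    = (((q' \<lhd> \<xi>') + (\<theta>'' \<rhd> p')) \<lhd> a) + (b \<rhd> ((q \<lhd> \<xi>) + (\<theta>' \<rhd> p)))"
proof -
  note [intro] = comp_closed a b \<xi> \<theta> p q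
  have "q' \<lhd> ((a \<cdot> \<xi>) - (\<xi>' \<cdot> a)) = (q' \<lhd> (a \<cdot> \<xi>)) - (q' \<lhd> (\<xi>' \<cdot> a))"
    by (rule comp_diff(6)) blast+
  moreover have "((b \<cdot> \<theta>') - (\<theta>'' \<cdot> b)) \<rhd> p = ((b \<cdot> \<theta>') \<rhd> p) - ((\<theta>'' \<cdot> b) \<rhd> p)"
    by (rule comp_diff(2)) blast+
  moreover have "\<partial> q' \<rhd> p = q' \<lhd> \<partial> p"
    by (rule truncation[OF q(2) p(1)])
  ultimately have key: "(q' \<lhd> (a \<cdot> \<xi>)) - (q' \<lhd> (\<xi>' \<cdot> a)) = ((b \<cdot> \<theta>') \<rhd> p) - ((\<theta>'' \<cdot> b) \<rhd> p)"
    by (simp add: nat)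
  have "((q' \<lhd> a) + (b \<rhd> q)) \<lhd> \<xi> = ((q' \<lhd> a) \<lhd> \<xi>) + ((b \<rhd> q) \<lhd> \<xi>)"
    "((q' \<lhd> \<xi>') + (\<theta>'' \<rhd> p')) \<lhd> a = ((q' \<lhd> \<xi>') \<lhd> a) + ((\<theta>'' \<rhd> p') \<lhd> a)"
    by (rule comp_add(3); blast)+
  moreover have "\<theta>'' \<rhd> ((p' \<lhd> a) + (b \<rhd> p)) = (\<theta>'' \<rhd> (p' \<lhd> a)) + (\<theta>'' \<rhd> (b \<rhd> p))"
    "b \<rhd> ((q \<lhd> \<xi>) + (\<theta>' \<rhd> p)) = (b \<rhd> (q \<lhd> \<xi>)) + (b \<rhd> (\<theta>' \<rhd> p))"
    by (rule comp_add(5); blast)+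
  ultimately show ?thesis
    using key assoc100[OF q(2) a \<xi>(1)] assoc100[OF q(2) \<xi>(2) a] assoc010[OF b q(1) \<xi>(1)]
      assoc010[OF \<theta>(2) p(2) a] assoc001[OF \<theta>(2) b p(1)] assoc001[OF b \<theta>(1) p(1)]
    by (simp add: algebra_simps)
qed

lemma pseudonatural3_vcomp:
  assumes F: "fun3_closed C F" and "pseudonatural3 C F F \<theta>" "pseudonatural3 C F F \<xi>"
  shows "pseudonatural3 C F F (tr_vcomp C \<theta> \<xi>)"
proof -
  interpret \<theta>: pseudonatural3 C F F \<theta> by fact
  interpret \<xi>: pseudonatural3 C F F \<xi> by fact
  show ?thesis
  proof (unfold_locales, unfold tr_vcomp_def transf.simps, goal_cases)
    case 1 show ?case
      by (rule comp00_closed[OF \<theta>.at_closed \<xi>.at_closed])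
  next
    case 2 then show ?case
      by (intro Hom_add comp10_closed[OF \<theta>.along_closed \<xi>.at_closed]
          comp01_closed[OF \<theta>.at_closed \<xi>.along_closed])
  next
    case (3 U U' V V' W W') show ?case
      using \<theta>.along_trilinear[of U U' V V' W W'] \<xi>.along_trilinear[of U U' V V' W W']
      unfolding trilinear_on_def
      by (auto intro!: linear_on_add linear_on_comp[OF _ _ \<xi>.at_closed] \<theta>.along_closed
          linear_on_comp[OF _ _ \<theta>.at_closed] \<xi>.along_closed)
  next
    case (4 f U U' g V V' k W W')
    \<comment> \<open>Both transformations give endomorphism squares of the 1-cell \<open>F(f, g, k)\<close>.\<close>
    let ?u = "Arrow (fun3_ob F U V W) (fun3_ob F U' V' W') (fun3_000 F f g k)"
    let ?\<theta> = "Square (at_ob \<theta> (U,V,W)) (at_ob \<theta> (U',V',W')) (along \<theta> (U,V,W) (U',V',W') (f,g,k))"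
    let ?\<xi> = "Square (at_ob \<xi> (U,V,W)) (at_ob \<xi> (U',V',W')) (along \<xi> (U,V,W) (U',V',W') (f,g,k))"
    have "?u \<in> Arr"
      using fun3_closedD(1)[OF F 4] by (simp add: Arr_def)
    moreover have "?\<theta> \<in> Sq ?u ?u" "?\<xi> \<in> Sq ?u ?u"
      using \<theta>.natural_000[OF 4] \<theta>.along_closed[OF 4] \<theta>.at_closed
        \<xi>.natural_000[OF 4] \<xi>.along_closed[OF 4] \<xi>.at_closed
      by (simp_all add: Sq_def)
    ultimately show ?case
      using SqD(4)[OF sq_comp_closed, of ?u ?u ?u ?\<theta> ?\<xi>] by (simp add: sq_comp_def)
  next
    case 5 show ?case
      using natural_comp[OF fun3_closedD(2)[OF F 5] \<xi>.at_closed \<xi>.at_closed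
          \<theta>.at_closed \<theta>.at_closed]
      by (simp add: \<theta>.natural_100[OF 5] \<xi>.natural_100[OF 5])
  next
    case 6 show ?case
      using natural_comp[OF fun3_closedD(3)[OF F 6] \<xi>.at_closed \<xi>.at_closed
          \<theta>.at_closed \<theta>.at_closed]
      by (simp add: \<theta>.natural_010[OF 6] \<xi>.natural_010[OF 6])
  next
    case 7 show ?case
      using natural_comp[OF fun3_closedD(4)[OF F 7] \<xi>.at_closed \<xi>.at_closed
          \<theta>.at_closed \<theta>.at_closed]
      by (simp add: \<theta>.natural_001[OF 7] \<xi>.natural_001[OF 7])
  next
    case 8 show ?case
      by (simp add: \<theta>.along_ident \<xi>.along_ident comp_zero(3)[OF \<xi>.at_closed]
          comp_zero(5)[OF \<theta>.at_closed])
  next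
    case 9
    note m = 9(1,3,5) and m' = 9(2,4,6)
    show ?case
      unfolding \<theta>.along_comp[OF 9] \<xi>.along_comp[OF 9]
      by (rule along_comp_vcomp[OF fun3_closedD(1)[OF F m] fun3_closedD(1)[OF F m']
            \<xi>.at_closed \<xi>.at_closed \<theta>.at_closed \<theta>.at_closed
            \<xi>.along_closed[OF m] \<xi>.along_closed[OF m'] \<theta>.along_closed[OF m] \<theta>.along_closed[OF m']
            \<xi>.natural_000[OF m] \<theta>.natural_000[OF m']])
  qed
qed

lemma pseudonatural3_diff:
  assumes F: "fun3_closed C F" and "pseudonatural3 C F F \<theta>" "pseudonatural3 C F F \<xi>"
  shows "pseudonatural3 C F F (tr_diff \<theta> \<xi>)"
proof -
  interpret \<theta>: pseudonatural3 C F F \<theta> by fact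
  interpret \<xi>: pseudonatural3 C F F \<xi> by fact
  show ?thesis
  proof (unfold_locales, unfold tr_diff_def transf.simps, goal_cases)
    case 1 show ?case
      by (rule Hom_diff(1)[OF \<theta>.at_closed \<xi>.at_closed])
  next
    case 2 show ?case
      by (rule Hom_diff(2)[OF \<theta>.along_closed[OF 2] \<xi>.along_closed[OF 2]])
  next
    case (3 U U' V V' W W') show ?case
      using \<theta>.along_trilinear[of U U' V V' W W'] \<xi>.along_trilinear[of U U' V V' W W']
      unfolding trilinear_on_def
      by (auto intro!: linear_on_diff)
  next
    case 4 show ?case
      using comp_diff(4)[OF fun3_closedD(1)[OF F 4] \<theta>.at_closed \<xi>.at_closed]
        comp_diff(1)[OF \<theta>.at_closed \<xi>.at_closed fun3_closedD(1)[OF F 4]]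
        bdry_diff[OF \<theta>.along_closed[OF 4] \<xi>.along_closed[OF 4]]
      by (simp add: \<theta>.natural_000[OF 4, symmetric] \<xi>.natural_000[OF 4, symmetric])
  next
    case 5 show ?case
      using comp_diff(6)[OF fun3_closedD(2)[OF F 5] \<theta>.at_closed \<xi>.at_closed]
        comp_diff(2)[OF \<theta>.at_closed \<xi>.at_closed fun3_closedD(2)[OF F 5]]
      by (simp add: \<theta>.natural_100[OF 5, symmetric] \<xi>.natural_100[OF 5, symmetric])
  next
    case 6 show ?case
      using comp_diff(6)[OF fun3_closedD(3)[OF F 6] \<theta>.at_closed \<xi>.at_closed]
        comp_diff(2)[OF \<theta>.at_closed \<xi>.at_closed fun3_closedD(3)[OF F 6]]
      by (simp add: \<theta>.natural_010[OF 6, symmetric] \<xi>.natural_010[OF 6, symmetric])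
  next
    case 7 show ?case
      using comp_diff(6)[OF fun3_closedD(4)[OF F 7] \<theta>.at_closed \<xi>.at_closed]
        comp_diff(2)[OF \<theta>.at_closed \<xi>.at_closed fun3_closedD(4)[OF F 7]]
      by (simp add: \<theta>.natural_001[OF 7, symmetric] \<xi>.natural_001[OF 7, symmetric])
  next
    case 8 show ?case
      by (simp add: \<theta>.along_ident \<xi>.along_ident)
  next
    case 9
    note m = 9(1,3,5) and m' = 9(2,4,6)
    show ?case
      using comp_diff(3)[OF \<theta>.along_closed[OF m'] \<xi>.along_closed[OF m'] fun3_closedD(1)[OF F m]]
        comp_diff(5)[OF fun3_closedD(1)[OF F m'] \<theta>.along_closed[OF m] \<xi>.along_closed[OF m]]
      by (simp add: \<theta>.along_comp[OF 9] \<xi>.along_comp[OF 9])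
  qed
qed

lemma pseudonatural3_smul:
  assumes F: "fun3_closed C F" and "pseudonatural3 C F F \<xi>"
  shows "pseudonatural3 C F F (tr_smul C r \<xi>)"
proof -
  interpret \<xi>: pseudonatural3 C F F \<xi> by fact
  note diff = module.scale_right_diff_distrib[OF module0] module.scale_right_diff_distrib[OF module1]
  show ?thesis
  proof (unfold_locales, unfold tr_smul_def transf.simps, goal_cases)
    case 1 show ?case
      by (rule Hom_smul(1)[OF \<xi>.at_closed])
  next
    case 2 show ?case
      by (rule Hom_smul(2)[OF \<xi>.along_closed[OF 2]])
  next
    case (3 U U' V V' W W') show ?case
      using \<xi>.along_trilinear[of U U' V V' W W']
      unfolding trilinear_on_def
      by (auto intro!: linear_on_smul)
  next
    case 4 show ?case
      using comp_smul(4)[OF fun3_closedD(1)[OF F 4] \<xi>.at_closed]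
        comp_smul(1)[OF \<xi>.at_closed fun3_closedD(1)[OF F 4]]
        bdry_smul[OF \<xi>.along_closed[OF 4]]
      by (simp add: \<xi>.natural_000[OF 4, symmetric] diff)
  next
    case 5 show ?case
      using comp_smul(6)[OF fun3_closedD(2)[OF F 5] \<xi>.at_closed]
        comp_smul(2)[OF \<xi>.at_closed fun3_closedD(2)[OF F 5]]
      by (simp add: \<xi>.natural_100[OF 5, symmetric] diff)
  next
    case 6 show ?case
      using comp_smul(6)[OF fun3_closedD(3)[OF F 6] \<xi>.at_closed]
        comp_smul(2)[OF \<xi>.at_closed fun3_closedD(3)[OF F 6]]
      by (simp add: \<xi>.natural_010[OF 6, symmetric] diff)
  next
    case 7 show ?case
      using comp_smul(6)[OF fun3_closedD(4)[OF F 7] \<xi>.at_closed]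
        comp_smul(2)[OF \<xi>.at_closed fun3_closedD(4)[OF F 7]]
      by (simp add: \<xi>.natural_001[OF 7, symmetric] diff)
  next
    case 8 show ?case
      by (simp add: \<xi>.along_ident module.scale_zero_right[OF module1])
  next
    case 9
    note m = 9(1,3,5) and m' = 9(2,4,6)
    show ?case
      using comp_smul(3)[OF \<xi>.along_closed[OF m'] fun3_closedD(1)[OF F m]]
        comp_smul(5)[OF fun3_closedD(1)[OF F m'] \<xi>.along_closed[OF m]]
      by (simp add: \<xi>.along_comp[OF 9] module.scale_right_distrib[OF module1])
  qed
qed

lemma pseudonatural3_commutator:
  assumes "fun3_closed C F" "pseudonatural3 C F F \<theta>" "pseudonatural3 C F F \<xi>"
  shows "pseudonatural3 C F F (tr_commutator C \<theta> \<xi>)"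
  unfolding tr_commutator_def using assms by (intro pseudonatural3_diff pseudonatural3_vcomp)

end

context ch_tensor
begin

lemma tensor_left_closed: "fun3_closed C (tensor_left C)"
  by (auto simp: fun3_closed_def tensor_left_def intro!: tens_closed)

lemma tens_diff:
  "\<lbrakk>f \<in> Hom0 C U U'; f' \<in> Hom0 C U U'; \<psi> \<in> Hom1 C V V'\<rbrakk> \<Longrightarrow> (f - f') \<rtimes> \<psi> = f \<rtimes> \<psi> - f' \<rtimes> \<psi>"
  "\<lbrakk>\<phi> \<in> Hom1 C U U'; \<phi>' \<in> Hom1 C U U'; g \<in> Hom0 C V V'\<rbrakk> \<Longrightarrow> (\<phi> - \<phi>') \<ltimes> g = \<phi> \<ltimes> g - \<phi>' \<ltimes> g"
  "\<lbrakk>f \<in> Hom0 C U U'; \<psi> \<in> Hom1 C V V'; \<psi>' \<in> Hom1 C V V'\<rbrakk> \<Longrightarrow> f \<rtimes> (\<psi> - \<psi>') = f \<rtimes> \<psi> - f \<rtimes> \<psi>'"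
  "\<lbrakk>\<phi> \<in> Hom1 C U U'; g \<in> Hom0 C V V'; g' \<in> Hom0 C V V'\<rbrakk> \<Longrightarrow> \<phi> \<ltimes> (g - g') = \<phi> \<ltimes> g - \<phi> \<ltimes> g'"
  using tens_add(3)[of "f - f'" U U' f' \<psi> V V'] tens_add(2)[of "\<phi> - \<phi>'" U U' \<phi>' g V V']
    tens_add(6)[of f U U' "\<psi> - \<psi>'" V V' \<psi>'] tens_add(5)[of \<phi> U U' "g - g'" V V' g']
  by (simp_all add: Hom_diff)

lemma tens_smul:
  "\<lbrakk>f \<in> Hom0 C U U'; g \<in> Hom0 C V V'\<rbrakk> \<Longrightarrow> smul0 C r f \<otimes> g = smul0 C r (f \<otimes> g)"
  "\<lbrakk>f \<in> Hom0 C U U'; g \<in> Hom0 C V V'\<rbrakk> \<Longrightarrow> f \<otimes> smul0 C r g = smul0 C r (f \<otimes> g)"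
  "\<lbrakk>\<phi> \<in> Hom1 C U U'; g \<in> Hom0 C V V'\<rbrakk> \<Longrightarrow> smul1 C r \<phi> \<ltimes> g = smul1 C r (\<phi> \<ltimes> g)"
  "\<lbrakk>f \<in> Hom0 C U U'; \<psi> \<in> Hom1 C V V'\<rbrakk> \<Longrightarrow> f \<rtimes> smul1 C r \<psi> = smul1 C r (f \<rtimes> \<psi>)"
  using tens00_bilinear[of U U' V V'] tens10_bilinear[of U U' V V'] tens01_bilinear[of U U' V V']
  by (simp_all add: bilinear_on_def linear_on_def)

lemma linear_on_tens:
  assumes "linear_on s (smul1 C) M \<phi>" "\<And>x. x \<in> M \<Longrightarrow> \<phi> x \<in> Hom1 C U U'" "g \<in> Hom0 C V V'"
  shows "linear_on s (smul1 C) M (\<lambda>x. \<phi> x \<ltimes> g)" "linear_on s (smul1 C) M (\<lambda>x. g \<rtimes> \<phi> x)"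
  using assms tens_add(2)[of _ U U' _ g V V'] tens_add(6)[of g V V' _ U U']
    tens_smul(3)[of _ U U' g V V'] tens_smul(4)[of g V V' _ U U']
  by (simp_all add: linear_on_def)

text \<open>
  This and the next lemma give naturality of \<open>t12\<close> and \<open>t23\<close> with respect to 2-cells. Here the 2-cell
  lies in an argument of \<open>t\<close>.
\<close>

lemma natural_whisker:
  assumes \<Phi>: "\<Phi> \<in> Hom1 C X X'" and T: "T \<in> Hom0 C X X" "T' \<in> Hom0 C X' X'"
    and k: "k \<in> Hom0 C W W'"
  shows "((\<Phi> \<ltimes> k) \<lhd> (T \<otimes> \<one> W)) - ((T' \<otimes> \<one> W') \<rhd> (\<Phi> \<ltimes> k)) = ((\<Phi> \<lhd> T) - (T' \<rhd> \<Phi>)) \<ltimes> k"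
    and "((k \<rtimes> \<Phi>) \<lhd> (\<one> W \<otimes> T)) - ((\<one> W' \<otimes> T') \<rhd> (k \<rtimes> \<Phi>)) = k \<rtimes> ((\<Phi> \<lhd> T) - (T' \<rhd> \<Phi>))"
  using interchange_10_00[OF T(1) \<Phi> ident_closed k] interchange_00_10[OF \<Phi> T(2) k ident_closed]
    interchange_01_00[OF ident_closed k T(1) \<Phi>] interchange_00_01[OF k ident_closed \<Phi> T(2)]
    tens_diff(2)[OF comp10_closed[OF \<Phi> T(1)] comp01_closed[OF T(2) \<Phi>] k]
    tens_diff(3)[OF k comp10_closed[OF \<Phi> T(1)] comp01_closed[OF T(2) \<Phi>]]
  by (simp_all add: ident_left0[OF k] ident_right0[OF k])

text \<open>
  The case that the 2-cell lies in the argument that \<open>t\<close> does not act on: its naturality square is the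
  exchange of two homotopies.
\<close>

lemma natural_exchange:
  assumes F: "F \<in> Hom0 C X X'" and T: "T \<in> Hom0 C X X" "T' \<in> Hom0 C X' X'"
    and p: "p \<in> Hom1 C X X'" "(F \<cdot> T) - (T' \<cdot> F) = \<partial> p" and \<phi>: "\<phi> \<in> Hom1 C W W'"
  shows "((F \<rtimes> \<phi>) \<lhd> (T \<otimes> \<one> W)) - ((T' \<otimes> \<one> W') \<rhd> (F \<rtimes> \<phi>)) = p \<ltimes> \<partial> \<phi>"
    and "((\<phi> \<ltimes> F) \<lhd> (\<one> W \<otimes> T)) - ((\<one> W' \<otimes> T') \<rhd> (\<phi> \<ltimes> F)) = \<partial> \<phi> \<rtimes> p"
proof -
  show "((F \<rtimes> \<phi>) \<lhd> (T \<otimes> \<one> W)) - ((T' \<otimes> \<one> W') \<rhd> (F \<rtimes> \<phi>)) = p \<ltimes> \<partial> \<phi>"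
    using interchange_01_00[OF T(1) F ident_closed \<phi>] interchange_00_01[OF F T(2) \<phi> ident_closed]
      tens_diff(1)[OF comp00_closed[OF F T(1)] comp00_closed[OF T(2) F] \<phi>]
      tens_truncation[OF p(1) \<phi>]
    by (simp add: ident_right1[OF \<phi>] ident_left1[OF \<phi>] p(2))
  show "((\<phi> \<ltimes> F) \<lhd> (\<one> W \<otimes> T)) - ((\<one> W' \<otimes> T') \<rhd> (\<phi> \<ltimes> F)) = \<partial> \<phi> \<rtimes> p"
    using interchange_10_00[OF ident_closed \<phi> T(1) F] interchange_00_10[OF \<phi> ident_closed F T(2)]
      tens_diff(4)[OF \<phi> comp00_closed[OF F T(1)] comp00_closed[OF T(2) F]]
      tens_truncation[OF \<phi> p(1)]
    by (simp add: ident_right1[OF \<phi>] ident_left1[OF \<phi>] p(2))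
qed

lemma square_of_pseudonatural2:
  assumes "pseudonatural2 C (tensor C) (tensor C) t" "f \<in> Hom0 C U U'" "g \<in> Hom0 C V V'"
  shows "Square (at_ob t (U,V)) (at_ob t (U',V')) (along t (U,V) (U',V') (f,g))
    \<in> Sq (Arrow U U' f \<boxtimes> Arrow V V' g) (Arrow U U' f \<boxtimes> Arrow V V' g)"
proof -
  interpret pseudonatural2 C "tensor C" "tensor C" t by fact
  show ?thesis
    using at_closed along_closed[OF assms(2,3)] natural_00[OF assms(2,3)]
    by (simp add: Sq_def tens_arrow_def tensor_def)
qed

lemma pseudonatural3_t12:
  assumes "pseudonatural2 C (tensor C) (tensor C) t"
  shows "pseudonatural3 C (tensor_left C) (tensor_left C) (t12 C t)"
proof -
  interpret t: pseudonatural2 C "tensor C" "tensor C" t by fact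
  note tensor_simps = tensor_def fun2.simps
  note t_closed = t.at_closed[unfolded tensor_simps] t.along_closed[unfolded tensor_simps]
  show ?thesis
  proof (unfold_locales, unfold t12_def tensor_left_def transf.simps fun3.simps prod.case,
      goal_cases)
    case 1 show ?case
      by (intro tens_closed t_closed ident_closed)
  next
    case 2 then show ?case
      by (intro tens_closed t_closed)
  next
    case (3 U U' V V' W W') show ?case
      using t.along_bilinear[of U U' V V']
        tens10_bilinear[of "U \<odot> V" "U' \<odot> V'" W W', unfolded bilinear_on_def]
      by (auto simp: trilinear_on_def bilinear_on_def intro!: linear_on_tens t_closed(2))
  next
    case (4 f U U' g V V' k W W')
    let ?u = "Arrow U U' f" and ?v = "Arrow V V' g" and ?w = "Arrow W W' k"
    have arr: "?u \<in> Arr" "?v \<in> Arr" "?w \<in> Arr"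
      using 4 by (simp_all add: Arr_def)
    show ?case
      using SqD(4)[OF whisker_right_closed[OF arr(3) _ _ square_of_pseudonatural2[OF assms 4(1,2)]]]
        arr
      by (simp add: whisker_right_def tens_arrow_closed) (simp add: tens_arrow_def)
  next
    case 5 show ?case
      using natural_whisker(1)[OF tens10_closed[OF 5(1,2)] t_closed(1) t_closed(1) 5(3)]
        t.natural_10[OF 5(1,2)]
      by (simp add: tensor_simps)
  next
    case 6 show ?case
      using natural_whisker(1)[OF tens01_closed[OF 6(1,2)] t_closed(1) t_closed(1) 6(3)]
        t.natural_01[OF 6(1,2)]
      by (simp add: tensor_simps)
  next
    case 7 show ?case
      by (rule natural_exchange(1)[OF tens00_closed[OF 7(1,2)] t_closed(1) t_closed(1)
            t_closed(2)[OF 7(1,2)] t.natural_00[OF 7(1,2), unfolded tensor_simps] 7(3)])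
  next
    case 8 show ?case
      by (simp add: t.along_ident tens_zero(2)[OF ident_closed])
  next
    case 9
    note m = 9(1,3) and m' = 9(2,4)
    show ?case
      unfolding t.along_comp[OF 9(1-4)] tensor_simps
      using tens_add(2)[OF comp10_closed[OF t_closed(2)[OF m'] tens00_closed[OF m]]
          comp01_closed[OF tens00_closed[OF m'] t_closed(2)[OF m]] comp00_closed[OF 9(6,5)]]
        interchange_10_00[OF tens00_closed[OF m] t_closed(2)[OF m'] 9(5,6)]
        interchange_00_10[OF t_closed(2)[OF m] tens00_closed[OF m'] 9(5,6)]
      by simp
  qed
qed

lemma pseudonatural3_t23:
  assumes "pseudonatural2 C (tensor C) (tensor C) t"
  shows "pseudonatural3 C (tensor_right C) (tensor_right C) (t23 C t)"
proof -
  interpret t: pseudonatural2 C "tensor C" "tensor C" t by fact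
  note tensor_simps = tensor_def fun2.simps
  note t_closed = t.at_closed[unfolded tensor_simps] t.along_closed[unfolded tensor_simps]
  show ?thesis
  proof (unfold_locales, unfold t23_def tensor_right_def transf.simps fun3.simps prod.case,
      goal_cases)
    case 1 show ?case
      by (intro tens_closed t_closed ident_closed)
  next
    case 2 then show ?case
      by (intro tens_closed t_closed)
  next
    case (3 U U' V V' W W') show ?case
      using t.along_bilinear[of V V' W W']
        tens01_bilinear[of U U' "V \<odot> W" "V' \<odot> W'", unfolded bilinear_on_def]
      by (auto simp: trilinear_on_def bilinear_on_def intro!: linear_on_tens t_closed(2))
  next
    case (4 f U U' g V V' k W W')
    let ?u = "Arrow U U' f" and ?v = "Arrow V V' g" and ?w = "Arrow W W' k"
    have arr: "?u \<in> Arr" "?v \<in> Arr" "?w \<in> Arr"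
      using 4 by (simp_all add: Arr_def)
    show ?case
      using SqD(4)[OF whisker_left_closed[OF arr(1) _ _ square_of_pseudonatural2[OF assms 4(2,3)]]]
        arr
      by (simp add: whisker_left_def tens_arrow_closed) (simp add: tens_arrow_def)
  next
    case 5 show ?case
      by (rule natural_exchange(2)[OF tens00_closed[OF 5(2,3)] t_closed(1) t_closed(1)
            t_closed(2)[OF 5(2,3)] t.natural_00[OF 5(2,3), unfolded tensor_simps] 5(1)])
  next
    case 6 show ?case
      using natural_whisker(2)[OF tens10_closed[OF 6(2,3)] t_closed(1) t_closed(1) 6(1)]
        t.natural_10[OF 6(2,3)]
      by (simp add: tensor_simps)
  next
    case 7 show ?case
      using natural_whisker(2)[OF tens01_closed[OF 7(2,3)] t_closed(1) t_closed(1) 7(1)]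
        t.natural_01[OF 7(2,3)]
      by (simp add: tensor_simps)
  next
    case 8 show ?case
      by (simp add: t.along_ident tens_zero(6)[OF ident_closed])
  next
    case 9
    note m = 9(3,5) and m' = 9(4,6)
    show ?case
      unfolding t.along_comp[OF 9(3-6)] tensor_simps
      using tens_add(6)[OF comp00_closed[OF 9(2,1)] comp10_closed[OF t_closed(2)[OF m'] tens00_closed[OF m]]
          comp01_closed[OF tens00_closed[OF m'] t_closed(2)[OF m]]]
        interchange_01_00[OF 9(1,2) tens00_closed[OF m] t_closed(2)[OF m']]
        interchange_00_01[OF 9(1,2) t_closed(2)[OF m] tens00_closed[OF m']]
      by simp
  qed
qed

end

section \<open>The commutator as a pseudonatural transformation\<close>

lemma (in strict_tensor) tensor_left_agrees_right:
  "fun3_agree C (tensor_left C) (tensor_right C)" "fun3_agree C (tensor_right C) (tensor_left C)"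
  using assoc_ob tens_assoc000 tens_assoc100 tens_assoc010 tens_assoc001
  by (auto simp: fun3_agree_def tensor_left_def tensor_right_def)

lemma fun3_agree_refl: "fun3_agree C F F"
  by (simp add: fun3_agree_def)

context infinitesimally_braided
begin

lemma pseudonatural3_commutator_t12_t23:
  "pseudonatural3 C (tensor_left C) (tensor_left C) (tr_commutator C (t12 C t) (t23 C t))"
  by (rule pseudonatural3_commutator[OF tensor_left_closed pseudonatural3_t12[OF pseudonatural]
        pseudonatural3_cong[OF tensor_left_agrees_right(2) tensor_left_agrees_right(2)
          pseudonatural3_t23[OF pseudonatural]]])

text \<open>
  The squares of the transformation \<open>[t12, t23]\<close> are the commutators to which the pentagon applies.
\<close>

lemma commutator_square_eq:
  "commutator_square u v w =
     Square (at_ob (tr_commutator C (t12 C t) (t23 C t)) (src u, src v, src w))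
       (at_ob (tr_commutator C (t12 C t) (t23 C t)) (tgt u, tgt v, tgt w))
       (along (tr_commutator C (t12 C t) (t23 C t)) (src u, src v, src w) (tgt u, tgt v, tgt w)
         (cell u, cell v, cell w))"
  by (simp add: commutator_square_def sq_commutator_def sq_comp_def whisker_left_def
      whisker_right_def t_square_def minus_square_def tr_commutator_def tr_diff_def tr_vcomp_def
      t12_def t23_def)

text \<open>
  The hexagon for \<open>V = W = I\<close> makes \<open>\<gamma>_UI\<close> idempotent, and it is invertible.
\<close>

lemma symmetry_unit: "\<gamma> (U, \<I>) = \<one> U" "\<gamma> (\<I>, U) = \<one> U"
proof -
  interpret \<gamma>: pseudonatural2 C "tensor C" "tensor_flip C" "\<lparr>at_ob = \<gamma>, along = (\<lambda>s s' p. 0)\<rparr>"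
    by (rule symmetry_natural)
  have *: "\<gamma> (U, \<I>) \<in> Hom0 C U U" "\<gamma> (\<I>, U) \<in> Hom0 C U U" for U
    using \<gamma>.at_closed[of U \<I>] \<gamma>.at_closed[of \<I> U]
    by (simp_all add: tensor_def tensor_flip_def unit_ob_left unit_ob_right)
  have idem: "\<gamma> (U, \<I>) = \<gamma> (U, \<I>) \<cdot> \<gamma> (U, \<I>)"
    using symmetry_hexagon[of U \<I> \<I>]
    by (simp add: unit_ob_left unit_left0[OF *(1)] unit_right0[OF *(1)])
  have inv: "\<gamma> (\<I>, U) \<cdot> \<gamma> (U, \<I>) = \<one> U"
    using symmetry_involutive[of \<I> U] by (simp add: unit_ob_right)
  have "\<one> U = \<gamma> (\<I>, U) \<cdot> \<gamma> (U, \<I>) \<cdot> \<gamma> (U, \<I>)"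
    using inv idem by simp
  also have "\<dots> = \<gamma> (U, \<I>)"
    unfolding assoc000[OF *(2,1,1), symmetric] inv by (rule ident_left0[OF *(1)])
  finally show "\<gamma> (U, \<I>) = \<one> U" ..
  with inv show "\<gamma> (\<I>, U) = \<one> U"
    using ident_right0[OF *(2)] by simp
qed

text \<open>
  Since \<open>I \<otimes> I = I\<close>, strictness in the second argument doubles \<open>t\<close> at \<open>(U, I)\<close>.
\<close>

lemma t_unit:
  shows "at_ob t (U, \<I>) = 0"
    and "f \<in> Hom0 C U U' \<Longrightarrow> along t (U, \<I>) (U', \<I>) (f, \<one> \<I>) = 0"
proof -
  have at: "at_ob t (U, \<I>) \<in> Hom0 C U U" for U
    using t.at_closed[of U \<I>] by (simp add: tensor_def unit_ob_right)
  have "at_ob t (U, \<I>) = at_ob t (U, \<I>) + at_ob t (U, \<I>)"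
    using strict_right_at[of U \<I> \<I>]
    by (simp add: unit_ob_left unit_ob_right symmetry_unit unit_left0[OF at] unit_right0[OF at]
        unit_right0[OF ident_closed] ident_left0[OF at] ident_right0[OF at])
  then show "at_ob t (U, \<I>) = 0"
    by simp
  assume f: "f \<in> Hom0 C U U'"
  have al: "along t (U, \<I>) (U', \<I>) (f, \<one> \<I>) \<in> Hom1 C U U'"
    using t.along_closed[OF f ident_closed[of \<I>]] by (simp add: tensor_def unit_ob_right)
  have "along t (U, \<I>) (U', \<I>) (f, \<one> \<I>)
      = along t (U, \<I>) (U', \<I>) (f, \<one> \<I>) + along t (U, \<I>) (U', \<I>) (f, \<one> \<I>)"
    using strict_right_along[OF f ident_closed[of \<I>] ident_closed[of \<I>]]
    by (simp add: unit_ob_left unit_ob_right symmetry_unit unit_left1[OF al] unit_right1[OF al]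
        unit_right0[OF ident_closed] ident_left1[OF al] ident_right1[OF al])
  then show "along t (U, \<I>) (U', \<I>) (f, \<one> \<I>) = 0"
    by simp
qed

lemma commutator_square_unit:
  assumes u: "u \<in> Arr" and v: "v \<in> Arr"
  shows "commutator_square u (Arrow \<I> \<I> (\<one> \<I>)) v = 0"
proof -
  let ?i = "Arrow \<I> \<I> (\<one> \<I>)"
  have i: "?i \<in> Arr"
    by (simp add: Arr_def ident_closed)
  note arr = u v i tens_arrow_closed
  have "t_square u ?i = 0"
    using t_unit(1) t_unit(2)[OF ArrD[OF u]] by (simp add: t_square_def zero_square_def)
  moreover have "0 \<triangleleft> v = 0"
    using tens_zero(1)[OF ident_closed] tens_zero(2)[OF ArrD[OF v]]
    by (simp add: whisker_right_def zero_square_def)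
  moreover have "u \<triangleright> t_square ?i v \<in> Sq (u \<boxtimes> ?i \<boxtimes> v) (u \<boxtimes> ?i \<boxtimes> v)"
    by (intro whisker_left_closed t_square_closed arr)
  moreover have z: "u \<boxtimes> ?i \<boxtimes> v \<in> Arr"
    by (intro arr)
  ultimately show ?thesis
    using bihom_zero_left[OF bihom_sq_comp[OF z z z]] bihom_zero_right[OF bihom_sq_comp[OF z z z]]
    by (simp add: commutator_square_def sq_commutator_def)
qed

end

section \<open>Perturbing the identity associator\<close>

text \<open>
  The elements \<open>e + a h^2\<close> and \<open>a h^2\<close> of an extended module. The associator and its composites have
  components of the first kind, with \<open>e\<close> an identity, and 2-cells of the second kind.
\<close>

definition plus_h2 :: "'a::zero \<Rightarrow> 'a \<Rightarrow> 'a trunc" where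
  "plus_h2 e a = Trunc e 0 a"

definition times_h2 :: "'a::zero \<Rightarrow> 'a trunc" where
  "times_h2 a = Trunc 0 0 a"

lemma times_h2_simps [simp]:
  "cf0 (times_h2 a) = 0" "cf1 (times_h2 a) = 0" "cf2 (times_h2 a) = a"
  "cf0 (plus_h2 e a) = e" "cf1 (plus_h2 e a) = 0" "cf2 (plus_h2 e a) = a"
  "cf0 (trunc_const e) = e" "cf1 (trunc_const e) = 0" "cf2 (trunc_const e) = 0"
  by (simp_all add: times_h2_def plus_h2_def trunc_const_def)

lemma times_h2_arith:
  "times_h2 (a + b) = times_h2 a + times_h2 b" "times_h2 (a - b) = times_h2 a - times_h2 b"
  "times_h2 0 = 0"
  by (simp_all add: times_h2_def plus_trunc_def minus_trunc_def zero_trunc_def)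

lemma
  assumes m: "bihom M N P m"
  shows trunc_mult_times_h2_right:
      "\<lbrakk>x \<in> trunc_submodule M; b \<in> N\<rbrakk> \<Longrightarrow> trunc_mult m x (times_h2 b) = times_h2 (m (cf0 x) b)"
    and trunc_mult_times_h2_left:
      "\<lbrakk>a \<in> M; y \<in> trunc_submodule N\<rbrakk> \<Longrightarrow> trunc_mult m (times_h2 a) y = times_h2 (m a (cf0 y))"
  by (simp_all add: trunc_mult_def trunc_submodule_def times_h2_def bihom_zero_right[OF m]
      bihom_zero_left[OF m])

lemma trunc_mult_plus_h2_right:
  assumes m: "bihom M N P m"
    and "x \<in> trunc_submodule M" "e \<in> N" "b \<in> N" "\<And>z. z \<in> M \<Longrightarrow> m z e = f z"
  shows "trunc_mult m x (plus_h2 e b) = map_trunc f x + times_h2 (m (cf0 x) b)"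
  using assms(2-)
  by (auto simp: trunc_mult_def trunc_submodule_def times_h2_def plus_h2_def plus_trunc_def
      trunc.map_sel bihom_zero_right[OF m] add.commute)

lemma trunc_mult_plus_h2_left:
  assumes m: "bihom M N P m"
    and "y \<in> trunc_submodule N" "e \<in> M" "a \<in> M" "\<And>z. z \<in> N \<Longrightarrow> m e z = g z"
  shows "trunc_mult m (plus_h2 e a) y = map_trunc g y + times_h2 (m a (cf0 y))"
  using assms(2-)
  by (auto simp: trunc_mult_def trunc_submodule_def times_h2_def plus_h2_def plus_trunc_def
      trunc.map_sel bihom_zero_left[OF m] add.commute)

text \<open>
  The transformation \<open>1 + h^2 c\<close>. By \<open>h^3 = 0\<close> its 2-cells see only the constant terms of 1-cells.
\<close>

definition perturbation :: "('r, 'o, 'a::ab_group_add, 'b::ab_group_add) mon_cat \<Rightarrow>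
    ('o, 'a, 'b) transf3 \<Rightarrow> ('o, 'a trunc, 'b trunc) transf3"
  where
  "perturbation C c =
     \<lparr>at_ob = (\<lambda>(U,V,W). plus_h2 (ident C (fun3_ob (tensor_left C) U V W)) (at_ob c (U,V,W))),
      along = (\<lambda>s s' (f,g,k). times_h2 (along c s s' (cf0 f, cf0 g, cf0 k)))\<rparr>"

locale perturbed_associator = strict_tensor C
  for C :: "('r::comm_ring_1, 'o, 'a::ab_group_add, 'b::ab_group_add) mon_cat" (structure) +
  fixes c :: "('o, 'a, 'b) transf3"
  assumes pseudonatural: "pseudonatural3 C (tensor_left C) (tensor_left C) c"
begin

sublocale c: pseudonatural3 C "tensor_left C" "tensor_left C" c
  by (rule pseudonatural)

sublocale D: strict_tensor "scalar_ext C"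
  by (rule strict_tensor_scalar_ext) unfold_locales

lemma plus_h2_closed: "a \<in> Hom0 C X X \<Longrightarrow> plus_h2 (\<one> X) a \<in> trunc_submodule (Hom0 C X X)"
  by (simp add: plus_h2_def ident_closed Hom_zero)

lemma times_h2_closed:
  "\<phi> \<in> Hom1 C X Y \<Longrightarrow> times_h2 \<phi> \<in> trunc_submodule (Hom1 C X Y)"
  by (simp add: times_h2_def Hom_zero)

lemma trunc_const_closed: "a \<in> Hom0 C X Y \<Longrightarrow> trunc_const a \<in> trunc_submodule (Hom0 C X Y)"
  by (simp add: trunc_const_def Hom_zero)

lemma comp_plus_h2:
  "\<lbrakk>x \<in> trunc_submodule (Hom0 C X Y); a \<in> Hom0 C X X\<rbrakk>
    \<Longrightarrow> trunc_mult (comp00 C) x (plus_h2 (\<one> X) a) = x + times_h2 (cf0 x \<cdot> a)"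
  "\<lbrakk>x \<in> trunc_submodule (Hom0 C X Y); b \<in> Hom0 C Y Y\<rbrakk>
    \<Longrightarrow> trunc_mult (comp00 C) (plus_h2 (\<one> Y) b) x = x + times_h2 (b \<cdot> cf0 x)"
  "\<lbrakk>y \<in> trunc_submodule (Hom1 C X Y); a \<in> Hom0 C X X\<rbrakk>
    \<Longrightarrow> trunc_mult (comp10 C) y (plus_h2 (\<one> X) a) = y + times_h2 (cf0 y \<lhd> a)"
  "\<lbrakk>y \<in> trunc_submodule (Hom1 C X Y); b \<in> Hom0 C Y Y\<rbrakk>
    \<Longrightarrow> trunc_mult (comp01 C) (plus_h2 (\<one> Y) b) y = y + times_h2 (b \<rhd> cf0 y)"
  using trunc_mult_plus_h2_right[OF bihom_comp(1) _ ident_closed, where f = "\<lambda>z. z"]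
    trunc_mult_plus_h2_left[OF bihom_comp(1) _ ident_closed, where g = "\<lambda>z. z"]
    trunc_mult_plus_h2_right[OF bihom_comp(3) _ ident_closed, where f = "\<lambda>z. z"]
    trunc_mult_plus_h2_left[OF bihom_comp(2) _ ident_closed, where g = "\<lambda>z. z"]
    ident_right0 ident_left0 ident_right1 ident_left1
  by (auto simp: trunc.map_ident)

text \<open>
  This turns the pentagon for \<open>1 + h^2 c\<close> into a linear equation for \<open>c\<close>.
\<close>

lemma comp_plus_h2_plus_h2:
  assumes "a \<in> Hom0 C X X" "b \<in> Hom0 C X X"
  shows "trunc_mult (comp00 C) (plus_h2 (\<one> X) a) (plus_h2 (\<one> X) b) = plus_h2 (\<one> X) (a + b)"
  using comp_plus_h2(1)[OF plus_h2_closed[OF assms(1)] assms(2)] ident_left0[OF assms(2)]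
  by (simp add: plus_h2_def times_h2_def plus_trunc_def)

lemma comp_times_h2_plus_h2:
  "\<lbrakk>\<phi> \<in> Hom1 C X Y; a \<in> Hom0 C X X\<rbrakk>
    \<Longrightarrow> trunc_mult (comp10 C) (times_h2 \<phi>) (plus_h2 (\<one> X) a) = times_h2 \<phi>"
  "\<lbrakk>\<phi> \<in> Hom1 C X Y; b \<in> Hom0 C Y Y\<rbrakk>
    \<Longrightarrow> trunc_mult (comp01 C) (plus_h2 (\<one> Y) b) (times_h2 \<phi>) = times_h2 \<phi>"
  using comp_plus_h2(3)[OF times_h2_closed, of \<phi> X Y a] comp_zero(3)[of a X X]
    comp_plus_h2(4)[OF times_h2_closed, of \<phi> X Y b] comp_zero(5)[of b Y Y]
  by (simp_all add: times_h2_arith)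

lemma tens_plus_h2:
  assumes "a \<in> Hom0 C X X"
  shows "trunc_mult (tens00 C) (trunc_const (\<one> U)) (plus_h2 (\<one> X) a)
      = plus_h2 (\<one> (U \<odot> X)) (\<one> U \<otimes> a)"
    "trunc_mult (tens00 C) (plus_h2 (\<one> X) a) (trunc_const (\<one> U))
      = plus_h2 (\<one> (X \<odot> U)) (a \<otimes> \<one> U)"
  using trunc_mult_const[OF bihom_tens(1) plus_h2_closed[OF assms] ident_closed[of U]]
    trunc_mult_const_right[OF bihom_tens(1) plus_h2_closed[OF assms] ident_closed[of U]]
    tens_zero(1,4)[OF ident_closed[of U]]
  by (simp_all add: plus_h2_def tens_ident)

lemma bdry_times_h2: "map_trunc (bdry C) (times_h2 \<phi>) = times_h2 (\<partial> \<phi>)"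
  by (simp add: times_h2_def bdry_zero)

lemma commute_plus_h2:
  "\<lbrakk>x \<in> trunc_submodule (Hom0 C X Y); a \<in> Hom0 C X X; b \<in> Hom0 C Y Y\<rbrakk>
    \<Longrightarrow> trunc_mult (comp00 C) x (plus_h2 (\<one> X) a) - trunc_mult (comp00 C) (plus_h2 (\<one> Y) b) x
      = times_h2 ((cf0 x \<cdot> a) - (b \<cdot> cf0 x))"
  "\<lbrakk>y \<in> trunc_submodule (Hom1 C X Y); a \<in> Hom0 C X X; b \<in> Hom0 C Y Y\<rbrakk>
    \<Longrightarrow> trunc_mult (comp10 C) y (plus_h2 (\<one> X) a) - trunc_mult (comp01 C) (plus_h2 (\<one> Y) b) y
      = times_h2 ((cf0 y \<lhd> a) - (b \<rhd> cf0 y))"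
  by (simp_all add: comp_plus_h2 times_h2_arith)

lemma perturbation_at:
  "at_ob (perturbation C c) (U,V,W) = plus_h2 (\<one> (fun3_ob (tensor_left C) U V W)) (at_ob c (U,V,W))"
  by (simp add: perturbation_def)

lemma perturbation_along:
  "along (perturbation C c) s s' (f,g,k) = times_h2 (along c s s' (cf0 f, cf0 g, cf0 k))"
  by (simp add: perturbation_def)

lemma tensor_left_scalar_ext:
  "fun3_ob (tensor_left (scalar_ext C)) = fun3_ob (tensor_left C)"
  "cf0 (fun3_000 (tensor_left (scalar_ext C)) F G K) = fun3_000 (tensor_left C) (cf0 F) (cf0 G) (cf0 K)"
  "cf0 (fun3_100 (tensor_left (scalar_ext C)) \<Phi> G K) = fun3_100 (tensor_left C) (cf0 \<Phi>) (cf0 G) (cf0 K)"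
  "cf0 (fun3_010 (tensor_left (scalar_ext C)) F \<Phi> K) = fun3_010 (tensor_left C) (cf0 F) (cf0 \<Phi>) (cf0 K)"
  "cf0 (fun3_001 (tensor_left (scalar_ext C)) F G \<Phi>) = fun3_001 (tensor_left C) (cf0 F) (cf0 G) (cf0 \<Phi>)"
  by (simp_all add: tensor_left_def cf_mult)

lemma perturbation_pseudonatural:
  "pseudonatural3 (scalar_ext C) (tensor_left (scalar_ext C)) (tensor_left (scalar_ext C))
     (perturbation C c)"
proof (unfold_locales, unfold perturbation_at perturbation_along scalar_ext_simps
    tensor_left_scalar_ext, goal_cases)
  case 1 show ?case
    by (rule plus_h2_closed[OF c.at_closed])
next
  case 2 show ?case
    by (intro times_h2_closed c.along_closed trunc_submoduleD 2)
next
  case (3 U U' V V' W W') show ?case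
    using c.along_trilinear[of U U' V V' W W']
    by (auto simp: trilinear_on_def linear_on_def trunc_submodule_def times_h2_def trunc_mult_def
        plus_trunc_def module.scale_zero_right[OF module1])
next
  case (4 f U U' g V V' k W W')
  note natural = c.natural_000[OF trunc_submoduleD(1)[OF 4(1)] trunc_submoduleD(1)[OF 4(2)]
      trunc_submoduleD(1)[OF 4(3)]]
  show ?case
    using commute_plus_h2(1)[OF fun3_closedD(1)[OF D.tensor_left_closed,
          unfolded scalar_ext_simps tensor_left_scalar_ext, OF 4] c.at_closed c.at_closed]
    by (simp add: tensor_left_scalar_ext natural bdry_times_h2)
next
  case 5
  note natural = c.natural_100[OF trunc_submoduleD(1)[OF 5(1)] trunc_submoduleD(1)[OF 5(2)]
      trunc_submoduleD(1)[OF 5(3)]]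
  show ?case
    using commute_plus_h2(2)[OF fun3_closedD(2)[OF D.tensor_left_closed,
          unfolded scalar_ext_simps tensor_left_scalar_ext, OF 5] c.at_closed c.at_closed]
    by (simp add: tensor_left_scalar_ext natural trunc.map_sel)
next
  case 6
  note natural = c.natural_010[OF trunc_submoduleD(1)[OF 6(1)] trunc_submoduleD(1)[OF 6(2)]
      trunc_submoduleD(1)[OF 6(3)]]
  show ?case
    using commute_plus_h2(2)[OF fun3_closedD(3)[OF D.tensor_left_closed,
          unfolded scalar_ext_simps tensor_left_scalar_ext, OF 6] c.at_closed c.at_closed]
    by (simp add: tensor_left_scalar_ext natural trunc.map_sel)
next
  case 7
  note natural = c.natural_001[OF trunc_submoduleD(1)[OF 7(1)] trunc_submoduleD(1)[OF 7(2)]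
      trunc_submoduleD(1)[OF 7(3)]]
  show ?case
    using commute_plus_h2(2)[OF fun3_closedD(4)[OF D.tensor_left_closed,
          unfolded scalar_ext_simps tensor_left_scalar_ext, OF 7] c.at_closed c.at_closed]
    by (simp add: tensor_left_scalar_ext natural trunc.map_sel)
next
  case 8 show ?case
    by (simp add: c.along_ident times_h2_arith)
next
  case (9 f U U' f' U'' g V V' g' V'' k W W' k' W'')
  note cf = trunc_submoduleD(1)[OF 9(1)] trunc_submoduleD(1)[OF 9(2)] trunc_submoduleD(1)[OF 9(3)]
    trunc_submoduleD(1)[OF 9(4)] trunc_submoduleD(1)[OF 9(5)] trunc_submoduleD(1)[OF 9(6)]
  note F = fun3_closedD(1)[OF D.tensor_left_closed,
      unfolded scalar_ext_simps tensor_left_scalar_ext, OF 9(1,3,5)]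
    and F' = fun3_closedD(1)[OF D.tensor_left_closed,
      unfolded scalar_ext_simps tensor_left_scalar_ext, OF 9(2,4,6)]
  show ?case
    using trunc_mult_times_h2_left[OF bihom_comp(3) c.along_closed[OF cf(2,4,6)] F]
      trunc_mult_times_h2_right[OF bihom_comp(2) F' c.along_closed[OF cf(1,3,5)]]
    by (simp add: cf_mult c.along_comp[OF cf] times_h2_arith tensor_left_scalar_ext)
qed

lemma perturbation_inverse:
  assumes "perturbed_associator C c'" and "\<And>s. at_ob c' s = - at_ob c s"
    and "\<And>s s' p. along c' s s' p = - along c s s' p"
  shows "tr_eq3 (scalar_ext C) (tr_vcomp (scalar_ext C) (perturbation C c') (perturbation C c))
    (tr_ident3 (scalar_ext C) (tensor_left (scalar_ext C)))"
proof -
  interpret c': perturbed_associator C c' by fact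
  have "at_ob (tr_vcomp (scalar_ext C) (perturbation C c') (perturbation C c)) (U,V,W)
      = trunc_const (\<one> (fun3_ob (tensor_left C) U V W))" for U V W
    using comp_plus_h2_plus_h2[OF c'.c.at_closed c.at_closed, of U V W]
    by (simp add: tr_vcomp_def perturbation_at c'.perturbation_at assms(2) plus_h2_def
        trunc_const_def)
  moreover have "along (tr_vcomp (scalar_ext C) (perturbation C c') (perturbation C c))
      (U,V,W) (U',V',W') (f,g,k) = 0"
    if "f \<in> trunc_submodule (Hom0 C U U')" "g \<in> trunc_submodule (Hom0 C V V')"
      "k \<in> trunc_submodule (Hom0 C W W')" for U V W U' V' W' f g k
  proof -
    note cf = that[THEN trunc_submoduleD(1)]
    show ?thesis
      using comp_times_h2_plus_h2(1)[OF c'.c.along_closed[OF cf] c.at_closed]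
        comp_times_h2_plus_h2(2)[OF c.along_closed[OF cf] c'.c.at_closed]
      by (simp add: tr_vcomp_def perturbation_at c'.perturbation_at perturbation_along
          c'.perturbation_along assms(3) times_h2_arith[symmetric])
  qed
  ultimately show ?thesis
    by (auto simp: tr_eq3_def tr_ident3_def tr_ident_def tensor_left_scalar_ext)
qed

lemma perturbation_iso:
  "pseudonatural_iso3 (scalar_ext C) (tensor_left (scalar_ext C)) (tensor_right (scalar_ext C))
     (perturbation C c)"
proof -
  let ?c' = "tr_smul C (-1) c"
  interpret c': perturbed_associator C ?c'
    by (intro perturbed_associator.intro perturbed_associator_axioms.intro strict_tensor_axioms
        pseudonatural3_smul[OF tensor_left_closed pseudonatural])
  have at: "at_ob ?c' s = - at_ob c s" for s
    using module.scale_minus_left[OF module0, of 1 "at_ob c s"] module.scale_one[OF module0]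
    by (simp add: tr_smul_def)
  have al: "along ?c' s s' p = - along c s s' p" for s s' p
    using module.scale_minus_left[OF module1, of 1 "along c s s' p"] module.scale_one[OF module1]
    by (simp add: tr_smul_def)
  have ob: "tr_ident3 (scalar_ext C) (tensor_right (scalar_ext C))
      = tr_ident3 (scalar_ext C) (tensor_left (scalar_ext C))"
    by (simp add: tr_ident3_def tensor_left_def tensor_right_def assoc_ob)
  note left_right = fun3_agree_refl D.tensor_left_agrees_right(1)
    and right_left = D.tensor_left_agrees_right(1) fun3_agree_refl
  show ?thesis
    unfolding pseudonatural_iso3_def ob
    using pseudonatural3_cong[OF left_right perturbation_pseudonatural]
      pseudonatural3_cong[OF right_left c'.perturbation_pseudonatural]
      perturbation_inverse[OF c'.perturbed_associator_axioms at al]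
      c'.perturbation_inverse[OF perturbed_associator_axioms] at al
    by auto
qed

text \<open>
  The associahedron holds because the components of \<open>1 + h^2 c\<close> are identities up to \<open>h^2\<close>, which the
  2-cells of \<open>1 + h^2 c\<close> do not see.
\<close>

lemma pentagonal_perturbation:
  assumes pent_at: "\<And>U V W X. \<one> U \<otimes> at_ob c (V,W,X) + at_ob c (U, V \<odot> W, X)
      + at_ob c (U,V,W) \<otimes> \<one> X = at_ob c (U, V, W \<odot> X) + at_ob c (U \<odot> V, W, X)"
    and pent_along: "\<And>U V W X U' V' W' X' f g k x.
      \<lbrakk>f \<in> Hom0 C U U'; g \<in> Hom0 C V V'; k \<in> Hom0 C W W'; x \<in> Hom0 C X X'\<rbrakk> \<Longrightarrow>
        f \<rtimes> along c (V,W,X) (V',W',X') (g,k,x)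
        + along c (U, V \<odot> W, X) (U', V' \<odot> W', X') (f, g \<otimes> k, x)
        + along c (U,V,W) (U',V',W') (f,g,k) \<ltimes> x
        = along c (U, V, W \<odot> X) (U', V', W' \<odot> X') (f, g, k \<otimes> x)
        + along c (U \<odot> V, W, X) (U' \<odot> V', W', X') (f \<otimes> g, k, x)"
    and unit_at: "\<And>U V. at_ob c (U, \<I>, V) = 0"
    and unit_along: "\<And>U V U' V' f g. \<lbrakk>f \<in> Hom0 C U U'; g \<in> Hom0 C V V'\<rbrakk>
      \<Longrightarrow> along c (U, \<I>, V) (U', \<I>, V') (f, \<one> \<I>, g) = 0"
  shows "pentagonal_monoidal (scalar_ext C) (perturbation C c)"
proof -
  have at: "at_ob (perturbation C c) (U,V,W) = plus_h2 (\<one> (U \<odot> V \<odot> W)) (at_ob c (U,V,W))"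
    for U V W
    by (simp add: perturbation_at tensor_left_def assoc_ob)
  have c_at: "at_ob c (U,V,W) \<in> Hom0 C (U \<odot> V \<odot> W) (U \<odot> V \<odot> W)" for U V W
    using c.at_closed by (simp add: tensor_left_def assoc_ob)
  have c_at': "at_ob c (U, V \<odot> W, X) \<in> Hom0 C (U \<odot> V \<odot> W \<odot> X) (U \<odot> V \<odot> W \<odot> X)"
    "at_ob c (U \<odot> V, W, X) \<in> Hom0 C (U \<odot> V \<odot> W \<odot> X) (U \<odot> V \<odot> W \<odot> X)"
    "\<one> U \<otimes> at_ob c (V,W,X) \<in> Hom0 C (U \<odot> V \<odot> W \<odot> X) (U \<odot> V \<odot> W \<odot> X)"
    "at_ob c (U,V,W) \<otimes> \<one> X \<in> Hom0 C (U \<odot> V \<odot> W \<odot> X) (U \<odot> V \<odot> W \<odot> X)" for U V W X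
    using c_at[of U "V \<odot> W" X] c_at[of "U \<odot> V" W X] tens00_closed[OF ident_closed[of U] c_at]
      tens00_closed[OF c_at ident_closed[of X]]
    by (simp_all add: assoc_ob)
  have c_along: "along c (U,V,W) (U',V',W') (f,g,k) \<in> Hom1 C (U \<odot> V \<odot> W) (U' \<odot> V' \<odot> W')"
    if "f \<in> Hom0 C U U'" "g \<in> Hom0 C V V'" "k \<in> Hom0 C W W'" for U V W U' V' W' f g k
    using c.along_closed[OF that] by (simp add: tensor_left_def assoc_ob)
  have tens_at: "trunc_mult (\<otimes>) (trunc_const (\<one> U)) (at_ob (perturbation C c) (V,W,X))
        = plus_h2 (\<one> (U \<odot> V \<odot> W \<odot> X)) (\<one> U \<otimes> at_ob c (V,W,X))"
    "trunc_mult (\<otimes>) (at_ob (perturbation C c) (U,V,W)) (trunc_const (\<one> X))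
        = plus_h2 (\<one> (U \<odot> V \<odot> W \<odot> X)) (at_ob c (U,V,W) \<otimes> \<one> X)" for U V W X
    using tens_plus_h2(1)[OF c_at] tens_plus_h2(2)[OF c_at] by (simp_all add: at assoc_ob)
  show ?thesis
  proof (unfold_locales, unfold scalar_ext_simps, goal_cases)
    case 1 show ?case by (rule perturbation_iso)
  next
    case (2 U V W X)
    show ?case
      using comp_plus_h2_plus_h2[OF c_at'(1,4)] comp_plus_h2_plus_h2[OF c_at c_at'(2)]
        comp_plus_h2_plus_h2[OF c_at'(3) Hom_add(1)[OF c_at'(1,4)]] pent_at[of U V W X]
      by (simp add: tens_at) (simp add: at assoc_ob add.assoc)
  next
    case (3 f U U' g V V' k W W' x X X')
    note cf = trunc_submoduleD(1)[OF 3(1)] trunc_submoduleD(1)[OF 3(2)]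
      trunc_submoduleD(1)[OF 3(3)] trunc_submoduleD(1)[OF 3(4)]
    let ?Z = "U \<odot> V \<odot> W \<odot> X" and ?Z' = "U' \<odot> V' \<odot> W' \<odot> X'"
    have closed: "cf0 f \<rtimes> along c (V,W,X) (V',W',X') (cf0 g, cf0 k, cf0 x) \<in> Hom1 C ?Z ?Z'"
      "along c (U, V \<odot> W, X) (U', V' \<odot> W', X') (cf0 f, cf0 g \<otimes> cf0 k, cf0 x) \<in> Hom1 C ?Z ?Z'"
      "along c (U,V,W) (U',V',W') (cf0 f, cf0 g, cf0 k) \<ltimes> cf0 x \<in> Hom1 C ?Z ?Z'"
      "along c (U, V, W \<odot> X) (U', V', W' \<odot> X') (cf0 f, cf0 g, cf0 k \<otimes> cf0 x) \<in> Hom1 C ?Z ?Z'"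
      "along c (U \<odot> V, W, X) (U' \<odot> V', W', X') (cf0 f \<otimes> cf0 g, cf0 k, cf0 x) \<in> Hom1 C ?Z ?Z'"
      using tens01_closed[OF cf(1) c_along[OF cf(2,3,4)]]
        c_along[OF cf(1) tens00_closed[OF cf(2,3)] cf(4)]
        tens10_closed[OF c_along[OF cf(1,2,3)] cf(4)]
        c_along[OF cf(1,2) tens00_closed[OF cf(3,4)]]
        c_along[OF tens00_closed[OF cf(1,2)] cf(3,4)]
      by (simp_all add: assoc_ob)
    have tens_along: "trunc_mult (\<rtimes>) f (along (perturbation C c) (V,W,X) (V',W',X') (g,k,x))
        = times_h2 (cf0 f \<rtimes> along c (V,W,X) (V',W',X') (cf0 g, cf0 k, cf0 x))"
      "trunc_mult (\<ltimes>) (along (perturbation C c) (U,V,W) (U',V',W') (f,g,k)) x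
        = times_h2 (along c (U,V,W) (U',V',W') (cf0 f, cf0 g, cf0 k) \<ltimes> cf0 x)"
      unfolding perturbation_along
      by (rule trunc_mult_times_h2_right[OF bihom_tens(3) 3(1) c_along[OF cf(2,3,4)]]
          trunc_mult_times_h2_left[OF bihom_tens(2) c_along[OF cf(1,2,3)] 3(4)])+
    show ?case
      unfolding tens_at tens_along
      unfolding at perturbation_along cf_mult assoc_ob
        comp_plus_h2_plus_h2[OF c_at'(1,4)] comp_plus_h2_plus_h2[OF c_at'(3,1)]
        comp_times_h2_plus_h2(1)[OF closed(1) Hom_add(1)[OF c_at'(1,4)]]
        comp_times_h2_plus_h2(1)[OF closed(2) c_at'(4)]
        comp_times_h2_plus_h2(2)[OF closed(2) c_at'(3)]
        comp_times_h2_plus_h2(2)[OF closed(3) Hom_add(1)[OF c_at'(3,1)]]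
        comp_times_h2_plus_h2(1)[OF closed(4) c_at'(2)]
        comp_times_h2_plus_h2(2)[OF closed(5) c_at]
        times_h2_arith(1)[symmetric] pent_along[OF cf]
      by (rule refl)
  next
    case (4 U V W X Y)
    let ?\<alpha> = "at_ob (perturbation C c)"
    let ?End = "\<lambda>Z. trunc_submodule (Hom0 C Z Z)" and ?Z = "U \<odot> V \<odot> W \<odot> X \<odot> Y"
    have \<alpha>: "?\<alpha> (U,V,W) \<in> ?End (U \<odot> V \<odot> W)" for U V W
      unfolding at by (rule plus_h2_closed[OF c_at])
    have const: "trunc_const (\<one> Z) \<in> ?End Z" for Z
      by (rule trunc_const_closed[OF ident_closed])
    note comp = D.comp00_closed[unfolded scalar_ext_simps]
    have tens: "trunc_mult (\<otimes>) (trunc_const (\<one> V)) a \<in> ?End (V \<odot> Z)"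
      "trunc_mult (\<otimes>) a (trunc_const (\<one> V)) \<in> ?End (Z \<odot> V)" if "a \<in> ?End Z" for V Z a
      using D.tens00_closed[unfolded scalar_ext_simps] that const by auto
    have \<alpha>': "?\<alpha> (U, V \<odot> W, X) \<in> ?End (U \<odot> V \<odot> W \<odot> X)"
      "?\<alpha> (U \<odot> V, W, X) \<in> ?End (U \<odot> V \<odot> W \<odot> X)"
      "trunc_mult (\<otimes>) (trunc_const (\<one> U)) (?\<alpha> (V,W,X)) \<in> ?End (U \<odot> V \<odot> W \<odot> X)"
      "trunc_mult (\<otimes>) (?\<alpha> (U,V,W)) (trunc_const (\<one> X)) \<in> ?End (U \<odot> V \<odot> W \<odot> X)" for U V W X
      using \<alpha>[of U "V \<odot> W" X] \<alpha>[of "U \<odot> V" W X] tens(1)[OF \<alpha>] tens(2)[OF \<alpha>]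
      by (simp_all add: assoc_ob)
    have 1: "trunc_mult (\<cdot>) (?\<alpha> (U \<odot> V, W \<odot> X, Y))
        (trunc_mult (\<otimes>) (?\<alpha> (U \<odot> V, W, X)) (trunc_const (\<one> Y))) \<in> ?End ?Z"
      using comp[OF \<alpha>'(1)[of "U \<odot> V" W X Y, unfolded assoc_ob]
          \<alpha>'(4)[of "U \<odot> V" W X Y, unfolded assoc_ob]] .
    have 2: "trunc_mult (\<cdot>) (trunc_mult (\<otimes>) (trunc_const (\<one> U)) (?\<alpha> (V, W, X \<odot> Y)))
        (?\<alpha> (U, V \<odot> W, X \<odot> Y)) \<in> ?End ?Z"
      using comp[OF \<alpha>'(3)[of U V W "X \<odot> Y"] \<alpha>'(1)[of U V W "X \<odot> Y"]] .
    have 3: "trunc_mult (\<otimes>) (trunc_const (\<one> U)) (trunc_mult (\<cdot>)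
        (trunc_mult (\<otimes>) (trunc_const (\<one> V)) (?\<alpha> (W,X,Y))) (?\<alpha> (V, W \<odot> X, Y))) \<in> ?End ?Z"
      by (rule tens(1)[OF comp[OF \<alpha>'(3) \<alpha>'(1)]])
    have 4: "trunc_mult (\<otimes>) (trunc_mult (\<cdot>) (?\<alpha> (U, V \<odot> W, X))
        (trunc_mult (\<otimes>) (?\<alpha> (U,V,W)) (trunc_const (\<one> X)))) (trunc_const (\<one> Y)) \<in> ?End ?Z"
      using tens(2)[OF comp[OF \<alpha>'(1)[of U V W X] \<alpha>'(4)[of U V W X]], of Y]
      by (simp add: assoc_ob)
    have id: "along (perturbation C c) (U,V,W) (U,V,W) (F,G,K) = 0"
      if "cf0 F = \<one> U" "cf0 G = \<one> V" "cf0 K = \<one> W" for U V W F G K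
      using that by (simp add: perturbation_along c.along_ident times_h2_arith)
    have ids: "cf0 (?\<alpha> (U,V,W)) = \<one> (U \<odot> V \<odot> W)" for U V W
      by (simp add: at)
    note comp_zero = D.comp_zero(3,5)[unfolded scalar_ext_simps]
    show ?case
      unfolding assoc_ob
      by (simp add: id ids comp_zero(1)[OF 1] comp_zero(2)[OF 2] comp_zero(1)[OF 4]
          comp_zero(2)[OF 3])
  next
    case 5 show ?case
      by (simp add: at unit_ob_left unit_at plus_h2_def trunc_const_def)
  next
    case 6 then show ?case
      by (auto simp: perturbation_along unit_along trunc_submoduleD times_h2_arith)
  qed
qed

end

section \<open>The associator of a strict infinitesimal 2-braiding\<close>

text \<open>
  Multiplication by \<open>h^2\<close> retains only the constant term of the commutator in the extended category,
  and taking constant terms is compatible with all operations.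
\<close>

lemma associator_eq_perturbation:
  fixes C :: "('k::field_char_0, 'o, 'a::ab_group_add, 'b::ab_group_add) mon_cat"
  assumes "ch_tensor C"
  shows "associator C t
    = perturbation C (tr_smul C (1/24) (tr_commutator C (t12 C t) (t23 C t)))"
proof -
  interpret ch_tensor C by fact
  let ?c = "tr_commutator C (t12 C t) (t23 C t)"
  let ?D = "scalar_ext C" and ?t = "transf2_ext t"
  have scalar: "trunc_const (1/24) * hbar ^ 2 = Trunc 0 0 (1/24 :: 'k)"
    by (simp add: power2_eq_square hbar_def trunc_const_def times_trunc_def trunc_mult_def)
  have smul: "trunc_mult (smul0 C) (Trunc 0 0 r) a = times_h2 (smul0 C r (cf0 a))"
    "trunc_mult (smul1 C) (Trunc 0 0 r) b = times_h2 (smul1 C r (cf0 b))" for r a b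
    by (simp_all add: trunc_mult_def times_h2_def module.scale_zero_left[OF module0]
        module.scale_zero_left[OF module1])
  have "cf0 (at_ob (tr_commutator ?D (t12 ?D ?t) (t23 ?D ?t)) s) = at_ob ?c s" for s
    by (cases s) (simp add: tr_commutator_def tr_diff_def tr_vcomp_def t12_def t23_def
        transf2_ext_def cf_mult)
  moreover have "cf0 (along (tr_commutator ?D (t12 ?D ?t) (t23 ?D ?t)) s s' (f,g,k))
      = along ?c s s' (cf0 f, cf0 g, cf0 k)" for s s' f g k
    by (cases s; cases s') (simp add: tr_commutator_def tr_diff_def tr_vcomp_def t12_def t23_def
        transf2_ext_def cf_mult)
  ultimately show ?thesis
    unfolding associator_def Let_def scalar
    by (auto simp: perturbation_def tr_add_def tr_smul_def tr_ident3_def tr_ident_def smul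
        tensor_left_def fun_eq_iff plus_h2_def times_h2_def trunc_const_def plus_trunc_def
        zero_trunc_def)
qed

text \<open>
  The pentagon for squares at identity arrows gives the equation of 1-cells; at arbitrary arrows its
  homotopies give the equation of 2-cells.
\<close>

lemma (in infinitesimally_braided) pentagon_components:
  defines "c \<equiv> tr_commutator C (t12 C t) (t23 C t)"
  shows "\<one> U \<otimes> at_ob c (V,W,X) + at_ob c (U, V \<odot> W, X) + at_ob c (U,V,W) \<otimes> \<one> X
      = at_ob c (U, V, W \<odot> X) + at_ob c (U \<odot> V, W, X)"
    and "\<lbrakk>f \<in> Hom0 C U U'; g \<in> Hom0 C V V'; k \<in> Hom0 C W W'; x \<in> Hom0 C X X'\<rbrakk> \<Longrightarrow>
        f \<rtimes> along c (V,W,X) (V',W',X') (g,k,x)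
        + along c (U, V \<odot> W, X) (U', V' \<odot> W', X') (f, g \<otimes> k, x)
        + along c (U,V,W) (U',V',W') (f,g,k) \<ltimes> x
        = along c (U, V, W \<odot> X) (U', V', W' \<odot> X') (f, g, k \<otimes> x)
        + along c (U \<odot> V, W, X) (U' \<odot> V', W', X') (f \<otimes> g, k, x)"
proof -
  have id: "Arrow Z Z (\<one> Z) \<in> Arr" for Z
    by (simp add: Arr_def ident_closed)
  show "\<one> U \<otimes> at_ob c (V,W,X) + at_ob c (U, V \<odot> W, X) + at_ob c (U,V,W) \<otimes> \<one> X
      = at_ob c (U, V, W \<odot> X) + at_ob c (U \<odot> V, W, X)"
    using arg_cong[OF commutator_pentagon[OF id id id id], of at_src U V W X]
    by (simp add: c_def[symmetric] commutator_square_eq whisker_left_def whisker_right_def tens_arrow_def)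
next
  assume m: "f \<in> Hom0 C U U'" "g \<in> Hom0 C V V'" "k \<in> Hom0 C W W'" "x \<in> Hom0 C X X'"
  then have arr: "Arrow U U' f \<in> Arr" "Arrow V V' g \<in> Arr" "Arrow W W' k \<in> Arr" "Arrow X X' x \<in> Arr"
    by (simp_all add: Arr_def)
  show "f \<rtimes> along c (V,W,X) (V',W',X') (g,k,x)
        + along c (U, V \<odot> W, X) (U', V' \<odot> W', X') (f, g \<otimes> k, x)
        + along c (U,V,W) (U',V',W') (f,g,k) \<ltimes> x
        = along c (U, V, W \<odot> X) (U', V', W' \<odot> X') (f, g, k \<otimes> x)
        + along c (U \<odot> V, W, X) (U' \<odot> V', W', X') (f \<otimes> g, k, x)"
    using arg_cong[OF commutator_pentagon[OF arr], of filler]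
    by (simp add: c_def[symmetric] commutator_square_eq whisker_left_def whisker_right_def tens_arrow_def)
qed

lemma (in infinitesimally_braided) commutator_unit:
  defines "c \<equiv> tr_commutator C (t12 C t) (t23 C t)"
  shows "at_ob c (U, \<I>, V) = 0"
    and "\<lbrakk>f \<in> Hom0 C U U'; g \<in> Hom0 C V V'\<rbrakk> \<Longrightarrow> along c (U, \<I>, V) (U', \<I>, V') (f, \<one> \<I>, g) = 0"
proof -
  show "at_ob c (U, \<I>, V) = 0"
    using commutator_square_unit[of "Arrow U U (\<one> U)" "Arrow V V (\<one> V)"]
    by (simp add: c_def[symmetric] commutator_square_eq Arr_def ident_closed zero_square_def)
  assume "f \<in> Hom0 C U U'" "g \<in> Hom0 C V V'"
  then show "along c (U, \<I>, V) (U', \<I>, V') (f, \<one> \<I>, g) = 0"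
    using commutator_square_unit[of "Arrow U U' f" "Arrow V V' g"]
    by (simp add: c_def[symmetric] commutator_square_eq Arr_def zero_square_def)
qed

theorem proposition5p14:
  fixes C :: "('k::field_char_0, 'o, 'a::ab_group_add, 'b::ab_group_add) mon_cat"
    and \<gamma> :: "'o \<times> 'o \<Rightarrow> 'a"
    and t :: "('o, 'a, 'b) transf2"
  assumes "symmetric_strict_monoidal C \<gamma>"
    and "strict_infinitesimal_2braiding C \<gamma> t"
  shows "pentagonal_monoidal (scalar_ext C) (associator C t)"
proof -
  interpret infinitesimally_braided C \<gamma> t
    using assms by (rule infinitesimally_braided.intro)
  let ?c = "tr_commutator C (t12 C t) (t23 C t)"
  let ?c' = "tr_smul C (1/24) ?c"
  interpret c: pseudonatural3 C "tensor_left C" "tensor_left C" ?c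
    by (rule pseudonatural3_commutator_t12_t23)
  interpret c': perturbed_associator C ?c'
    by (intro perturbed_associator.intro perturbed_associator_axioms.intro strict_tensor
        pseudonatural3_smul tensor_left_closed pseudonatural3_commutator_t12_t23)
  have c': "at_ob ?c' s = smul0 C (1/24) (at_ob ?c s)"
    "along ?c' s s' p = smul1 C (1/24) (along ?c s s' p)" for s s' p
    by (simp_all add: tr_smul_def)
  note add = module.scale_right_distrib[OF module0, symmetric]
    module.scale_right_distrib[OF module1, symmetric]
  have "pentagonal_monoidal (scalar_ext C) (perturbation C ?c')"
  proof (rule c'.pentagonal_perturbation, unfold c', goal_cases)
    case 1 show ?case
      unfolding tens_smul(1)[OF c.at_closed ident_closed] tens_smul(2)[OF ident_closed c.at_closed]
        add pentagon_components(1) ..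
  next
    case 2 show ?case
      unfolding tens_smul(4)[OF 2(1) c.along_closed[OF 2(2,3,4)]]
        tens_smul(3)[OF c.along_closed[OF 2(1,2,3)] 2(4)] add pentagon_components(2)[OF 2] ..
  next
    case 3 show ?case
      by (simp add: commutator_unit module.scale_zero_right[OF module0])
  next
    case 4 then show ?case
      by (simp add: commutator_unit module.scale_zero_right[OF module1])
  qed
  then show ?thesis
    by (simp only: associator_eq_perturbation[OF ch_tensor_axioms])
qed

end
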